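(* For every $p > 2$, there exist two symbols $\phi_1, \phi_2 \colon \mathbb{D} \to \mathbb{D}$ having the same modulus on $\partial \mathbb{D}$ (that is, $|\phi_1^\ast| = |\phi_2^\ast|$ a.e. on $\partial\mathbb{D}$) and such that the composition operator $C_{\phi_1}$ is not compact on $H^2$, but $C_{\phi_2} \colon H^2 \to H^2$ is in the Schatten class $S_p$.
   Context: $\mathbb{D}$ is the open unit disc of $\mathbb{C}$, $\partial\mathbb{D}$ its boundary with normalized Lebesgue measure $m$, and $H^2$ the Hardy space on $\mathbb{D}$. For an analytic self-map $\phi\colon \mathbb{D}\to\mathbb{D}$, $\phi^\ast$ denotes its radial boundary value function on $\partial\mathbb{D}$ (defined a.e.), and $C_\phi\colon H^2\to H^2$, $C_\phi(f) = f\circ\phi$, is the (bounded) composition operator. A symbol is an analytic self-map $\phi$ of $\mathbb{D}$ such that $|\phi^\ast| < 1$ a.e. on $\partial\mathbb{D}$. For $p>0$, $S_p$ is the Schatten class of operators on $H^2$, i.e. the compact operators whose sequence of singular numbers is in $\ell^p$. *)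

theory Defs
  imports "HOL-Complex_Analysis.Complex_Analysis"
begin

section \<open>The Hardy space of the unit disc\<close>

definition taylor_coeff :: "(complex \<Rightarrow> complex) \<Rightarrow> nat \<Rightarrow> complex" where
  "taylor_coeff f n = (deriv ^^ n) f 0 / fact n"

lemma taylor_coeff_0: "taylor_coeff (\<lambda>_. 0) n = 0"
  by (simp add: taylor_coeff_def)

lemma taylor_coeff_add:
  assumes "f holomorphic_on ball 0 1" "g holomorphic_on ball 0 1"
  shows "taylor_coeff (\<lambda>z. f z + g z) n = taylor_coeff f n + taylor_coeff g n"
  using higher_deriv_add[OF assms, of 0 n] by (simp add: taylor_coeff_def add_divide_distrib)

lemma taylor_coeff_cmult:
  assumes "f holomorphic_on ball 0 1"
  shows "taylor_coeff (\<lambda>z. c * f z) n = c * taylor_coeff f n"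
  using higher_deriv_cmult[OF assms, of 0 n c] by (simp add: taylor_coeff_def)

lemma summable_sq_add:
  fixes a b :: "nat \<Rightarrow> complex"
  assumes "summable (\<lambda>n. (cmod (a n))\<^sup>2)" "summable (\<lambda>n. (cmod (b n))\<^sup>2)"
  shows "summable (\<lambda>n. (cmod (a n + b n))\<^sup>2)"
proof (rule summable_comparison_test')
  show "summable (\<lambda>n. 2 * ((cmod (a n))\<^sup>2 + (cmod (b n))\<^sup>2))"
    by (intro summable_mult summable_add assms)
  show "norm ((cmod (a n + b n))\<^sup>2) \<le> 2 * ((cmod (a n))\<^sup>2 + (cmod (b n))\<^sup>2)" for n
  proof -
    have "(cmod (a n + b n))\<^sup>2 \<le> (cmod (a n) + cmod (b n))\<^sup>2"
      by (intro power_mono norm_triangle_ineq) auto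
    also have "\<dots> \<le> 2 * ((cmod (a n))\<^sup>2 + (cmod (b n))\<^sup>2)"
      using sum_squares_bound[of "cmod (a n)" "cmod (b n)"]
      by (simp add: power2_eq_square algebra_simps)
    finally show ?thesis by simp
  qed
qed

text \<open>Functions are only relevant on the disc; they are normalised to vanish outside it, so that
  equality of elements of the type is equality on the disc.\<close>

typedef hardy2 = "{f. f holomorphic_on ball 0 1 \<and> (\<forall>z. z \<notin> ball 0 1 \<longrightarrow> f z = 0) \<and>
    summable (\<lambda>n. (cmod (taylor_coeff f n))\<^sup>2)}"
  morphisms hardy2_fun Abs_hardy2
  by (rule exI[of _ "\<lambda>_. 0"]) (simp add: taylor_coeff_0)

setup_lifting type_definition_hardy2

lemma hardy2_holomorphic: "hardy2_fun f holomorphic_on ball 0 1"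
  and hardy2_outside: "z \<notin> ball 0 1 \<Longrightarrow> hardy2_fun f z = 0"
  and hardy2_summable: "summable (\<lambda>n. (cmod (taylor_coeff (hardy2_fun f) n))\<^sup>2)"
  using hardy2_fun[of f] by auto

lemma summable_taylor_cmult:
  assumes "f holomorphic_on ball 0 1" "summable (\<lambda>n. (cmod (taylor_coeff f n))\<^sup>2)"
  shows "summable (\<lambda>n. (cmod (taylor_coeff (\<lambda>z. c * f z) n))\<^sup>2)"
  using summable_mult[OF assms(2), of "(cmod c)\<^sup>2"]
  by (simp add: taylor_coeff_cmult[OF assms(1)] norm_mult power_mult_distrib)

lift_definition hardy2_scaleC :: "complex \<Rightarrow> hardy2 \<Rightarrow> hardy2" is "\<lambda>c f z. c * f z"
  by (auto intro!: holomorphic_intros summable_taylor_cmult)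

instantiation hardy2 :: real_inner
begin

lift_definition zero_hardy2 :: hardy2 is "\<lambda>_. 0"
  by (simp add: taylor_coeff_0)

lift_definition plus_hardy2 :: "hardy2 \<Rightarrow> hardy2 \<Rightarrow> hardy2" is "\<lambda>f g z. f z + g z"
  by (auto intro!: holomorphic_intros summable_sq_add simp: taylor_coeff_add)

definition uminus_hardy2 :: "hardy2 \<Rightarrow> hardy2" where
  "uminus_hardy2 f = hardy2_scaleC (- 1) f"

definition minus_hardy2 :: "hardy2 \<Rightarrow> hardy2 \<Rightarrow> hardy2" where
  "minus_hardy2 f g = f + - g"

definition scaleR_hardy2 :: "real \<Rightarrow> hardy2 \<Rightarrow> hardy2" where
  "scaleR_hardy2 c f = hardy2_scaleC (complex_of_real c) f"

text \<open>The real part of the complex inner product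
  \<open>\<Sum>n. taylor_coeff f n * cnj (taylor_coeff g n)\<close>.\<close>

definition inner_hardy2 :: "hardy2 \<Rightarrow> hardy2 \<Rightarrow> real" where
  "inner_hardy2 f g =
     Re (\<Sum>n. taylor_coeff (hardy2_fun f) n * cnj (taylor_coeff (hardy2_fun g) n))"

definition norm_hardy2 :: "hardy2 \<Rightarrow> real" where
  "norm_hardy2 f = sqrt (\<Sum>n. (cmod (taylor_coeff (hardy2_fun f) n))\<^sup>2)"

definition sgn_hardy2 :: "hardy2 \<Rightarrow> hardy2" where
  "sgn_hardy2 f = inverse (norm f) *\<^sub>R f"

definition dist_hardy2 :: "hardy2 \<Rightarrow> hardy2 \<Rightarrow> real" where
  "dist_hardy2 f g = norm (f - g)"

definition uniformity_hardy2 :: "(hardy2 \<times> hardy2) filter" where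
  "uniformity_hardy2 = (INF e\<in>{0 <..}. principal {(f, g). dist f g < e})"

definition open_hardy2 :: "hardy2 set \<Rightarrow> bool" where
  "open_hardy2 U \<longleftrightarrow> (\<forall>f\<in>U. eventually (\<lambda>(f', g). f' = f \<longrightarrow> g \<in> U) uniformity)"

lemma hardy2_summable_inner:
  "summable (\<lambda>n. taylor_coeff (hardy2_fun f) n * cnj (taylor_coeff (hardy2_fun g) n))"
proof (rule summable_comparison_test')
  let ?a = "\<lambda>n. cmod (taylor_coeff (hardy2_fun f) n)"
  let ?b = "\<lambda>n. cmod (taylor_coeff (hardy2_fun g) n)"
  show "summable (\<lambda>n. (?a n)\<^sup>2 + (?b n)\<^sup>2)"
    by (intro summable_add hardy2_summable)
  show "norm (taylor_coeff (hardy2_fun f) n * cnj (taylor_coeff (hardy2_fun g) n))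
      \<le> (?a n)\<^sup>2 + (?b n)\<^sup>2" for n
  proof -
    have "0 \<le> ?a n * ?b n" by simp
    with sum_squares_bound[of "?a n" "?b n"] have "?a n * ?b n \<le> (?a n)\<^sup>2 + (?b n)\<^sup>2"
      by linarith
    then show ?thesis by (simp add: norm_mult)
  qed
qed

lemma taylor_coeff_plus_hardy2:
  "taylor_coeff (hardy2_fun (f + g)) n
     = taylor_coeff (hardy2_fun f) n + taylor_coeff (hardy2_fun g) n"
  by (simp add: plus_hardy2.rep_eq taylor_coeff_add hardy2_holomorphic)

lemma taylor_coeff_scaleC_hardy2:
  "taylor_coeff (hardy2_fun (hardy2_scaleC c f)) n = c * taylor_coeff (hardy2_fun f) n"
  by (simp add: hardy2_scaleC.rep_eq taylor_coeff_cmult hardy2_holomorphic)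

lemma hardy2_fun_minus: "hardy2_fun (- f) = (\<lambda>z. - hardy2_fun f z)"
  by (simp add: uminus_hardy2_def hardy2_scaleC.rep_eq)

lemma hardy2_eq_0:
  assumes "\<And>n. taylor_coeff (hardy2_fun f) n = 0"
  shows "f = 0"
proof -
  have "hardy2_fun f z = 0" for z
  proof (cases "z \<in> ball 0 1")
    case True
    have "(deriv ^^ n) (hardy2_fun f) 0 = 0" for n
      using assms[of n] by (simp add: taylor_coeff_def)
    then show ?thesis
      by (rule holomorphic_fun_eq_0_on_ball[OF hardy2_holomorphic True])
  qed (rule hardy2_outside)
  then show ?thesis
    by (simp add: hardy2_fun_inject[symmetric] zero_hardy2.rep_eq fun_eq_iff)
qed

lemma inner_hardy2_self:
  "inner f f = (\<Sum>n. (cmod (taylor_coeff (hardy2_fun f) n))\<^sup>2)" for f :: hardy2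
  unfolding inner_hardy2_def complex_norm_square[symmetric]
    suminf_of_real[OF hardy2_summable, symmetric]
  by (rule Re_complex_of_real)

instance
proof
  fix f g h :: hardy2 and a b :: real
  show "f + g + h = f + (g + h)" by transfer (simp add: add.assoc)
  show "f + g = g + f" by transfer (simp add: add.commute)
  show "0 + f = f" by transfer simp
  show "- f + f = 0"
    by (simp add: hardy2_fun_inject[symmetric] plus_hardy2.rep_eq hardy2_fun_minus zero_hardy2.rep_eq)
  show "f - g = f + - g" by (rule minus_hardy2_def)
  show "a *\<^sub>R (f + g) = a *\<^sub>R f + a *\<^sub>R g"
    unfolding scaleR_hardy2_def by transfer (simp add: ring_distribs)
  show "(a + b) *\<^sub>R f = a *\<^sub>R f + b *\<^sub>R f"
    unfolding scaleR_hardy2_def by transfer (simp add: ring_distribs)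
  show "a *\<^sub>R b *\<^sub>R f = (a * b) *\<^sub>R f"
    unfolding scaleR_hardy2_def by transfer (simp add: mult.assoc)
  show "1 *\<^sub>R f = f"
    unfolding scaleR_hardy2_def by transfer simp
  show "sgn f = inverse (norm f) *\<^sub>R f" by (rule sgn_hardy2_def)
  show "dist f g = norm (f - g)" by (rule dist_hardy2_def)
  show "uniformity = (INF e\<in>{0 <..}. principal {(f :: hardy2, g). dist f g < e})"
    by (rule uniformity_hardy2_def)
  show "open U \<longleftrightarrow> (\<forall>f\<in>U. eventually (\<lambda>(f', g). f' = f \<longrightarrow> g \<in> U) uniformity)"
    for U :: "hardy2 set"
    by (rule open_hardy2_def)
  show "inner f g = inner g f"
    unfolding inner_hardy2_def
    by (subst (1 2) Re_suminf) (simp_all add: hardy2_summable_inner mult.commute)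
  show "inner (f + g) h = inner f h + inner g h"
    unfolding inner_hardy2_def
    by (simp add: taylor_coeff_plus_hardy2 ring_distribs
        suminf_add[OF hardy2_summable_inner hardy2_summable_inner, symmetric])
  show "inner (a *\<^sub>R f) g = a * inner f g"
    unfolding inner_hardy2_def scaleR_hardy2_def taylor_coeff_scaleC_hardy2 mult.assoc
      suminf_mult[OF hardy2_summable_inner]
    by simp
  show "0 \<le> inner f f"
    unfolding inner_hardy2_self by (intro suminf_nonneg hardy2_summable) simp
  show "inner f f = 0 \<longleftrightarrow> f = 0"
  proof
    assume "inner f f = 0"
    then have "\<forall>n. (cmod (taylor_coeff (hardy2_fun f) n))\<^sup>2 = 0"
      unfolding inner_hardy2_self by (subst (asm) suminf_eq_zero_iff) (simp_all add: hardy2_summable)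
    then show "f = 0" by (intro hardy2_eq_0) simp
  qed (simp add: inner_hardy2_self zero_hardy2.rep_eq taylor_coeff_0)
  show "norm f = sqrt (inner f f)"
    by (simp add: norm_hardy2_def inner_hardy2_self)
qed

end

interpretation hardy2: vector_space hardy2_scaleC
  by unfold_locales (transfer; simp add: ring_distribs mult.assoc)+


section \<open>Symbols and composition operators\<close>

definition circle_measure :: "complex measure" where
  "circle_measure =
     distr (uniform_measure lborel {0..2 * pi}) (restrict_space borel (sphere 0 1)) cis"

lemma emeasure_circle_measure: "emeasure circle_measure (sphere 0 1) = 1"
proof -
  have "cis \<in> borel_measurable borel"
    by (intro borel_measurable_continuous_onI continuous_intros)
  then have "cis \<in> uniform_measure lborel {0..2 * pi} \<rightarrow>\<^sub>M restrict_space borel (sphere 0 1)"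
    by (intro measurable_restrict_space2) auto
  moreover have "cis -` sphere 0 1 = UNIV" by auto
  ultimately show ?thesis
    by (simp add: circle_measure_def emeasure_distr sets_restrict_space_iff)
qed

text \<open>For a bounded holomorphic \<open>\<phi>\<close> the limit exists at almost every point of the circle (Fatou);
  elsewhere the value is unspecified.\<close>

definition radial_limit :: "(complex \<Rightarrow> complex) \<Rightarrow> complex \<Rightarrow> complex" where
  "radial_limit \<phi> \<zeta> = Lim (at_left 1) (\<lambda>r. \<phi> (complex_of_real r * \<zeta>))"

definition symbol :: "(complex \<Rightarrow> complex) \<Rightarrow> bool" where
  "symbol \<phi> \<longleftrightarrow> \<phi> holomorphic_on ball 0 1 \<and> \<phi> ` ball 0 1 \<subseteq> ball 0 1 \<and>
     (AE \<zeta> in circle_measure. cmod (radial_limit \<phi> \<zeta>) < 1)"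

text \<open>For every holomorphic self-map \<open>\<phi>\<close> of the disc, the composition of a function in the Hardy
  space with \<open>\<phi>\<close> is again in the Hardy space (Littlewood's subordination principle), so
  \<open>Abs_hardy2\<close> is applied to an element of the defining set.\<close>

definition composition_operator :: "(complex \<Rightarrow> complex) \<Rightarrow> hardy2 \<Rightarrow> hardy2" where
  "composition_operator \<phi> f =
     Abs_hardy2 (\<lambda>z. if z \<in> ball 0 1 then hardy2_fun f (\<phi> z) else 0)"


section \<open>Compact operators and Schatten classes\<close>

text \<open>To be used for linear maps \<open>T\<close>.\<close>

definition compact_operator :: "(hardy2 \<Rightarrow> hardy2) \<Rightarrow> bool" where
  "compact_operator T \<longleftrightarrow> compact (closure (T ` cball 0 1))"

text \<open>The library's \<^const>\<open>adjoint\<close> refers to the real inner product; for complex-linear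
  \<open>T\<close> it is also the adjoint for the complex inner product (replace \<open>f\<close> by \<open>\<i> f\<close>
  to compare the imaginary parts). The dimension below is over the complex numbers.

  The sequence \<open>s\<close> lists the square roots of the eigenvalues of \<open>T\<^sup>* T\<close> in nonincreasing order,
  each positive one as often as its multiplicity, and continues with zeros if there are only
  finitely many positive ones. For a compact operator \<open>T\<close> there is exactly one such sequence.\<close>

definition singular_numbers :: "(hardy2 \<Rightarrow> hardy2) \<Rightarrow> (nat \<Rightarrow> real) \<Rightarrow> bool" where
  "singular_numbers T s \<longleftrightarrow> decseq s \<and> (\<forall>n. 0 \<le> s n) \<and> s \<longlonglongrightarrow> 0 \<and>
     (\<forall>\<sigma>>0. card {n. s n = \<sigma>} =
        hardy2.dim {f. adjoint T (T f) = hardy2_scaleC (complex_of_real (\<sigma>\<^sup>2)) f})"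

definition schatten_class :: "real \<Rightarrow> (hardy2 \<Rightarrow> hardy2) set" where
  "schatten_class p = {T. Vector_Spaces.linear hardy2_scaleC hardy2_scaleC T \<and>
     compact_operator T \<and> (\<exists>s. singular_numbers T s \<and> summable (\<lambda>n. s n powr p))}"

end

theory Submission
  imports Defs
begin

text \<open>Write \<open>u = (1 + z) / 2\<close>, \<open>s = (1 - z) / (1 + z)\<close> and \<open>U(u) = u / 4 - u\<^sup>\<alpha> / 32\<close> with
  \<open>1 < \<alpha> < 2\<close>. The symbols are \<open>exp (- U)\<close> and \<open>exp (- U - s)\<close>; they differ by the factor
  \<open>exp (- s)\<close>, a singular inner function with its mass at \<open>-1\<close>. On the circle \<open>Re U\<close> is comparable to
  \<open>|u|\<^sup>\<alpha>\<close>, and on the radius to \<open>-1\<close> it is at most \<open>u / 4\<close>. Hence the first symbol has a finite angular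
  derivative at \<open>-1\<close>, and normalised reproducing kernels show that its composition operator is not
  compact. The inner factor makes the boundary curve of the second symbol wind around the origin
  infinitely often near \<open>-1\<close>: with \<open>x = tan (\<tau> / 2)\<close>, the part \<open>k \<le> x \<le> k + 1\<close> of the curve is nearly
  an arc of a circle centred at the origin and carries only the mass \<open>1 / k\<^sup>2\<close>. So \<open>|f \<circ> \<phi>|\<^sup>2 / h\<close> with
  \<open>h = sqrt |u|\<close> is integrable over the circle with integral at most \<open>C |f|\<^sup>2\<close>.

  Since \<open>1 \<le> c / h + (h / c)\<^sup>q\<^sup>-\<^sup>1\<close>, this gives
  \<open>|T f|\<^sup>2 \<le> c C |f|\<^sup>2 + c\<^sup>1\<^sup>-\<^sup>q \<integral> |f \<circ> \<phi>|\<^sup>2 h\<^sup>q\<^sup>-\<^sup>1\<close> for all \<open>c > 0\<close>. With \<open>c\<close> a multiple of \<open>|T v|\<^sup>2\<close>, a unit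
  vector \<open>v\<close> satisfies \<open>|T v|\<^sup>2\<^sup>q \<le> C' \<integral> |v \<circ> \<phi>|\<^sup>2 h\<^sup>q\<^sup>-\<^sup>1\<close>. Summing over orthonormal eigenvectors of
  \<open>T\<^sup>* T\<close>, whose squared values at a point \<open>w\<close> add up to at most \<open>1 / (1 - |w|\<^sup>2)\<close>, bounds the sum of
  the powers \<open>2 q = p\<close> of the singular numbers.\<close>

section \<open>The Hardy space\<close>

text \<open>Compactness is decided by the radius to -1, the Schatten class by the circle, and
  \<open>U\<close> has to behave differently on the two. The circle is
  \<open>Re u = |u|\<^sup>2\<close>, so with \<open>u / 4\<close> alone the kernel integral would be
  that of \<open>|u|\<close> to the power (q - 1) / 2 - 2, which is finite only for q > 3, that is p
  > 6. The term with \<alpha> > 1 repairs this: \<open>u\<^sup>\<alpha>\<close> has negative real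
  part in the tangential directions, where \<open>Re u\<close> is too small, and positive real part
  only in a sector around the radius, where \<open>u / 4\<close> outweighs it. The power becomes (q
  - 1) / 2 - \<alpha>, which exceeds -1 for every q > 1 once \<alpha> is close enough to 1. The
  small coefficients leave the winding of the second symbol to its inner factor.

  Boundary values of general functions in the Hardy space never occur. The estimates are proved for
  polynomials, whose composites are continuous on the circle without -1, and are carried over by
  truncation; that composites with the second symbol stay in the Hardy space comes out of the same
  estimates.\<close>

abbreviation hcoeff :: "hardy2 \<Rightarrow> nat \<Rightarrow> complex" where
  "hcoeff f \<equiv> taylor_coeff (hardy2_fun f)"

lemma hcoeff_zero [simp]: "hcoeff 0 n = 0"
  by (simp add: zero_hardy2.rep_eq taylor_coeff_0)

lemma hcoeff_diff: "hcoeff (f - g) n = hcoeff f n - hcoeff g n"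
  unfolding minus_hardy2_def uminus_hardy2_def taylor_coeff_plus_hardy2 taylor_coeff_scaleC_hardy2
  by simp

lemma hcoeff_sum: "hcoeff (sum F I) n = (\<Sum>i\<in>I. hcoeff (F i) n)"
  by (induction I rule: infinite_finite_induct) (auto simp: taylor_coeff_plus_hardy2)

lemma hardy2_eqI_hcoeff: "(\<And>n. hcoeff f n = hcoeff g n) \<Longrightarrow> f = g"
  using hardy2_eq_0[of "f - g"] by (simp add: hcoeff_diff)

lemma hardy2_fun_diff: "hardy2_fun (f - g) z = hardy2_fun f z - hardy2_fun g z"
  unfolding minus_hardy2_def plus_hardy2.rep_eq hardy2_fun_minus by simp

lemma hardy2_fun_sum: "hardy2_fun (sum F I) z = (\<Sum>i\<in>I. hardy2_fun (F i) z)"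
  by (induction I rule: infinite_finite_induct) (auto simp: plus_hardy2.rep_eq zero_hardy2.rep_eq)

section \<open>Taylor coefficients and square-summable sequences\<close>

lemma holomorphic_sums_taylor_coeff:
  assumes "f holomorphic_on ball 0 1" "cmod z < 1"
  shows "(\<lambda>n. taylor_coeff f n * z ^ n) sums f z"
  using holomorphic_power_series[OF assms(1), of z] assms(2) by (simp add: taylor_coeff_def)

lemma hardy2_sums:
  assumes "cmod z < 1"
  shows "(\<lambda>n. hcoeff f n * z ^ n) sums hardy2_fun f z"
  by (rule holomorphic_sums_taylor_coeff[OF hardy2_holomorphic assms])

lemma norm_hardy2_sq: "(norm f)\<^sup>2 = (\<Sum>n. (cmod (hcoeff f n))\<^sup>2)"
  using inner_hardy2_self[of f] by (simp only: power2_norm_eq_inner)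

lemma summable_sq_imp_powser:
  fixes a :: "nat \<Rightarrow> complex"
  assumes a: "summable (\<lambda>n. (cmod (a n))\<^sup>2)" and z: "cmod z < 1"
  shows "summable (\<lambda>n. a n * z ^ n)" "summable (\<lambda>n. cmod (a n * z ^ n))"
proof -
  have z2: "(cmod z)\<^sup>2 < 1"
    using z by (simp add: abs_square_less_1)
  show 2: "summable (\<lambda>n. cmod (a n * z ^ n))"
  proof (rule summable_comparison_test')
    show "summable (\<lambda>n. (cmod (a n))\<^sup>2 + ((cmod z)\<^sup>2) ^ n)"
      using z2 by (intro summable_add a summable_geometric) auto
    show "norm (cmod (a n * z ^ n)) \<le> (cmod (a n))\<^sup>2 + ((cmod z)\<^sup>2) ^ n" for n
    proof -
      have "0 \<le> cmod (a n) * cmod z ^ n" by simp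
      with sum_squares_bound[of "cmod (a n)" "cmod z ^ n"]
      have "cmod (a n) * cmod z ^ n \<le> (cmod (a n))\<^sup>2 + (cmod z ^ n)\<^sup>2"
        by linarith
      then show ?thesis by (simp add: norm_mult norm_power power_mult[symmetric] mult.commute)
    qed
  qed
  then show "summable (\<lambda>n. a n * z ^ n)" by (rule summable_norm_cancel)
qed

lemma taylor_coeff_cong:
  assumes "\<And>z. cmod z < 1 \<Longrightarrow> f z = g z"
  shows "taylor_coeff f n = taylor_coeff g n"
proof -
  have "(deriv ^^ n) f 0 = (deriv ^^ n) g 0"
    by (rule higher_deriv_cong_ev)
       (auto intro!: eventually_nhds_in_open[of "ball 0 1", THEN eventually_mono] simp: assms)
  then show ?thesis by (simp add: taylor_coeff_def)
qed

lemma taylor_coeff_powser: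
  fixes a :: "nat \<Rightarrow> complex"
  assumes sums: "\<And>z. cmod z < 1 \<Longrightarrow> (\<lambda>n. a n * z ^ n) sums f z"
  shows "f holomorphic_on ball 0 1" "taylor_coeff f n = a n"
proof -
  show "f holomorphic_on ball 0 1"
    by (rule power_series_holomorphic[of 0 1 a]) (use sums in simp)
  let ?F = "Abs_fps a"
  have "fps_conv_radius ?F \<ge> 1"
    unfolding fps_conv_radius_def
  proof (rule conv_radius_geI_ex')
    fix r :: real assume "0 < r" "ereal r < 1"
    then show "summable (\<lambda>n. fps_nth ?F n * of_real r ^ n)"
      using sums[of "of_real r"] by (simp add: sums_iff)
  qed
  then have "fps_nth ?F n = taylor_coeff (eval_fps ?F) n"
    unfolding taylor_coeff_def
    by (intro fps_nth_conv_deriv) (use less_le_trans[of 0 "1::ereal"] in auto)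
  also have "\<dots> = taylor_coeff f n"
    by (rule taylor_coeff_cong) (use sums in \<open>simp add: eval_fps_def sums_iff\<close>)
  finally show "taylor_coeff f n = a n" by simp
qed

text \<open>The inverse of the coefficient map on square-summable sequences. For other sequences the
  value carries no information, so summability has to be established before
  \<open>hcoeff_hardy2_of\<close> can be used.\<close>

definition hardy2_of :: "(nat \<Rightarrow> complex) \<Rightarrow> hardy2" where
  "hardy2_of a = Abs_hardy2 (\<lambda>z. if z \<in> ball 0 1 then (\<Sum>n. a n * z ^ n) else 0)"

lemma hardy2_fun_Abs:
  assumes f: "f holomorphic_on ball 0 1" and s: "summable (\<lambda>n. (cmod (taylor_coeff f n))\<^sup>2)"
  defines "g \<equiv> (\<lambda>z. if z \<in> ball 0 1 then f z else 0)"
  shows "hardy2_fun (Abs_hardy2 g) = g" "hcoeff (Abs_hardy2 g) n = taylor_coeff f n"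
proof -
  have *: "taylor_coeff g n = taylor_coeff f n" for n
    by (rule taylor_coeff_cong) (simp add: g_def)
  have "g holomorphic_on ball 0 1"
    using f by (rule holomorphic_transform) (simp add: g_def)
  then show 1: "hardy2_fun (Abs_hardy2 g) = g"
    by (intro Abs_hardy2_inverse) (use s in \<open>simp add: *, simp add: g_def\<close>)
  show "hcoeff (Abs_hardy2 g) n = taylor_coeff f n"
    by (simp add: 1 *)
qed

lemma hcoeff_hardy2_of:
  assumes "summable (\<lambda>n. (cmod (a n))\<^sup>2)"
  shows "hcoeff (hardy2_of a) n = a n"
proof -
  let ?f = "\<lambda>z. \<Sum>n. a n * z ^ n"
  have "(\<lambda>n. a n * z ^ n) sums ?f z" if "cmod z < 1" for z
    using summable_sq_imp_powser(1)[OF assms that] by (rule summable_sums)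
  note * = taylor_coeff_powser[OF this]
  show ?thesis
    unfolding hardy2_of_def using hardy2_fun_Abs(2)[OF *(1)] assms by (simp add: *)
qed

definition hbasis :: "nat \<Rightarrow> hardy2" where
  "hbasis m = hardy2_of (\<lambda>n. if n = m then 1 else 0)"

definition htrunc :: "nat \<Rightarrow> hardy2 \<Rightarrow> hardy2" where
  "htrunc N f = (\<Sum>n<N. hardy2_scaleC (hcoeff f n) (hbasis n))"

lemma hcoeff_hbasis: "hcoeff (hbasis m) n = (if n = m then 1 else 0)"
proof -
  have "summable (\<lambda>n. (cmod (if n = m then 1 else 0))\<^sup>2)"
    by (rule summable_finite[of "{m}"]) auto
  from hcoeff_hardy2_of[OF this] show ?thesis by (simp add: hbasis_def)
qed

lemma hcoeff_htrunc: "hcoeff (htrunc N f) n = (if n < N then hcoeff f n else 0)"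
proof -
  have "hcoeff (htrunc N f) n = (\<Sum>i<N. if i = n then hcoeff f n else 0)"
    unfolding htrunc_def hcoeff_sum taylor_coeff_scaleC_hardy2 hcoeff_hbasis
    by (intro sum.cong) auto
  then show ?thesis by simp
qed

lemma htrunc_tendsto: "(\<lambda>N. htrunc N f) \<longlonglongrightarrow> f"
proof -
  let ?a = "\<lambda>n. (cmod (hcoeff f n))\<^sup>2"
  have "(norm (htrunc N f - f))\<^sup>2 = suminf ?a - sum ?a {..<N}" for N
  proof -
    have "(\<lambda>n. ?a n - (if n \<in> {..<N} then ?a n else 0)) sums (suminf ?a - sum ?a {..<N})"
      by (intro sums_diff summable_sums hardy2_summable sums_If_finite_set) simp
    also have "(\<lambda>n. ?a n - (if n \<in> {..<N} then ?a n else 0)) = (\<lambda>n. (cmod (hcoeff (htrunc N f - f) n))\<^sup>2)"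
      by (auto simp: fun_eq_iff hcoeff_diff hcoeff_htrunc)
    finally show ?thesis unfolding norm_hardy2_sq by (simp add: sums_iff)
  qed
  moreover have "(\<lambda>N. suminf ?a - sum ?a {..<N}) \<longlonglongrightarrow> suminf ?a - suminf ?a"
    by (intro tendsto_intros summable_LIMSEQ hardy2_summable)
  ultimately have "(\<lambda>N. (norm (htrunc N f - f))\<^sup>2) \<longlonglongrightarrow> 0" by simp
  from tendsto_real_sqrt[OF this] have "(\<lambda>N. norm (htrunc N f - f)) \<longlonglongrightarrow> 0" by simp
  then show ?thesis by (simp only: tendsto_norm_zero_iff LIM_zero_iff)
qed

text \<open>The type class supplies only the real part of this product. Orthogonality over the
  complex scalars, as it is needed to compute \<open>hardy2.dim\<close>, refers to the full
  product.\<close>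

definition cinner :: "hardy2 \<Rightarrow> hardy2 \<Rightarrow> complex" where
  "cinner f g = (\<Sum>n. hcoeff f n * cnj (hcoeff g n))"

lemma cinner_sums: "(\<lambda>n. hcoeff f n * cnj (hcoeff g n)) sums cinner f g"
  unfolding cinner_def by (rule summable_sums[OF hardy2_summable_inner])

lemma inner_eq_Re_cinner: "inner f g = Re (cinner f g)"
  by (simp add: inner_hardy2_def cinner_def)

lemma cinner_eqI: "(\<lambda>n. hcoeff f n * cnj (hcoeff g n)) sums c \<Longrightarrow> cinner f g = c"
  using cinner_sums sums_unique2 by blast

lemma cinner_add_left: "cinner (f + g) h = cinner f h + cinner g h"
  using sums_add[OF cinner_sums[of f h] cinner_sums[of g h]]
  by (intro cinner_eqI) (simp add: taylor_coeff_plus_hardy2 ring_distribs)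

lemma cinner_scaleC_left: "cinner (hardy2_scaleC c f) h = c * cinner f h"
  using sums_mult[OF cinner_sums[of f h], of c]
  by (intro cinner_eqI) (simp add: taylor_coeff_scaleC_hardy2 mult.assoc)

lemma cinner_commute: "cinner f g = cnj (cinner g f)"
  using cinner_sums[of g f]
  by (intro cinner_eqI, subst (asm) sums_cnj[symmetric]) (simp add: mult.commute)

lemma cinner_scaleC_right: "cinner h (hardy2_scaleC c f) = cnj c * cinner h f"
  using cinner_scaleC_left[of c f h] by (simp add: cinner_commute[of h])

lemma cinner_zero [simp]: "cinner 0 f = 0" "cinner f 0 = 0"
  by (simp_all add: cinner_def)

lemma cinner_diff_left: "cinner (f - g) h = cinner f h - cinner g h"
  using cinner_add_left[of "f - g" g h] by simp

lemma cinner_sum_left: "cinner (sum F I) h = (\<Sum>i\<in>I. cinner (F i) h)"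
  by (induction I rule: infinite_finite_induct) (auto simp: cinner_add_left)

lemma cinner_self: "cinner f f = of_real ((norm f)\<^sup>2)"
  unfolding cinner_def norm_hardy2_sq complex_norm_square[symmetric]
    suminf_of_real[OF hardy2_summable, symmetric] by simp

lemma norm_scaleC: "norm (hardy2_scaleC c f) = cmod c * norm f"
proof -
  have "(norm (hardy2_scaleC c f))\<^sup>2 = (cmod c * norm f)\<^sup>2"
    unfolding power_mult_distrib norm_hardy2_sq taylor_coeff_scaleC_hardy2 norm_mult
    by (rule suminf_mult[OF hardy2_summable])
  then show ?thesis by (rule power2_eq_imp_eq) auto
qed

lemma cmod_cinner_le: "cmod (cinner f g) \<le> norm f * norm g"
proof -
  \<comment> \<open>A rotation that makes the product real and nonnegative, so that the real
    Cauchy-Schwarz inequality applies. If the product is zero, division by zero gives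
    \<open>c = 0\<close>; hence the norm is only claimed not to increase.\<close>
  define c where "c = cnj (cinner f g) / of_real (cmod (cinner f g))"
  have "c * cinner f g = of_real (cmod (cinner f g))"
  proof (cases "cinner f g = 0")
    case False
    have "c * cinner f g = (cinner f g * cnj (cinner f g)) / of_real (cmod (cinner f g))"
      by (simp add: c_def)
    also have "\<dots> = of_real ((cmod (cinner f g))\<^sup>2 / cmod (cinner f g))"
      by (simp add: complex_norm_square[symmetric])
    finally show ?thesis using False by (simp add: power2_eq_square)
  qed (simp add: c_def)
  then have "cmod (cinner f g) = inner (hardy2_scaleC c f) g"
    by (simp add: inner_eq_Re_cinner cinner_scaleC_left)
  also have "\<dots> \<le> norm (hardy2_scaleC c f) * norm g"
    by (rule norm_cauchy_schwarz)
  also have "norm (hardy2_scaleC c f) \<le> norm f"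
    unfolding norm_scaleC by (rule mult_left_le_one_le) (auto simp: c_def norm_divide)
  finally show ?thesis by (simp add: mult_right_mono)
qed

lemma cinner_hbasis: "cinner f (hbasis n) = hcoeff f n"
proof (rule cinner_eqI)
  show "(\<lambda>m. hcoeff f m * cnj (hcoeff (hbasis n) m)) sums hcoeff f n"
    using sums_single[of n "hcoeff f"]
    by (rule sums_cong[THEN iffD1, rotated]) (auto simp: hcoeff_hbasis)
qed

lemma cmod_hcoeff_le: "cmod (hcoeff f n) \<le> norm f"
proof -
  have "(cmod (hcoeff f n))\<^sup>2 = (\<Sum>i\<in>{n}. (cmod (hcoeff f i))\<^sup>2)" by simp
  also have "\<dots> \<le> (norm f)\<^sup>2"
    unfolding norm_hardy2_sq by (intro sum_le_suminf hardy2_summable) auto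
  finally show ?thesis by (simp add: power2_le_iff_abs_le)
qed

text \<open>\<open>k\<close> is the reproducing kernel at \<open>z\<close>: evaluation is the inner
  product with it, and its norm is a geometric series.\<close>

lemma hardy2_eval_bound:
  assumes z: "cmod z < 1"
  shows "(cmod (hardy2_fun f z))\<^sup>2 \<le> (norm f)\<^sup>2 / (1 - (cmod z)\<^sup>2)"
proof -
  have z2: "(cmod z)\<^sup>2 < 1" using z by (simp add: abs_square_less_1)
  define k where "k = hardy2_of (\<lambda>n. cnj z ^ n)"
  have s: "(\<lambda>n. (cmod (cnj z ^ n))\<^sup>2) sums (1 / (1 - (cmod z)\<^sup>2))"
    using geometric_sums[of "(cmod z)\<^sup>2"] z2
    by (simp add: norm_power power_mult[symmetric] mult.commute)
  then have ck: "hcoeff k n = cnj z ^ n" for n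
    unfolding k_def by (intro hcoeff_hardy2_of) (simp add: sums_iff)
  have nk: "(norm k)\<^sup>2 = 1 / (1 - (cmod z)\<^sup>2)"
    unfolding norm_hardy2_sq ck using s by (simp add: sums_iff)
  have "hardy2_fun f z = cinner f k"
    using hardy2_sums[OF z, of f] by (intro cinner_eqI[symmetric]) (simp add: ck)
  then have "(cmod (hardy2_fun f z))\<^sup>2 \<le> (norm f * norm k)\<^sup>2"
    using cmod_cinner_le[of f k] by (intro power_mono) auto
  then show ?thesis by (simp add: power_mult_distrib nk)
qed

section \<open>Compactness and adjoints\<close>

lemma cnj_cinner [simp]: "cnj (cinner f g) = cinner g f"
  by (rule cinner_commute[symmetric])

lemma cinner_hbasis_left: "cinner (hbasis n) f = cnj (hcoeff f n)"
  by (simp flip: cinner_hbasis)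

lemma hardy2_fun_measurable: "hardy2_fun f \<in> borel_measurable borel"
proof -
  have "(\<lambda>z. if z \<in> ball 0 1 then hardy2_fun f z else 0) \<in> borel_measurable borel"
    by (intro borel_measurable_continuous_on_if holomorphic_on_imp_continuous_on
        hardy2_holomorphic) auto
  also have "(\<lambda>z. if z \<in> ball 0 1 then hardy2_fun f z else 0) = hardy2_fun f"
    by (auto simp: fun_eq_iff hardy2_outside)
  finally show ?thesis .
qed

text \<open>The assumptions describe weakly null sequences. The terms of the power series are
  dominated by \<open>B * cmod z ^ k\<close>, so limit and sum may be exchanged.\<close>

lemma hardy2_eval_tendsto_0:
  assumes "\<And>k. (\<lambda>n. hcoeff (g n) k) \<longlonglongrightarrow> 0" "\<And>n. norm (g n) \<le> B" "cmod z < 1"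
  shows "(\<lambda>n. hardy2_fun (g n) z) \<longlonglongrightarrow> 0"
proof -
  have *: "hardy2_fun (g n) z = (\<Sum>k. hcoeff (g n) k * z ^ k)" for n
    using hardy2_sums[OF assms(3)] by (simp add: sums_iff)
  have "eventually (\<lambda>(k,n). norm (hcoeff (g n) k * z ^ k) \<le> B * cmod z ^ k) (at_top \<times>\<^sub>F sequentially)"
    by (intro always_eventually)
       (auto simp: norm_mult norm_power intro!: mult_right_mono order_trans[OF cmod_hcoeff_le assms(2)])
  then have "(\<lambda>n. \<Sum>k. hcoeff (g n) k * z ^ k) \<longlonglongrightarrow> (\<Sum>k. 0 * z ^ k)"
    by (intro tannerys_theorem[THEN conjunct2, THEN conjunct2] tendsto_mult assms(1) tendsto_const)
       (use assms(3) in \<open>auto intro!: summable_mult summable_geometric\<close>)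
  then show ?thesis by (simp add: *)
qed

lemma norm_le_if_partial_sums:
  fixes a :: "nat \<Rightarrow> complex"
  assumes "\<And>K. (\<Sum>k<K. (cmod (a k))\<^sup>2) \<le> B"
  shows "summable (\<lambda>k. (cmod (a k))\<^sup>2)" "(\<Sum>k. (cmod (a k))\<^sup>2) \<le> B"
proof -
  show s: "summable (\<lambda>k. (cmod (a k))\<^sup>2)"
    using assms by (intro summableI_nonneg_bounded) auto
  show "(\<Sum>k. (cmod (a k))\<^sup>2) \<le> B"
    using assms by (intro suminf_le_const s) auto
qed

text \<open>Weak compactness of the unit ball in coordinates: a diagonal subsequence converges in
  every coefficient, and the bound on finite partial sums keeps the limit in the ball.\<close>

lemma hardy2_weakly_convergent_subseq:
  assumes "\<And>n. norm (f n :: hardy2) \<le> 1"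
  obtains r g where "strict_mono (r :: nat \<Rightarrow> nat)" "norm g \<le> 1"
    "\<And>k. (\<lambda>n. hcoeff (f (r n)) k) \<longlonglongrightarrow> hcoeff g k"
proof -
  obtain r where r: "strict_mono (r :: nat \<Rightarrow> nat)"
    and "\<And>k. k \<in> UNIV \<Longrightarrow> \<exists>l. (\<lambda>n. hcoeff (f (r n)) k) \<longlonglongrightarrow> l"
    by (rule function_convergent_subsequence[of UNIV "\<lambda>n. hcoeff (f n)" 1])
       (auto intro: order_trans[OF cmod_hcoeff_le assms])
  then obtain l where l: "\<And>k. (\<lambda>n. hcoeff (f (r n)) k) \<longlonglongrightarrow> l k"
    by (metis UNIV_I)
  have "(\<Sum>k<K. (cmod (l k))\<^sup>2) \<le> 1" for K
  proof (rule LIMSEQ_le_const2)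
    show "(\<lambda>n. \<Sum>k<K. (cmod (hcoeff (f (r n)) k))\<^sup>2) \<longlonglongrightarrow> (\<Sum>k<K. (cmod (l k))\<^sup>2)"
      by (intro tendsto_intros l)
    have "(\<Sum>k<K. (cmod (hcoeff (f (r n)) k))\<^sup>2) \<le> (norm (f (r n)))\<^sup>2" for n
      unfolding norm_hardy2_sq by (intro sum_le_suminf hardy2_summable) auto
    also have "(norm (f (r n)))\<^sup>2 \<le> 1" for n
      using assms by (simp add: abs_square_le_1)
    finally show "\<exists>N. \<forall>n\<ge>N. (\<Sum>k<K. (cmod (hcoeff (f (r n)) k))\<^sup>2) \<le> 1" by blast
  qed
  note s = norm_le_if_partial_sums[OF this]
  define g where "g = hardy2_of l"
  have g: "hcoeff g k = l k" for k unfolding g_def by (rule hcoeff_hardy2_of[OF s(1)])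
  have "(norm g)\<^sup>2 \<le> 1" unfolding norm_hardy2_sq g by (rule s(2))
  then have "norm g \<le> 1" by (simp add: abs_square_le_1)
  then show ?thesis using that r l by (simp add: g)
qed

lemma cinner_tendsto: "(\<lambda>n. F n) \<longlonglongrightarrow> f \<Longrightarrow> (\<lambda>n. cinner (F n) g) \<longlonglongrightarrow> cinner f g"
proof -
  assume "(\<lambda>n. F n) \<longlonglongrightarrow> f"
  then have "(\<lambda>n. norm (F n - f) * norm g) \<longlonglongrightarrow> 0"
    by (intro tendsto_mult_left_zero tendsto_norm_zero) (simp add: LIM_zero_iff)
  then have "(\<lambda>n. cinner (F n) g - cinner f g) \<longlonglongrightarrow> 0"
    by (rule Lim_null_comparison[rotated])
       (auto intro!: always_eventually simp: cinner_diff_left[symmetric] cmod_cinner_le)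
  then show ?thesis by (simp add: LIM_zero_iff)
qed

text \<open>The abstract part of the argument. In the application \<open>\<psi>\<close> is the
  boundary function of a symbol and \<open>M\<close> is arc length with a density proportional to
  \<open>h\<^sup>q\<^sup>-\<^sup>1\<close>. Compactness follows by fixing a small \<open>c\<close>,
  the power sum of the singular numbers by adapting \<open>c\<close> to each vector.\<close>

locale trace_bound =
  fixes T :: "hardy2 \<Rightarrow> hardy2" and M :: "'a measure" and \<psi> :: "'a \<Rightarrow> complex" and C q :: real
  assumes lin: "Vector_Spaces.linear hardy2_scaleC hardy2_scaleC T"
    and q: "q > 1" and C: "C > 0"
    and psi_meas: "\<psi> \<in> borel_measurable M"
    and psi_disc: "\<And>x. x \<in> space M \<Longrightarrow> cmod (\<psi> x) < 1"
    and kernel: "integrable M (\<lambda>x. 1 / (1 - (cmod (\<psi> x))\<^sup>2))"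
    and bound: "\<And>c f. c > 0 \<Longrightarrow> (norm (T f))\<^sup>2 \<le> c * C * (norm f)\<^sup>2 +
      c powr (1 - q) * (\<integral>x. (cmod (hardy2_fun f (\<psi> x)))\<^sup>2 \<partial>M)"
begin

definition energy :: "hardy2 \<Rightarrow> real" where
  "energy f = (\<integral>x. (cmod (hardy2_fun f (\<psi> x)))\<^sup>2 \<partial>M)"

abbreviation K :: real where
  "K \<equiv> \<integral>x. 1 / (1 - (cmod (\<psi> x))\<^sup>2) \<partial>M"

sublocale T: Vector_Spaces.linear hardy2_scaleC hardy2_scaleC T
  by (rule lin)

lemma psi_sq: "x \<in> space M \<Longrightarrow> (cmod (\<psi> x))\<^sup>2 < 1"
  using psi_disc[of x] by (simp add: abs_square_less_1)

lemma meas [measurable]: "(\<lambda>x. hardy2_fun f (\<psi> x)) \<in> borel_measurable M"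
  using measurable_compose[OF psi_meas hardy2_fun_measurable] .

lemma eval_le:
  assumes "x \<in> space M" "norm f \<le> B"
  shows "(cmod (hardy2_fun f (\<psi> x)))\<^sup>2 \<le> B\<^sup>2 * (1 / (1 - (cmod (\<psi> x))\<^sup>2))"
proof -
  have "(cmod (hardy2_fun f (\<psi> x)))\<^sup>2 \<le> (norm f)\<^sup>2 * (1 / (1 - (cmod (\<psi> x))\<^sup>2))"
    using hardy2_eval_bound[OF psi_disc[OF assms(1)], of f] by simp
  also have "\<dots> \<le> B\<^sup>2 * (1 / (1 - (cmod (\<psi> x))\<^sup>2))"
    using psi_sq[OF assms(1)] assms(2) by (intro mult_right_mono power_mono) auto
  finally show ?thesis .
qed

lemma integrable_energy: "integrable M (\<lambda>x. (cmod (hardy2_fun f (\<psi> x)))\<^sup>2)"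
  by (rule Bochner_Integration.integrable_bound[OF integrable_mult_right[OF kernel, of "(norm f)\<^sup>2"]])
     (use psi_sq eval_le[of _ f "norm f"] in \<open>auto intro!: AE_I2 simp: less_imp_le\<close>)

lemma energy_nonneg: "0 \<le> energy f"
  unfolding energy_def by (intro Bochner_Integration.integral_nonneg) auto

lemma K_nonneg: "0 \<le> K"
  using psi_sq by (intro Bochner_Integration.integral_nonneg) (auto simp: less_imp_le)

lemma energy_le: "energy f \<le> (norm f)\<^sup>2 * K"
proof -
  have "energy f \<le> (\<integral>x. (norm f)\<^sup>2 * (1 / (1 - (cmod (\<psi> x))\<^sup>2)) \<partial>M)"
    unfolding energy_def
    by (intro integral_mono integrable_energy integrable_mult_right kernel eval_le) auto
  also have "\<dots> = (norm f)\<^sup>2 * K" by (rule integral_mult_right_zero)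
  finally show ?thesis .
qed

text \<open>Weakly null sequences converge pointwise along \<open>\<psi>\<close>, and the
  reproducing kernel bound supplies a dominating function, integrable by
  \<open>kernel\<close>.\<close>

lemma energy_tendsto_0:
  assumes "\<And>k. (\<lambda>n. hcoeff (g n) k) \<longlonglongrightarrow> 0" "\<And>n. norm (g n) \<le> B"
  shows "(\<lambda>n. energy (g n)) \<longlonglongrightarrow> 0"
proof -
  have "(\<lambda>n. energy (g n)) \<longlonglongrightarrow> (\<integral>x. 0 \<partial>M)"
    unfolding energy_def
  proof (rule integral_dominated_convergence)
    show "integrable M (\<lambda>x. B\<^sup>2 * (1 / (1 - (cmod (\<psi> x))\<^sup>2)))"
      by (intro integrable_mult_right kernel)
    show "AE x in M. (\<lambda>n. (cmod (hardy2_fun (g n) (\<psi> x)))\<^sup>2) \<longlonglongrightarrow> 0"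
      by (intro AE_I2 tendsto_null_power tendsto_norm_zero
          hardy2_eval_tendsto_0[OF assms] psi_disc) auto
  qed (use eval_le[OF _ assms(2)] in \<open>auto intro!: AE_I2\<close>)
  then show ?thesis by simp
qed

lemma T_bounded: "norm (T f) \<le> sqrt (C + K) * norm f"
proof -
  have "(norm (T f))\<^sup>2 \<le> C * (norm f)\<^sup>2 + energy f"
    using bound[of 1 f] by (simp add: energy_def)
  also have "\<dots> \<le> (C + K) * (norm f)\<^sup>2"
    using energy_le[of f] by (simp add: algebra_simps)
  finally have "sqrt ((norm (T f))\<^sup>2) \<le> sqrt ((C + K) * (norm f)\<^sup>2)"
    by (rule real_sqrt_le_mono)
  then show ?thesis by (simp add: real_sqrt_mult)
qed

lemma T_scaleR: "T (c *\<^sub>R f) = c *\<^sub>R T f"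
  by (simp add: scaleR_hardy2_def T.scale)

lemma T_bounded_linear: "bounded_linear T"
  by (rule bounded_linear_intro[of _ "sqrt (C + K)"])
     (use T_bounded in \<open>auto simp: T.add T_scaleR mult.commute\<close>)

lemmas T_tendsto = bounded_linear.tendsto[OF T_bounded_linear]

lemma T_tendsto_0:
  assumes "\<And>k. (\<lambda>n. hcoeff (g n) k) \<longlonglongrightarrow> 0" "\<And>n. norm (g n) \<le> B"
  shows "(\<lambda>n. T (g n)) \<longlonglongrightarrow> 0"
proof -
  have "(\<lambda>n. (norm (T (g n)))\<^sup>2) \<longlonglongrightarrow> 0"
  proof (rule LIMSEQ_I)
    fix e :: real assume e: "e > 0"
    \<comment> \<open>\<open>c\<close> is fixed before \<open>n\<close>: it makes the first term of
      \<open>bound\<close> at most e / 2 uniformly in \<open>n\<close>, and for this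
      \<open>c\<close> the energy term tends to zero. The summand 1 covers
      \<open>B = 0\<close>.\<close>
    define c where "c = e / (2 * C * (B\<^sup>2 + 1))"
    have pos: "B\<^sup>2 + 1 > 0" by (intro add_nonneg_pos) auto
    have c: "c > 0" unfolding c_def using e C pos by simp
    have "c * C * B\<^sup>2 \<le> c * C * (B\<^sup>2 + 1)" using c C by simp
    also have "\<dots> = e / 2" unfolding c_def using C pos by (simp del: distrib_left_numeral)
    finally have 1: "c * C * B\<^sup>2 \<le> e / 2" .
    have "(\<lambda>n. c powr (1 - q) * energy (g n)) \<longlonglongrightarrow> 0"
      by (intro tendsto_mult_right_zero energy_tendsto_0[OF assms])
    then have "\<forall>\<^sub>F n in sequentially. c powr (1 - q) * energy (g n) < e / 2"
      by (rule order_tendstoD) (use e in simp)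
    then obtain N where N: "\<And>n. n \<ge> N \<Longrightarrow> c powr (1 - q) * energy (g n) < e / 2"
      by (auto simp: eventually_sequentially)
    have "norm ((norm (T (g n)))\<^sup>2 - 0) < e" if "n \<ge> N" for n
    proof -
      have "c * C * (norm (g n))\<^sup>2 \<le> c * C * B\<^sup>2"
        using c C assms(2) by (intro mult_left_mono power_mono) auto
      then show ?thesis using bound[OF c, of "g n"] N[OF that] 1 unfolding energy_def by simp
    qed
    then show "\<exists>N. \<forall>n\<ge>N. norm ((norm (T (g n)))\<^sup>2 - 0) < e" by blast
  qed
  from tendsto_real_sqrt[OF this] have "(\<lambda>n. norm (T (g n))) \<longlonglongrightarrow> 0" by simp
  then show ?thesis by (rule tendsto_norm_zero_cancel)
qed

text \<open>After subtraction of the weak limit the sequence is weakly null, and \<open>T\<close>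
  turns it into a norm null sequence. Since the limit is \<open>T g\<close> with \<open>g\<close> in
  the ball, the image of the closed ball is itself compact.\<close>

lemma T_seq_compact:
  assumes "\<And>n. norm (f n) \<le> 1"
  obtains r g where "strict_mono (r :: nat \<Rightarrow> nat)" "norm g \<le> 1" "(\<lambda>n. T (f (r n))) \<longlonglongrightarrow> T g"
proof -
  from hardy2_weakly_convergent_subseq[of f] assms
  obtain r g where r: "strict_mono (r :: nat \<Rightarrow> nat)" and g: "norm g \<le> 1"
    and l: "\<And>k. (\<lambda>n. hcoeff (f (r n)) k) \<longlonglongrightarrow> hcoeff g k" by metis
  have "(\<lambda>n. T (f (r n) - g)) \<longlonglongrightarrow> 0"
  proof (rule T_tendsto_0)
    show "(\<lambda>n. hcoeff (f (r n) - g) k) \<longlonglongrightarrow> 0" for k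
      using tendsto_diff[OF l[of k] tendsto_const[of "hcoeff g k"]] by (simp add: hcoeff_diff)
    show "norm (f (r n) - g) \<le> 2" for n
      using norm_triangle_ineq4[of "f (r n)" g] assms[of "r n"] g by linarith
  qed
  then have "(\<lambda>n. T (f (r n))) \<longlonglongrightarrow> T g" by (simp add: T.diff LIM_zero_iff)
  with r g that show ?thesis by blast
qed

lemma T_compact: "compact_operator T"
proof -
  have "compact (T ` cball 0 1)"
    unfolding compact_eq_seq_compact_metric seq_compact_def
  proof safe
    fix h :: "nat \<Rightarrow> hardy2" assume h: "\<forall>n. h n \<in> T ` cball 0 1"
    have "\<exists>f. h n = T f \<and> norm f \<le> 1" for n
    proof -
      obtain f where "f \<in> cball 0 1" "h n = T f" using h by blast
      then show ?thesis by auto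
    qed
    then have "\<exists>f. \<forall>n. h n = T (f n) \<and> norm (f n) \<le> 1" by (intro choice allI)
    then obtain f where f: "\<And>n. h n = T (f n)" "\<And>n. norm (f n) \<le> 1" by blast
    show "\<exists>l\<in>T ` cball 0 1. \<exists>r. strict_mono r \<and> (h \<circ> r) \<longlonglongrightarrow> l"
    proof (rule T_seq_compact[OF f(2)])
      fix r g assume "strict_mono (r :: nat \<Rightarrow> nat)" "norm g \<le> 1" "(\<lambda>n. T (f (r n))) \<longlonglongrightarrow> T g"
      then show ?thesis
        by (intro bexI[of _ "T g"] exI[of _ r] conjI imageI) (simp_all add: f o_def)
    qed
  qed
  then show ?thesis
    unfolding compact_operator_def by (simp add: compact_imp_closed)
qed

text \<open>The coefficients are those that an adjoint must have. The map is constructed explicitly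
  because \<open>adjoint\<close> is defined by choice and says nothing until some map with the
  adjoint identity is exhibited.\<close>

definition Tadj :: "hardy2 \<Rightarrow> hardy2" where
  "Tadj y = hardy2_of (\<lambda>n. cinner y (T (hbasis n)))"

lemma T_htrunc: "T (htrunc N f) = (\<Sum>n<N. hardy2_scaleC (hcoeff f n) (T (hbasis n)))"
  by (simp add: htrunc_def T.sum T.scale)

lemma hcoeff_Tadj: "hcoeff (Tadj y) n = cinner y (T (hbasis n))"
  unfolding Tadj_def
proof (rule hcoeff_hardy2_of, rule norm_le_if_partial_sums(1))
  fix N
  let ?b = "\<lambda>n. cinner y (T (hbasis n))"
  define S where "S = (\<Sum>n<N. (cmod (?b n))\<^sup>2)"
  \<comment> \<open>A test vector: the product of \<open>T w\<close> with \<open>y\<close> is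
    \<open>S\<close>, while \<open>norm w\<close> is the square root of \<open>S\<close>.
    Boundedness of \<open>T\<close> therefore bounds \<open>S\<close> by a multiple of its own
    square root.\<close>
  define w where "w = (\<Sum>n<N. hardy2_scaleC (?b n) (hbasis n))"
  have cw: "hcoeff w n = (if n < N then ?b n else 0)" for n
  proof -
    have "hcoeff w n = (\<Sum>i<N. if i = n then ?b n else 0)"
      unfolding w_def hcoeff_sum taylor_coeff_scaleC_hardy2 hcoeff_hbasis
      by (intro sum.cong) auto
    then show ?thesis by simp
  qed
  have "(\<lambda>n. if n \<in> {..<N} then (cmod (?b n))\<^sup>2 else 0) sums S"
    unfolding S_def by (intro sums_If_finite_set) simp
  also have "(\<lambda>n. if n \<in> {..<N} then (cmod (?b n))\<^sup>2 else 0) = (\<lambda>n. (cmod (hcoeff w n))\<^sup>2)"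
    by (auto simp: cw)
  finally have nw: "(norm w)\<^sup>2 = S" unfolding norm_hardy2_sq by (simp add: sums_iff)
  have "T w = (\<Sum>n<N. hardy2_scaleC (?b n) (T (hbasis n)))"
    by (simp add: w_def T.sum T.scale)
  then have "cinner (T w) y = (\<Sum>n<N. ?b n * cnj (?b n))"
    by (simp add: cinner_sum_left cinner_scaleC_left)
  also have "\<dots> = of_real S" unfolding S_def of_real_sum complex_norm_square cnj_cinner ..
  finally have "cmod (cinner (T w) y) = S" by (simp only: norm_of_real) (simp add: S_def sum_nonneg)
  then have "S = cmod (cinner (T w) y)" ..
  also have "\<dots> \<le> norm (T w) * norm y" by (rule cmod_cinner_le)
  also have "\<dots> \<le> (sqrt (C + K) * norm w) * norm y"
    by (intro mult_right_mono T_bounded) simp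
  finally have "S\<^sup>2 \<le> ((sqrt (C + K) * norm w) * norm y)\<^sup>2"
    by (intro power_mono) (auto simp: S_def sum_nonneg)
  also have "\<dots> = (C + K) * S * (norm y)\<^sup>2"
    using C K_nonneg by (simp add: power_mult_distrib nw)
  finally have *: "S * S \<le> ((C + K) * (norm y)\<^sup>2) * S" by (simp add: power2_eq_square algebra_simps)
  have "S \<le> (C + K) * (norm y)\<^sup>2"
  proof (cases "S > 0")
    case True then show ?thesis using * by simp
  next
    case False
    then show ?thesis using C K_nonneg
      by (smt (verit) mult_nonneg_nonneg zero_le_power2)
  qed
  then show "(\<Sum>n<N. (cmod (?b n))\<^sup>2) \<le> (C + K) * (norm y)\<^sup>2" by (simp add: S_def)
qed

text \<open>On truncations of \<open>x\<close> the identity is linearity together with the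
  definition of \<open>Tadj\<close>, and both sides are continuous in \<open>x\<close>.\<close>

lemma cinner_Tadj: "cinner (T x) y = cinner x (Tadj y)"
proof (rule LIMSEQ_unique)
  show "(\<lambda>N. cinner (T (htrunc N x)) y) \<longlonglongrightarrow> cinner (T x) y"
    by (intro cinner_tendsto T_tendsto htrunc_tendsto)
  have "cinner (T (htrunc N x)) y = cinner (htrunc N x) (Tadj y)" for N
    unfolding T_htrunc cinner_sum_left cinner_scaleC_left
    unfolding htrunc_def cinner_sum_left cinner_scaleC_left
    by (intro sum.cong refl arg_cong2[where f="(*)"])
       (simp add: cinner_hbasis_left hcoeff_Tadj)
  then show "(\<lambda>N. cinner (T (htrunc N x)) y) \<longlonglongrightarrow> cinner x (Tadj y)"
    by (simp add: cinner_tendsto htrunc_tendsto)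
qed

lemma adjoint_T: "adjoint T = Tadj"
  by (rule adjoint_unique) (simp add: inner_eq_Re_cinner cinner_Tadj)

lemma Tadj_add: "Tadj (f + g) = Tadj f + Tadj g"
  by (rule hardy2_eqI_hcoeff) (simp add: hcoeff_Tadj taylor_coeff_plus_hardy2 cinner_add_left)

lemma Tadj_scaleC: "Tadj (hardy2_scaleC c f) = hardy2_scaleC c (Tadj f)"
  by (rule hardy2_eqI_hcoeff) (simp add: hcoeff_Tadj taylor_coeff_scaleC_hardy2 cinner_scaleC_left)

lemma norm_sq_T: "of_real ((norm (T f))\<^sup>2) = cinner f (Tadj (T f))"
  using cinner_self[of "T f"] by (simp only: cinner_Tadj)

lemma Tadj_bounded: "norm (Tadj f) \<le> sqrt (C + K) * norm f"
proof -
  have "of_real ((norm (Tadj f))\<^sup>2) = cinner (T (Tadj f)) f"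
    using cinner_self[of "Tadj f"] by (simp only: cinner_Tadj)
  then have "(norm (Tadj f))\<^sup>2 = cmod (cinner (T (Tadj f)) f)"
    by (metis norm_of_real abs_of_nonneg zero_le_power2)
  also have "\<dots> \<le> norm (T (Tadj f)) * norm f" by (rule cmod_cinner_le)
  also have "\<dots> \<le> (sqrt (C + K) * norm (Tadj f)) * norm f"
    by (intro mult_right_mono T_bounded) simp
  finally have "norm (Tadj f) * norm (Tadj f) \<le> (sqrt (C + K) * norm f) * norm (Tadj f)"
    by (simp add: power2_eq_square algebra_simps)
  then show ?thesis
    by (cases "norm (Tadj f) = 0") (use C K_nonneg in \<open>auto simp: mult_le_cancel_right\<close>)
qed

lemma Tadj_scaleR: "Tadj (c *\<^sub>R f) = c *\<^sub>R Tadj f"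
  by (simp add: scaleR_hardy2_def Tadj_scaleC)

lemma Tadj_bounded_linear: "bounded_linear Tadj"
  by (rule bounded_linear_intro[of _ "sqrt (C + K)"])
     (use Tadj_bounded in \<open>auto simp: Tadj_add Tadj_scaleR mult.commute\<close>)

lemmas Tadj_tendsto = bounded_linear.tendsto[OF Tadj_bounded_linear]

end

section \<open>Eigenvectors of \<open>TstarT\<close>\<close>

lemma norm_diff_scaleR_sq:
  "(norm (a - c *\<^sub>R b))\<^sup>2 = (norm a)\<^sup>2 - 2 * c * inner b a + c\<^sup>2 * (norm b)\<^sup>2"
  unfolding power2_norm_eq_inner
  by (simp add: inner_diff_left inner_diff_right inner_commute[of a b] power2_eq_square algebra_simps)

context trace_bound
begin

definition TstarT :: "hardy2 \<Rightarrow> hardy2" where "TstarT f = Tadj (T f)"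

lemma TstarT_add: "TstarT (f + g) = TstarT f + TstarT g" by (simp add: TstarT_def T.add Tadj_add)

lemma TstarT_scaleC: "TstarT (hardy2_scaleC c f) = hardy2_scaleC c (TstarT f)"
  by (simp add: TstarT_def T.scale Tadj_scaleC)

lemma Tadj_zero: "Tadj 0 = 0" using Tadj_scaleR[of 0 0] by simp

lemma TstarT_zero: "TstarT 0 = 0" by (simp add: TstarT_def Tadj_zero)

lemma TstarT_sum: "TstarT (sum F I) = (\<Sum>i\<in>I. TstarT (F i))"
  by (induction I rule: infinite_finite_induct) (auto simp: TstarT_add TstarT_zero)

lemma TstarT_tendsto: "F \<longlonglongrightarrow> f \<Longrightarrow> (\<lambda>n. TstarT (F n)) \<longlonglongrightarrow> TstarT f"
  unfolding TstarT_def by (intro Tadj_tendsto T_tendsto)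

lemma TstarT_selfadjoint: "cinner (TstarT f) g = cinner f (TstarT g)"
proof -
  have "cinner (TstarT f) g = cnj (cinner g (Tadj (T f)))" by (simp add: TstarT_def)
  also have "\<dots> = cinner (T f) (T g)" by (simp flip: cinner_Tadj)
  also have "\<dots> = cinner f (TstarT g)" by (simp add: TstarT_def cinner_Tadj)
  finally show ?thesis .
qed

lemma cinner_TstarT_self: "cinner f (TstarT f) = of_real ((norm (T f))\<^sup>2)"
  by (simp only: TstarT_def norm_sq_T)

definition Orth :: "nat \<Rightarrow> (nat \<Rightarrow> hardy2) \<Rightarrow> hardy2 set" where
  "Orth n e = {w. \<forall>i<n. cinner w (e i) = 0}"

text \<open>Pairing an eigenvalue equation with the unit vector \<open>v\<close> forces the
  eigenvalue to be \<open>(norm (T v))\<^sup>2\<close>, so fixing it loses nothing. Unit vectors in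
  the kernel of \<open>T\<close> count, with eigenvalue 0.\<close>

definition eigvec :: "hardy2 \<Rightarrow> bool" where
  "eigvec v \<longleftrightarrow> norm v = 1 \<and> TstarT v = hardy2_scaleC (of_real ((norm (T v))\<^sup>2)) v"

lemma Orth_scaleC: "w \<in> Orth n e \<Longrightarrow> hardy2_scaleC c w \<in> Orth n e"
  by (simp add: Orth_def cinner_scaleC_left)

lemma Orth_TstarT:
  assumes "\<And>i. i < n \<Longrightarrow> eigvec (e i)" "w \<in> Orth n e"
  shows "TstarT w \<in> Orth n e"
  using assms by (auto simp: Orth_def TstarT_selfadjoint eigvec_def cinner_scaleC_right)

text \<open>Infinite dimension enters here. The coefficients of finitely many vectors tend to zero,
  so for large \<open>m\<close> the projection of \<open>hbasis m\<close> onto their span has norm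
  below 1, and subtracting it leaves a nonzero vector.\<close>

lemma Orth_unit_exists:
  assumes e: "\<And>i. i < n \<Longrightarrow> norm (e i) = 1" "\<And>i j. i < j \<Longrightarrow> j < n \<Longrightarrow> cinner (e j) (e i) = 0"
  shows "\<exists>w\<in>Orth n e. norm w = 1"
proof -
  define w where "w m = hbasis m - (\<Sum>i<n. hardy2_scaleC (cinner (hbasis m) (e i)) (e i))" for m
  have ortho: "cinner (e i) (e j) = (if i = j then 1 else 0)" if "i < n" "j < n" for i j
  proof -
    have "cinner (e i) (e j) = 0" if "i < j"
      using e(2)[OF that \<open>j < n\<close>] cnj_cinner[of "e j" "e i"] by simp
    then show ?thesis
      using e that by (cases i j rule: linorder_cases) (auto simp: cinner_self)
  qed
  have w: "w m \<in> Orth n e" for m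
    unfolding Orth_def
  proof safe
    fix j assume "j < n"
    have "(\<Sum>i<n. cinner (hbasis m) (e i) * cinner (e i) (e j)) =
        (\<Sum>i<n. if i = j then cinner (hbasis m) (e j) else 0)"
      by (intro sum.cong) (auto simp: ortho \<open>j < n\<close>)
    then show "cinner (w m) (e j) = 0"
      using \<open>j < n\<close> by (simp add: w_def cinner_diff_left cinner_sum_left cinner_scaleC_left)
  qed
  have "(\<lambda>m. \<Sum>i<n. cmod (cinner (hbasis m) (e i))) \<longlonglongrightarrow> (\<Sum>i<n. 0)"
  proof (intro tendsto_sum)
    fix i
    have "(\<lambda>m. (cmod (hcoeff (e i) m))\<^sup>2) \<longlonglongrightarrow> 0"
      by (rule summable_LIMSEQ_zero[OF hardy2_summable])
    from tendsto_real_sqrt[OF this] show "(\<lambda>m. cmod (cinner (hbasis m) (e i))) \<longlonglongrightarrow> 0"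
      by (simp add: cinner_hbasis_left)
  qed
  then have "\<forall>\<^sub>F m in sequentially. (\<Sum>i<n. cmod (cinner (hbasis m) (e i))) < 1"
    by (intro order_tendstoD) auto
  then obtain m where m: "(\<Sum>i<n. cmod (cinner (hbasis m) (e i))) < 1"
    by (auto simp: eventually_sequentially)
  have "norm (\<Sum>i<n. hardy2_scaleC (cinner (hbasis m) (e i)) (e i)) \<le> (\<Sum>i<n. cmod (cinner (hbasis m) (e i)))"
    by (rule order_trans[OF norm_sum]) (simp add: norm_scaleC e)
  moreover have "norm (hbasis m) = 1"
  proof -
    have "cinner (hbasis m) (hbasis m) = 1" by (simp add: cinner_hbasis hcoeff_hbasis)
    then have "(norm (hbasis m))\<^sup>2 = 1" unfolding cinner_self using of_real_eq_1_iff by blast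
    then show ?thesis by (simp add: power2_eq_1_iff) (metis norm_ge_zero not_one_le_zero neg_0_le_iff_le)
  qed
  ultimately have "w m \<noteq> 0" using m unfolding w_def by auto
  then have "norm (hardy2_scaleC (of_real (1 / norm (w m))) (w m)) = 1"
    by (simp add: norm_scaleC norm_divide)
  then show ?thesis using Orth_scaleC[OF w] by blast
qed

text \<open>A maximising sequence \<open>v\<close> satisfies \<open>T\<^sup>* T v - s\<^sup>2 v \<rightarrow> 0\<close>, and \<open>T v\<close> converges along a
  subsequence, hence so does \<open>v\<close>; no weak compactness of the orthogonal complement is needed.\<close>

lemma max_vector_exists:
  assumes e: "\<And>i. i < n \<Longrightarrow> eigvec (e i)" "\<And>i j. i < j \<Longrightarrow> j < n \<Longrightarrow> cinner (e j) (e i) = 0"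
  shows "\<exists>v. eigvec v \<and> v \<in> Orth n e \<and> (\<forall>w\<in>Orth n e. norm (T w) \<le> norm (T v) * norm w)"
proof -
  define S where "S = (\<lambda>w. norm (T w)) ` {w \<in> Orth n e. norm w = 1}"
  obtain w0 where w0: "w0 \<in> Orth n e" "norm w0 = 1"
    using Orth_unit_exists[of n e] e unfolding eigvec_def by blast
  have bdd: "bdd_above S"
    unfolding S_def
  proof (rule bdd_aboveI2)
    fix w assume "w \<in> {w \<in> Orth n e. norm w = 1}"
    then show "norm (T w) \<le> sqrt (C + K)" using T_bounded[of w] by simp
  qed
  have ne: "S \<noteq> {}" using w0 by (auto simp: S_def)
  define s where "s = Sup S"
  have le: "norm (T w) \<le> s * norm w" if w: "w \<in> Orth n e" for w
  proof (cases "w = 0")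
    case False
    let ?u = "hardy2_scaleC (of_real (1 / norm w)) w"
    have "?u \<in> Orth n e" "norm ?u = 1" using False Orth_scaleC[OF w] by (auto simp: norm_scaleC norm_divide)
    then have "norm (T ?u) \<in> S" unfolding S_def by blast
    then have "norm (T ?u) \<le> s" unfolding s_def by (rule cSup_upper[OF _ bdd])
    then show ?thesis using False by (simp add: T.scale norm_scaleC norm_divide field_simps)
  qed auto
  have s0: "0 \<le> s" using le[OF w0(1)] w0(2) by (metis mult.right_neutral norm_ge_zero order_trans)
  show ?thesis
  proof (cases "s = 0")
    \<comment> \<open>Then \<open>T\<close> vanishes on the whole complement, and any unit vector in
      it is an eigenvector with eigenvalue 0. Thus the sequence of eigenvectors can be continued
      even if \<open>T\<close> has finite rank.\<close>
    case True
    have T0: "T w = 0" if "w \<in> Orth n e" for w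
      using le[OF that] True by simp
    then have "TstarT w0 = 0"
      using T0[OF w0(1)] by (simp add: TstarT_def Tadj_zero)
    then have "eigvec w0" using w0 T0[OF w0(1)] by (simp add: eigvec_def)
    then show ?thesis using w0 T0 by force
  next
    case False
    then have s: "s > 0" using s0 by simp
    have "\<exists>v. v \<in> Orth n e \<and> norm v = 1 \<and> s - 1 / Suc j < norm (T v)" for j
    proof -
      have "s - 1 / Suc j < Sup S" by (simp add: s_def)
      then obtain y where "y \<in> S" "s - 1 / Suc j < y" using less_cSupD[OF ne] by blast
      then show ?thesis by (auto simp: S_def)
    qed
    then obtain v where v: "\<And>j. v j \<in> Orth n e" "\<And>j. norm (v j) = 1"
      "\<And>j. s - 1 / Suc j < norm (T (v j))" by metis
    have lim_s: "(\<lambda>j. norm (T (v j))) \<longlonglongrightarrow> s"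
    proof (rule tendsto_sandwich)
      have "(\<lambda>j. s - 1 / Suc j) \<longlonglongrightarrow> s - 0"
        by (intro tendsto_intros LIMSEQ_Suc[OF lim_1_over_n])
      then show "(\<lambda>j. s - 1 / Suc j) \<longlonglongrightarrow> s" by simp
      show "(\<lambda>_. s) \<longlonglongrightarrow> s" by simp
      show "\<forall>\<^sub>F j in sequentially. s - 1 / Suc j \<le> norm (T (v j))"
        using v(3) by (auto intro!: always_eventually less_imp_le)
      show "\<forall>\<^sub>F j in sequentially. norm (T (v j)) \<le> s"
        using le[OF v(1)] v(2) by (auto intro!: always_eventually)
    qed
    define d where "d j = TstarT (v j) - (s\<^sup>2) *\<^sub>R v j" for j
    \<comment> \<open>The bound is \<open>s\<^sup>2\<close> because \<open>TstarT\<close> maps the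
      complement into itself, so that \<open>s\<close> may be applied to \<open>T\<close>
      twice.\<close>
    have nA: "norm (TstarT (v j)) \<le> s\<^sup>2" for j
    proof -
      have "of_real ((norm (TstarT (v j)))\<^sup>2) = cinner (T (TstarT (v j))) (T (v j))"
        unfolding cinner_self[symmetric] by (simp add: cinner_Tadj TstarT_def)
      then have "(norm (TstarT (v j)))\<^sup>2 = cmod (cinner (T (TstarT (v j))) (T (v j)))"
        by (metis norm_of_real abs_of_nonneg zero_le_power2)
      also have "\<dots> \<le> norm (T (TstarT (v j))) * norm (T (v j))" by (rule cmod_cinner_le)
      also have "\<dots> \<le> (s * norm (TstarT (v j))) * (s * norm (v j))"
        by (intro mult_mono le Orth_TstarT e v) (auto simp: s0)
      finally have "norm (TstarT (v j)) * norm (TstarT (v j)) \<le> s\<^sup>2 * norm (TstarT (v j))"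
        by (simp add: v power2_eq_square algebra_simps)
      then show ?thesis by (cases "norm (TstarT (v j)) = 0") (auto simp: mult_le_cancel_right)
    qed
    have nd: "(norm (d j))\<^sup>2 \<le> 2 * s ^ 4 - 2 * s\<^sup>2 * (norm (T (v j)))\<^sup>2" for j
    proof -
      have "(norm (d j))\<^sup>2 = (norm (TstarT (v j)))\<^sup>2 - 2 * s\<^sup>2 * inner (v j) (TstarT (v j)) + s ^ 4"
        unfolding d_def norm_diff_scaleR_sq using v(2) by (simp flip: power_mult)
      moreover have "inner (v j) (TstarT (v j)) = (norm (T (v j)))\<^sup>2"
        unfolding inner_eq_Re_cinner cinner_TstarT_self by (rule Re_complex_of_real)
      moreover have "(norm (TstarT (v j)))\<^sup>2 \<le> (s\<^sup>2)\<^sup>2" using nA by (intro power_mono) auto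
      then have "(norm (TstarT (v j)))\<^sup>2 \<le> s ^ 4" by simp
      ultimately show ?thesis by simp
    qed
    have "(\<lambda>j. (norm (d j))\<^sup>2) \<longlonglongrightarrow> 0"
    proof (rule tendsto_sandwich[OF _ _ tendsto_const])
      have "(\<lambda>j. 2 * s ^ 4 - 2 * s\<^sup>2 * (norm (T (v j)))\<^sup>2) \<longlonglongrightarrow> 2 * s ^ 4 - 2 * s\<^sup>2 * s\<^sup>2"
        by (intro tendsto_intros lim_s)
      also have "2 * s ^ 4 - 2 * s\<^sup>2 * s\<^sup>2 = 0" by (simp add: eval_nat_numeral)
      finally show "(\<lambda>j. 2 * s ^ 4 - 2 * s\<^sup>2 * (norm (T (v j)))\<^sup>2) \<longlonglongrightarrow> 0" .
    qed (use nd in \<open>auto intro!: always_eventually\<close>)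
    from tendsto_real_sqrt[OF this] have d0: "d \<longlonglongrightarrow> 0"
      by (simp add: tendsto_norm_zero_iff)
    obtain r g where r: "strict_mono (r :: nat \<Rightarrow> nat)" and g: "(\<lambda>j. T (v (r j))) \<longlonglongrightarrow> T g"
      by (rule T_seq_compact[of v]) (simp_all add: v(2))
    define u where "u = (1 / s\<^sup>2) *\<^sub>R TstarT g"
    have "(\<lambda>j. (1 / s\<^sup>2) *\<^sub>R (TstarT (v (r j)) - d (r j))) \<longlonglongrightarrow> (1 / s\<^sup>2) *\<^sub>R (TstarT g - 0)"
      unfolding TstarT_def
      by (intro tendsto_intros Tadj_tendsto g LIMSEQ_subseq_LIMSEQ[OF d0 r, unfolded o_def])
    also have "(\<lambda>j. (1 / s\<^sup>2) *\<^sub>R (TstarT (v (r j)) - d (r j))) = (\<lambda>j. v (r j))"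
      using s by (simp add: d_def)
    finally have u: "(\<lambda>j. v (r j)) \<longlonglongrightarrow> u" by (simp add: u_def)
    have "(\<lambda>j. norm (v (r j))) \<longlonglongrightarrow> norm u" by (intro tendsto_norm u)
    then have nu: "norm u = 1" by (simp add: v LIMSEQ_const_iff)
    have "cinner u (e i) = 0" if "i < n" for i
    proof -
      have "(\<lambda>j. cinner (v (r j)) (e i)) \<longlonglongrightarrow> cinner u (e i)" by (rule cinner_tendsto[OF u])
      moreover have "cinner (v (r j)) (e i) = 0" for j using v(1) that by (simp add: Orth_def)
      ultimately show ?thesis by (simp add: LIMSEQ_const_iff)
    qed
    then have uO: "u \<in> Orth n e" by (simp add: Orth_def)
    have "(\<lambda>j. norm (T (v (r j)))) \<longlonglongrightarrow> norm (T u)" by (intro tendsto_norm T_tendsto u)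
    moreover have "(\<lambda>j. norm (T (v (r j)))) \<longlonglongrightarrow> s"
      using LIMSEQ_subseq_LIMSEQ[OF lim_s r] by (simp add: o_def)
    ultimately have Tu: "norm (T u) = s" using LIMSEQ_unique by blast
    have "(\<lambda>j. d (r j)) \<longlonglongrightarrow> TstarT u - (s\<^sup>2) *\<^sub>R u"
      unfolding d_def by (intro tendsto_intros TstarT_tendsto u)
    moreover have "(\<lambda>j. d (r j)) \<longlonglongrightarrow> 0"
      using LIMSEQ_subseq_LIMSEQ[OF d0 r] by (simp add: o_def)
    ultimately have "TstarT u - (s\<^sup>2) *\<^sub>R u = 0" using LIMSEQ_unique by blast
    then have "eigvec u" using nu by (simp add: eigvec_def Tu scaleR_hardy2_def)
    then show ?thesis using uO le Tu by blast
  qed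
qed

text \<open>Repeated maximisation in the complement of the vectors already found. The condition
  \<open>P\<close> at \<open>n\<close> depends only on values below \<open>n\<close>, as the choice
  principle for well-orders requires.\<close>

lemma eigen_sequence:
  obtains e :: "nat \<Rightarrow> hardy2" where "\<And>n. eigvec (e n)" "\<And>i j. cinner (e i) (e j) = (if i = j then 1 else 0)"
    "\<And>n w. w \<in> Orth n e \<Longrightarrow> norm (T w) \<le> norm (T (e n)) * norm w"
proof -
  define P where "P e n v \<longleftrightarrow> eigvec v \<and> v \<in> Orth n e \<and>
      (\<forall>w\<in>Orth n e. norm (T w) \<le> norm (T v) * norm w)" for e :: "nat \<Rightarrow> hardy2" and n v
  have "\<exists>e. \<forall>n. P e n (e n)"
  proof (rule dependent_wellorder_choice)
    fix r and f g :: "nat \<Rightarrow> hardy2" and n assume "\<And>y. y < n \<Longrightarrow> f y = g y"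
    then have "Orth n f = Orth n g" by (auto simp: Orth_def)
    then show "P f n r = P g n r" by (simp add: P_def)
  next
    fix n and f :: "nat \<Rightarrow> hardy2" assume "\<And>y. y < n \<Longrightarrow> P f y (f y)"
    then show "\<exists>v. P f n v"
      unfolding P_def by (intro max_vector_exists) (auto simp: Orth_def)
  qed
  then obtain e where e: "\<And>n. P e n (e n)" by blast
  have o: "cinner (e j) (e i) = 0" if "i < j" for i j
    using e[of j] that by (simp add: P_def Orth_def)
  show ?thesis
  proof (rule that)
    show "eigvec (e n)" for n using e[of n] by (simp add: P_def)
    show "cinner (e i) (e j) = (if i = j then 1 else 0)" for i j
    proof (cases i j rule: linorder_cases)
      case less
      then show ?thesis using o[OF less] cnj_cinner[of "e j" "e i"] by simp
    next
      case equal
      then show ?thesis using e[of j] by (simp add: P_def eigvec_def cinner_self)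
    qed (simp add: o)
    show "norm (T w) \<le> norm (T (e n)) * norm w" if "w \<in> Orth n e" for n w
      using e[of n] that by (simp add: P_def)
  qed
qed

section \<open>Trace inequality and Schatten class\<close>

text \<open>Evaluate \<open>g = \<Sum> cnj (e\<^sub>j z) e\<^sub>j\<close> at \<open>z\<close>.\<close>

lemma orthonormal_eval:
  fixes e :: "nat \<Rightarrow> hardy2"
  assumes e: "\<And>i j. cinner (e i) (e j) = (if i = j then 1 else 0)" and z: "cmod z < 1"
  shows "(\<Sum>j<N. (cmod (hardy2_fun (e j) z))\<^sup>2) \<le> 1 / (1 - (cmod z)\<^sup>2)"
proof -
  have z2: "(cmod z)\<^sup>2 < 1" using z by (simp add: abs_square_less_1)
  define S where "S = (\<Sum>j<N. (cmod (hardy2_fun (e j) z))\<^sup>2)"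
  define g where "g = (\<Sum>j<N. hardy2_scaleC (cnj (hardy2_fun (e j) z)) (e j))"
  have 1: "cinner (e j) g = (if j < N then hardy2_fun (e j) z else 0)" for j
  proof -
    have "cinner g (e j) = (\<Sum>i<N. if i = j then cnj (hardy2_fun (e j) z) else 0)"
      unfolding g_def cinner_sum_left cinner_scaleC_left e by (intro sum.cong) auto
    then have "cinner g (e j) = (if j < N then cnj (hardy2_fun (e j) z) else 0)" by simp
    then have "cnj (cinner g (e j)) = (if j < N then hardy2_fun (e j) z else 0)" by simp
    then show ?thesis by simp
  qed
  have "cinner g g = (\<Sum>j<N. cnj (hardy2_fun (e j) z) * cinner (e j) g)"
    by (subst g_def) (simp add: cinner_sum_left cinner_scaleC_left)
  also have "\<dots> = of_real S"
    unfolding S_def of_real_sum complex_norm_square by (intro sum.cong) (auto simp: 1)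
  finally have ng: "(norm g)\<^sup>2 = S" unfolding cinner_self using of_real_eq_iff by blast
  have "hardy2_fun g z = (\<Sum>j<N. cnj (hardy2_fun (e j) z) * hardy2_fun (e j) z)"
    by (simp add: g_def hardy2_fun_sum hardy2_scaleC.rep_eq)
  also have "\<dots> = of_real S"
    unfolding S_def of_real_sum complex_norm_square by (intro sum.cong) auto
  finally have "(cmod (hardy2_fun g z))\<^sup>2 = S\<^sup>2" by simp
  with hardy2_eval_bound[OF z, of g] have *: "S * S \<le> S / (1 - (cmod z)\<^sup>2)"
    unfolding ng power2_eq_square[of S] by simp
  have "0 \<le> S" by (simp add: S_def sum_nonneg)
  have "S \<le> 1 / (1 - (cmod z)\<^sup>2)"
  proof (cases "S = 0")
    case False
    then have "S > 0" using \<open>0 \<le> S\<close> by simp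
    then have "S * S \<le> S * (1 / (1 - (cmod z)\<^sup>2))" using * by simp
    then show ?thesis using \<open>S > 0\<close> mult_le_cancel_left_pos by blast
  qed (use z2 in simp)
  then show ?thesis by (simp add: S_def)
qed

lemma sum_energy_le:
  fixes e :: "nat \<Rightarrow> hardy2"
  assumes e: "\<And>i j. cinner (e i) (e j) = (if i = j then 1 else 0)"
  shows "(\<Sum>j<N. energy (e j)) \<le> K"
proof -
  have "(\<Sum>j<N. energy (e j)) = (\<integral>x. (\<Sum>j<N. (cmod (hardy2_fun (e j) (\<psi> x)))\<^sup>2) \<partial>M)"
    unfolding energy_def by (intro Bochner_Integration.integral_sum[symmetric] integrable_energy)
  also have "\<dots> \<le> K"
    by (intro integral_mono Bochner_Integration.integrable_sum integrable_energy kernel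
        orthonormal_eval e psi_disc)
  finally show ?thesis .
qed

lemma norm_T_powr_le:
  assumes "norm v = 1"
  shows "norm (T v) powr (2 * q) \<le> 2 * (2 * C) powr (q - 1) * energy v"
proof (cases "norm (T v) = 0")
  case True
  then show ?thesis using energy_nonneg[of v] by simp
next
  case False
  define t where "t = (norm (T v))\<^sup>2"
  have t: "t > 0" using False by (simp add: t_def)
  \<comment> \<open>With this \<open>c\<close> the first term of \<open>bound\<close> is half of the
    left side and is absorbed there; what remains is solved for \<open>t powr q\<close>.\<close>
  define c where "c = t / (2 * C)"
  have c: "c > 0" using t C by (simp add: c_def)
  have "t \<le> c * C + c powr (1 - q) * energy v"
    using bound[OF c, of v] assms by (simp add: t_def energy_def)
  also have "c * C = t / 2" using C by (simp add: c_def)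
  finally have "t / 2 \<le> c powr (1 - q) * energy v" by simp
  then have "t / 2 * c powr (q - 1) \<le> (c powr (1 - q) * energy v) * c powr (q - 1)"
    by (intro mult_right_mono) auto
  also have "\<dots> = energy v * (c powr (1 - q) * c powr (q - 1))" by simp
  also have "c powr (1 - q) * c powr (q - 1) = 1" using c by (simp flip: powr_add)
  finally have 1: "t / 2 * c powr (q - 1) \<le> energy v" by simp
  have "c powr (q - 1) = t powr (q - 1) / (2 * C) powr (q - 1)"
    unfolding c_def using t C by (simp add: powr_divide)
  with 1 have "t * t powr (q - 1) \<le> 2 * (2 * C) powr (q - 1) * energy v"
    using C by (simp add: field_simps)
  moreover have "t * t powr (q - 1) = t powr q" using t by (simp add: powr_mult_base)
  moreover have "t powr q = norm (T v) powr (2 * q)"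
    unfolding t_def using False by (simp add: powr_power powr_powr flip: powr_numeral)
  ultimately show ?thesis by simp
qed

lemma schatten: "T \<in> schatten_class (2 * q)"
proof -
  obtain e :: "nat \<Rightarrow> hardy2" where eig: "\<And>n. eigvec (e n)"
    and on: "\<And>i j. cinner (e i) (e j) = (if i = j then 1 else 0)"
    and max: "\<And>n w. w \<in> Orth n e \<Longrightarrow> norm (T w) \<le> norm (T (e n)) * norm w"
    using eigen_sequence by blast
  define s where "s n = norm (T (e n))" for n
  have ne: "norm (e n) = 1" for n using eig by (simp add: eigvec_def)
  have Ae: "TstarT (e n) = hardy2_scaleC (of_real ((s n)\<^sup>2)) (e n)" for n
    using eig by (simp add: eigvec_def s_def)
  have s0: "0 \<le> s n" for n by (simp add: s_def)
  \<comment> \<open>\<open>e (Suc n)\<close> lies in the complement over which \<open>e n\<close> is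
    maximal.\<close>
  have "s (Suc n) \<le> s n" for n
    using max[of "e (Suc n)" n] by (simp add: on ne s_def Orth_def)
  then have dec: "decseq s" by (rule decseq_SucI)
  have sm: "summable (\<lambda>n. s n powr (2 * q))"
  proof (rule summableI_nonneg_bounded)
    show "(\<Sum>n<N. s n powr (2 * q)) \<le> 2 * (2 * C) powr (q - 1) * K" for N
    proof -
      have "(\<Sum>n<N. s n powr (2 * q)) \<le> (\<Sum>n<N. 2 * (2 * C) powr (q - 1) * energy (e n))"
        unfolding s_def by (intro sum_mono norm_T_powr_le ne)
      also have "\<dots> = 2 * (2 * C) powr (q - 1) * (\<Sum>n<N. energy (e n))"
        by (simp add: sum_distrib_left)
      also have "\<dots> \<le> 2 * (2 * C) powr (q - 1) * K"
        by (intro mult_left_mono sum_energy_le on) auto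
      finally show ?thesis .
    qed
  qed auto
  have "(\<lambda>n. (s n powr (2 * q)) powr (1 / (2 * q))) \<longlonglongrightarrow> 0"
  proof (rule tendsto_zero_powrI[OF summable_LIMSEQ_zero[OF sm] tendsto_const])
    show "0 < 1 / (2 * q)" using q by simp
  qed simp
  then have lim: "s \<longlonglongrightarrow> 0"
    using q s0 by (simp add: powr_powr)
  have dims: "card {n. s n = \<sigma>} =
      hardy2.dim {f. adjoint T (T f) = hardy2_scaleC (of_real (\<sigma>\<^sup>2)) f}" if \<sigma>: "\<sigma> > 0" for \<sigma>
  proof -
    let ?I = "{n. s n = \<sigma>}"
    let ?E = "{f. adjoint T (T f) = hardy2_scaleC (of_real (\<sigma>\<^sup>2)) f}"
    have "\<forall>\<^sub>F n in sequentially. s n < \<sigma>" using lim \<sigma> by (rule order_tendstoD)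
    then obtain N where "\<And>n. n \<ge> N \<Longrightarrow> s n < \<sigma>" by (auto simp: eventually_sequentially)
    then have "?I \<subseteq> {..<N}" by (force simp: not_le[symmetric])
    then have fin: "finite ?I" by (rule finite_subset) simp
    have inj: "inj e"
      by (rule injI) (metis on zero_neq_one)
    have "hardy2.dim ?E = card (e ` ?I)"
    proof (rule hardy2.dim_unique)
      show "e ` ?I \<subseteq> ?E" using Ae by (auto simp: adjoint_T TstarT_def)
      show "hardy2.independent (e ` ?I)"
      proof (rule hardy2.independent_if_scalars_zero)
        show "finite (e ` ?I)" using fin by simp
        fix f x assume 0: "(\<Sum>x\<in>e ` ?I. hardy2_scaleC (f x) x) = 0" and "x \<in> e ` ?I"
        then obtain i where i: "i \<in> ?I" "x = e i" by blast
        have "0 = cinner (\<Sum>j\<in>?I. hardy2_scaleC (f (e j)) (e j)) (e i)"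
          using 0 by (simp add: sum.reindex inj_on_subset[OF inj])
        also have "\<dots> = (\<Sum>j\<in>?I. if j = i then f (e i) else 0)"
          unfolding cinner_sum_left cinner_scaleC_left by (intro sum.cong) (auto simp: on)
        also have "\<dots> = f x" using i fin by simp
        finally show "f x = 0" by simp
      qed
      show "?E \<subseteq> hardy2.span (e ` ?I)"
      proof
        fix f assume "f \<in> ?E"
        then have Af: "TstarT f = hardy2_scaleC (of_real (\<sigma>\<^sup>2)) f" by (simp add: adjoint_T TstarT_def)
        \<comment> \<open>Eigenvectors of the selfadjoint \<open>TstarT\<close> for different
          eigenvalues are orthogonal, and nonnegative numbers with equal squares agree.\<close>
        have ortho: "cinner f (e n) = 0" if "s n \<noteq> \<sigma>" for n
        proof -
          have "of_real (\<sigma>\<^sup>2) * cinner f (e n) = of_real ((s n)\<^sup>2) * cinner f (e n)"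
            using TstarT_selfadjoint[of f "e n"]
            by (simp only: Af Ae cinner_scaleC_left cinner_scaleC_right complex_cnj_complex_of_real)
          then have "\<sigma>\<^sup>2 = (s n)\<^sup>2 \<or> cinner f (e n) = 0"
            using mult_right_cancel of_real_eq_iff by metis
          then show ?thesis using that \<sigma> s0[of n] by (auto simp: power2_eq_iff)
        qed
        define p where "p = (\<Sum>j\<in>?I. hardy2_scaleC (cinner f (e j)) (e j))"
        have "cinner (f - p) (e i) = 0" for i
        proof -
          have "cinner p (e i) = (\<Sum>j\<in>?I. if j = i then cinner f (e i) else 0)"
            unfolding p_def cinner_sum_left cinner_scaleC_left by (intro sum.cong) (auto simp: on)
          then have "cinner p (e i) = cinner f (e i)"
            using fin ortho[of i] by auto
          then show ?thesis by (simp add: cinner_diff_left)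
        qed
        \<comment> \<open>The system \<open>e\<close> may fail to be complete. A vector orthogonal
          to all \<open>e n\<close> lies in every complement, so its image is bounded by every
          \<open>s n\<close> times its norm and vanishes. Applying \<open>TstarT\<close> to
          \<open>f\<close> and to \<open>p\<close> then gives the same result, and
          \<open>f = p\<close>.\<close>
        then have "norm (T (f - p)) \<le> s n * norm (f - p)" for n
          unfolding s_def by (intro max) (simp add: Orth_def)
        moreover have "(\<lambda>n. s n * norm (f - p)) \<longlonglongrightarrow> 0"
          by (intro tendsto_mult_left_zero lim)
        ultimately have "norm (T (f - p)) \<le> 0"
          by (intro LIMSEQ_le_const) auto
        then have "T (f - p) = 0" by simp
        then have "TstarT (f - p) = 0"
          by (simp add: TstarT_def Tadj_zero)
        moreover have "TstarT p = hardy2_scaleC (of_real (\<sigma>\<^sup>2)) p"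
        proof -
          have "TstarT p = (\<Sum>j\<in>?I. TstarT (hardy2_scaleC (cinner f (e j)) (e j)))"
            unfolding p_def by (rule TstarT_sum)
          also have "\<dots> = hardy2_scaleC (of_real (\<sigma>\<^sup>2)) p"
            unfolding p_def hardy2.scale_sum_right
            by (intro sum.cong) (auto simp: TstarT_scaleC Ae mult.commute)
          finally show ?thesis .
        qed
        moreover have "TstarT f = TstarT (f - p) + TstarT p" by (simp flip: TstarT_add)
        ultimately have "hardy2_scaleC (of_real (\<sigma>\<^sup>2)) f = hardy2_scaleC (of_real (\<sigma>\<^sup>2)) p"
          using Af by simp
        then have "f = p" using \<sigma> by (simp add: hardy2.scale_left_imp_eq)
        moreover have "p \<in> hardy2.span (e ` ?I)"
          unfolding p_def by (intro hardy2.span_sum hardy2.span_scale hardy2.span_base) auto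
        ultimately show "f \<in> hardy2.span (e ` ?I)" by simp
      qed
    qed simp
    then show ?thesis using inj by (simp add: card_image inj_on_subset)
  qed
  have "singular_numbers T s"
    unfolding singular_numbers_def using dec s0 lim dims by blast
  then show ?thesis
    unfolding schatten_class_def using lin T_compact sm by blast
qed

end

section \<open>Composition operators and Parseval\<close>

lemma norm_htrunc_le: "norm (htrunc N f) \<le> norm f"
proof -
  have "(norm (htrunc N f))\<^sup>2 \<le> (norm f)\<^sup>2"
    unfolding norm_hardy2_sq
    by (intro suminf_le hardy2_summable) (auto simp: hcoeff_htrunc)
  then show ?thesis by (rule power2_le_imp_le) simp
qed

lemma hardy2_fun_hbasis:
  assumes "cmod z < 1"
  shows "hardy2_fun (hbasis m) z = z ^ m"
proof -
  have "(\<lambda>n. hcoeff (hbasis m) n * z ^ n) = (\<lambda>n. if n = m then z ^ m else 0)"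
    by (auto simp: hcoeff_hbasis)
  then have "(\<lambda>n. if n = m then z ^ m else 0) sums hardy2_fun (hbasis m) z"
    using hardy2_sums[OF assms, of "hbasis m"] by simp
  then show ?thesis using sums_single[of m "\<lambda>_. z ^ m"] sums_unique2 by metis
qed

lemma hardy2_fun_htrunc:
  assumes "cmod z < 1"
  shows "hardy2_fun (htrunc N f) z = (\<Sum>n<N. hcoeff f n * z ^ n)"
  by (simp add: htrunc_def hardy2_fun_sum hardy2_scaleC.rep_eq hardy2_fun_hbasis assms)

lemma hardy2_eval_diff_le:
  assumes "cmod z \<le> R" "R < 1"
  shows "cmod (hardy2_fun f z - hardy2_fun g z) \<le> norm (f - g) / sqrt (1 - R\<^sup>2)"
proof -
  have R: "0 \<le> R" "R\<^sup>2 < 1" using assms norm_ge_zero[of z] by (auto simp: abs_square_less_1 simp del: norm_ge_zero)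
  have "(cmod (hardy2_fun f z - hardy2_fun g z))\<^sup>2 \<le> (norm (f - g))\<^sup>2 / (1 - (cmod z)\<^sup>2)"
    using hardy2_eval_bound[of z "f - g"] assms by (simp add: hardy2_fun_diff)
  also have "\<dots> \<le> (norm (f - g))\<^sup>2 / (1 - R\<^sup>2)"
    using R assms by (intro divide_left_mono mult_pos_pos) (auto intro!: power_mono order_le_less_trans[OF power_mono[of _ R 2]])
  finally have "sqrt ((cmod (hardy2_fun f z - hardy2_fun g z))\<^sup>2) \<le> sqrt ((norm (f - g))\<^sup>2 / (1 - R\<^sup>2))"
    by (rule real_sqrt_le_mono)
  then show ?thesis by (simp add: real_sqrt_divide)
qed

lemma hardy2_eval_tendsto:
  assumes "F \<longlonglongrightarrow> f" "cmod z < 1"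
  shows "(\<lambda>n. hardy2_fun (F n) z) \<longlonglongrightarrow> hardy2_fun f z"
proof -
  have "(\<lambda>n. hardy2_fun (F n) z - hardy2_fun f z) \<longlonglongrightarrow> 0"
  proof (rule Lim_null_comparison)
    show "\<forall>\<^sub>F n in sequentially. norm (hardy2_fun (F n) z - hardy2_fun f z)
        \<le> norm (F n - f) / sqrt (1 - (cmod z)\<^sup>2)"
      using assms(2) by (intro always_eventually allI hardy2_eval_diff_le) auto
    show "(\<lambda>n. norm (F n - f) / sqrt (1 - (cmod z)\<^sup>2)) \<longlonglongrightarrow> 0"
      using assms(1) by (intro tendsto_divide_zero tendsto_norm_zero) (simp add: LIM_zero_iff)
  qed
  then show ?thesis by (simp add: LIM_zero_iff)
qed

section \<open>Composition with a self-map of the disc\<close>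

lemma hardy2_compose_holomorphic:
  assumes "\<phi> holomorphic_on ball 0 1" "\<phi> ` ball 0 1 \<subseteq> ball 0 1"
  shows "(\<lambda>z. hardy2_fun f (\<phi> z)) holomorphic_on ball 0 1"
  using holomorphic_on_compose_gen[OF assms(1) hardy2_holomorphic assms(2)] by (simp add: o_def)

text \<open>The disc of radius 1/2 is mapped into a compact part of the unit disc, where norm
  convergence in the Hardy space gives uniform convergence; the derivatives at 0 then
  converge.\<close>

lemma taylor_coeff_compose_tendsto:
  assumes \<phi>: "\<phi> holomorphic_on ball 0 1" "\<phi> ` ball 0 1 \<subseteq> ball 0 1" and F: "F \<longlonglongrightarrow> f"
  shows "(\<lambda>N. taylor_coeff (\<lambda>z. hardy2_fun (F N) (\<phi> z)) k) \<longlonglongrightarrow> taylor_coeff (\<lambda>z. hardy2_fun f (\<phi> z)) k"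
proof -
  have "compact (\<phi> ` cball 0 (1/2))"
    by (intro compact_continuous_image holomorphic_on_imp_continuous_on holomorphic_on_subset[OF \<phi>(1)]) auto
  then obtain w where w: "w \<in> \<phi> ` cball 0 (1/2)" "\<And>v. v \<in> \<phi> ` cball 0 (1/2) \<Longrightarrow> cmod v \<le> cmod w"
    using continuous_attains_sup[of "\<phi> ` cball 0 (1/2)" cmod] continuous_on_norm_id by auto
  define R where "R = cmod w"
  have "w \<in> \<phi> ` ball 0 1" using w(1) by (auto simp: image_iff)
  then have R: "R < 1" using \<phi>(2) by (auto simp: R_def)
  have le: "cmod (\<phi> z) \<le> R" if "z \<in> ball 0 (1/2)" for z
    unfolding R_def using that by (intro w(2)) auto
  have lim: "(\<lambda>N. norm (F N - f) / sqrt (1 - R\<^sup>2)) \<longlonglongrightarrow> 0"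
    using F by (intro tendsto_divide_zero tendsto_norm_zero) (simp add: LIM_zero_iff)
  have "uniform_limit (ball 0 (1/2)) (\<lambda>N z. hardy2_fun (F N) (\<phi> z)) (\<lambda>z. hardy2_fun f (\<phi> z)) sequentially"
  proof (rule uniform_limitI)
    fix e :: real assume "e > 0"
    with lim have "\<forall>\<^sub>F N in sequentially. norm (F N - f) / sqrt (1 - R\<^sup>2) < e"
      by (rule order_tendstoD)
    then show "\<forall>\<^sub>F N in sequentially. \<forall>z\<in>ball 0 (1/2). dist (hardy2_fun (F N) (\<phi> z)) (hardy2_fun f (\<phi> z)) < e"
    proof eventually_elim
      case (elim N)
      show ?case
        unfolding dist_norm using hardy2_eval_diff_le[OF le R] elim by (blast intro: le_less_trans)
    qed
  qed
  then have "(\<lambda>N. (deriv ^^ k) (\<lambda>z. hardy2_fun (F N) (\<phi> z)) 0) \<longlonglongrightarrow> (deriv ^^ k) (\<lambda>z. hardy2_fun f (\<phi> z)) 0"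
    by (rule higher_deriv_complex_uniform_limit)
       (auto intro!: always_eventually holomorphic_on_subset[OF hardy2_compose_holomorphic[OF \<phi>]])
  then show ?thesis unfolding taylor_coeff_def by (intro tendsto_divide) auto
qed

text \<open>\<open>poly_bound\<close> involves only polynomials and finitely many coefficients, so
  that it can be verified with continuous boundary functions. That composites lie in the Hardy space
  is a consequence, and it gives \<open>Abs_hardy2\<close> in \<open>composition_operator\<close>
  its meaning.\<close>

locale composition_trace_bound =
  fixes \<phi> :: "complex \<Rightarrow> complex" and M :: "'a measure" and \<psi> :: "'a \<Rightarrow> complex" and C q :: real
  assumes holo: "\<phi> holomorphic_on ball 0 1" and self_map: "\<phi> ` ball 0 1 \<subseteq> ball 0 1"
    and q: "q > 1" and C: "C > 0"
    and psi_meas: "\<psi> \<in> borel_measurable M"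
    and psi_disc: "\<And>x. x \<in> space M \<Longrightarrow> cmod (\<psi> x) < 1"
    and kernel: "integrable M (\<lambda>x. 1 / (1 - (cmod (\<psi> x))\<^sup>2))"
    and poly_bound: "\<And>c a N L. c > 0 \<Longrightarrow>
      (\<Sum>k<L. (cmod (taylor_coeff (\<lambda>z. \<Sum>n<N. a n * \<phi> z ^ n) k))\<^sup>2)
        \<le> c * C * (\<Sum>n<N. (cmod (a n))\<^sup>2)
          + c powr (1 - q) * (\<integral>x. (cmod (\<Sum>n<N. a n * \<psi> x ^ n))\<^sup>2 \<partial>M)"
begin

lemma phi_disc: "cmod z < 1 \<Longrightarrow> cmod (\<phi> z) < 1"
  using self_map by (auto simp: image_subset_iff)

text \<open>Both sides pass to the limit along truncations of \<open>f\<close>: on the left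
  coefficient by coefficient, on the right by dominated convergence with the reproducing kernel
  bound.\<close>

lemma coeff_bound:
  assumes c: "c > 0"
  shows "(\<Sum>k<L. (cmod (taylor_coeff (\<lambda>z. hardy2_fun f (\<phi> z)) k))\<^sup>2)
    \<le> c * C * (norm f)\<^sup>2 + c powr (1 - q) * (\<integral>x. (cmod (hardy2_fun f (\<psi> x)))\<^sup>2 \<partial>M)"
proof (rule LIMSEQ_le)
  show "(\<lambda>N. \<Sum>k<L. (cmod (taylor_coeff (\<lambda>z. hardy2_fun (htrunc N f) (\<phi> z)) k))\<^sup>2)
      \<longlonglongrightarrow> (\<Sum>k<L. (cmod (taylor_coeff (\<lambda>z. hardy2_fun f (\<phi> z)) k))\<^sup>2)"
    by (intro tendsto_intros taylor_coeff_compose_tendsto holo self_map htrunc_tendsto)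
  have meas: "(\<lambda>x. hardy2_fun g (\<psi> x)) \<in> borel_measurable M" for g
    using measurable_compose[OF psi_meas hardy2_fun_measurable] .
  have "(\<lambda>N. \<integral>x. (cmod (hardy2_fun (htrunc N f) (\<psi> x)))\<^sup>2 \<partial>M) \<longlonglongrightarrow> (\<integral>x. (cmod (hardy2_fun f (\<psi> x)))\<^sup>2 \<partial>M)"
  proof (rule integral_dominated_convergence)
    show "integrable M (\<lambda>x. (norm f)\<^sup>2 * (1 / (1 - (cmod (\<psi> x))\<^sup>2)))"
      by (intro integrable_mult_right kernel)
    show "AE x in M. (\<lambda>N. (cmod (hardy2_fun (htrunc N f) (\<psi> x)))\<^sup>2) \<longlonglongrightarrow> (cmod (hardy2_fun f (\<psi> x)))\<^sup>2"
      by (intro AE_I2 tendsto_intros hardy2_eval_tendsto htrunc_tendsto psi_disc)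
    show "AE x in M. norm ((cmod (hardy2_fun (htrunc N f) (\<psi> x)))\<^sup>2) \<le> (norm f)\<^sup>2 * (1 / (1 - (cmod (\<psi> x))\<^sup>2))" for N
    proof (rule AE_I2)
      fix x assume x: "x \<in> space M"
      have "(cmod (\<psi> x))\<^sup>2 < 1" using psi_disc[OF x] by (simp add: abs_square_less_1)
      then have "(norm (htrunc N f))\<^sup>2 / (1 - (cmod (\<psi> x))\<^sup>2) \<le> (norm f)\<^sup>2 / (1 - (cmod (\<psi> x))\<^sup>2)"
        by (intro divide_right_mono power_mono norm_htrunc_le) auto
      with hardy2_eval_bound[OF psi_disc[OF x], of "htrunc N f"]
      show "norm ((cmod (hardy2_fun (htrunc N f) (\<psi> x)))\<^sup>2) \<le> (norm f)\<^sup>2 * (1 / (1 - (cmod (\<psi> x))\<^sup>2))"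
        by simp
    qed
  qed (use meas in measurable)
  then show "(\<lambda>N. c * C * (norm f)\<^sup>2 + c powr (1 - q) * (\<integral>x. (cmod (hardy2_fun (htrunc N f) (\<psi> x)))\<^sup>2 \<partial>M))
      \<longlonglongrightarrow> c * C * (norm f)\<^sup>2 + c powr (1 - q) * (\<integral>x. (cmod (hardy2_fun f (\<psi> x)))\<^sup>2 \<partial>M)"
    by (intro tendsto_intros)
  have "(\<Sum>k<L. (cmod (taylor_coeff (\<lambda>z. hardy2_fun (htrunc N f) (\<phi> z)) k))\<^sup>2)
    \<le> c * C * (norm f)\<^sup>2 + c powr (1 - q) * (\<integral>x. (cmod (hardy2_fun (htrunc N f) (\<psi> x)))\<^sup>2 \<partial>M)" for N
  proof -
    have "taylor_coeff (\<lambda>z. hardy2_fun (htrunc N f) (\<phi> z)) k = taylor_coeff (\<lambda>z. \<Sum>n<N. hcoeff f n * \<phi> z ^ n) k" for k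
      by (rule taylor_coeff_cong) (simp add: hardy2_fun_htrunc phi_disc)
    moreover have "(\<integral>x. (cmod (hardy2_fun (htrunc N f) (\<psi> x)))\<^sup>2 \<partial>M) = (\<integral>x. (cmod (\<Sum>n<N. hcoeff f n * \<psi> x ^ n))\<^sup>2 \<partial>M)"
      by (intro Bochner_Integration.integral_cong) (auto simp: hardy2_fun_htrunc psi_disc)
    moreover have "(\<Sum>n<N. (cmod (hcoeff f n))\<^sup>2) \<le> (norm f)\<^sup>2"
      unfolding norm_hardy2_sq by (intro sum_le_suminf hardy2_summable) auto
    then have "c * C * (\<Sum>n<N. (cmod (hcoeff f n))\<^sup>2) \<le> c * C * (norm f)\<^sup>2"
      using c C by (intro mult_left_mono) auto
    ultimately show ?thesis using poly_bound[OF c, where L = L and N = N and a = "hcoeff f"] by simp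
  qed
  then show "\<exists>N0. \<forall>N\<ge>N0. (\<Sum>k<L. (cmod (taylor_coeff (\<lambda>z. hardy2_fun (htrunc N f) (\<phi> z)) k))\<^sup>2)
    \<le> c * C * (norm f)\<^sup>2 + c powr (1 - q) * (\<integral>x. (cmod (hardy2_fun (htrunc N f) (\<psi> x)))\<^sup>2 \<partial>M)" by blast
qed

lemma summable_compose: "summable (\<lambda>k. (cmod (taylor_coeff (\<lambda>z. hardy2_fun f (\<phi> z)) k))\<^sup>2)"
  by (rule norm_le_if_partial_sums(1)[OF coeff_bound[of 1]]) simp

lemmas composition_operator_rep =
  hardy2_fun_Abs[OF hardy2_compose_holomorphic[OF holo self_map] summable_compose,
    folded composition_operator_def]

lemma trace_bound: "trace_bound (composition_operator \<phi>) M \<psi> C q"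
proof
  show "composition_operator \<phi> (f + g) = composition_operator \<phi> f + composition_operator \<phi> g" for f g
    unfolding hardy2_fun_inject[symmetric]
    by (simp add: composition_operator_rep plus_hardy2.rep_eq fun_eq_iff)
  show "composition_operator \<phi> (hardy2_scaleC c f) = hardy2_scaleC c (composition_operator \<phi> f)" for c f
    unfolding hardy2_fun_inject[symmetric]
    by (simp add: composition_operator_rep hardy2_scaleC.rep_eq fun_eq_iff)
  show "(norm (composition_operator \<phi> f))\<^sup>2 \<le> c * C * (norm f)\<^sup>2 +
      c powr (1 - q) * (\<integral>x. (cmod (hardy2_fun f (\<psi> x)))\<^sup>2 \<partial>M)" if "c > 0" for c f
    unfolding norm_hardy2_sq[of "composition_operator \<phi> f"] composition_operator_rep(2)
    by (rule norm_le_if_partial_sums(2)[OF coeff_bound[OF that]])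
qed (use q C psi_meas psi_disc kernel in auto)

end

section \<open>Parseval and Bessel on circles\<close>

lemma cis_integral_period:
  "((\<lambda>y. cis (of_int k * y)) has_integral (if k = 0 then of_real (2 * pi) else 0)) {y0..y0 + 2 * pi}"
proof (cases "k = 0")
  case True
  then show ?thesis using has_integral_const_real[of "1::complex" y0 "y0 + 2 * pi"]
    by (simp add: scaleR_conv_of_real)
next
  case False
  let ?F = "\<lambda>y. cis (of_int k * y) / (\<i> * of_int k)"
  have "((\<lambda>y. cis (of_int k * y)) has_integral (?F (y0 + 2 * pi) - ?F y0)) {y0..y0 + 2 * pi}"
  proof (rule fundamental_theorem_of_calculus)
    fix y
    have "((\<lambda>y. cis (of_int k * y)) has_vector_derivative (of_int k * \<i> * cis (of_int k * y))) (at y within {y0..y0 + 2 * pi})"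
      unfolding has_vector_derivative_def
      by (rule derivative_eq_intros refl | simp)+ (auto simp: fun_eq_iff scaleR_conv_of_real mult_ac)
    then have "(?F has_vector_derivative (of_int k * \<i> * cis (of_int k * y)) / (\<i> * of_int k)) (at y within {y0..y0 + 2 * pi})"
      by (rule has_vector_derivative_divide)
    then show "(?F has_vector_derivative cis (of_int k * y)) (at y within {y0..y0 + 2 * pi})"
      using False by (simp add: mult_ac)
  qed simp
  moreover have "cis (of_int k * (y0 + 2 * pi)) = cis (of_int k * y0)"
    using cis_multiple_2pi[of "of_int k"] by (simp add: distrib_left cis_mult[symmetric] mult_ac)
  ultimately show ?thesis using False by simp
qed

lemma parseval_trig_poly:
  fixes a :: "nat \<Rightarrow> complex"
  shows "((\<lambda>y. (cmod (\<Sum>n<N. a n * cis (of_nat n * y)))\<^sup>2) has_integral (2 * pi * (\<Sum>n<N. (cmod (a n))\<^sup>2)))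
    {y0..y0 + 2 * pi}"
proof -
  let ?J = "{y0..y0 + 2 * pi}"
  have eq: "of_real ((cmod (\<Sum>n<N. a n * cis (of_nat n * y)))\<^sup>2) =
      (\<Sum>n<N. \<Sum>m<N. a n * cnj (a m) * cis (of_int (int n - int m) * y))" for y
    unfolding complex_norm_square cnj_sum sum_product
    by (intro sum.cong refl) (simp add: cis_cnj cis_mult algebra_simps)
  have "((\<lambda>y. \<Sum>n<N. \<Sum>m<N. a n * cnj (a m) * cis (of_int (int n - int m) * y)) has_integral
      (\<Sum>n<N. \<Sum>m<N. a n * cnj (a m) * (if int n - int m = 0 then of_real (2 * pi) else 0))) ?J"
    by (intro has_integral_sum finite_lessThan has_integral_mult_right cis_integral_period)
  also have "(\<Sum>n<N. \<Sum>m<N. a n * cnj (a m) * (if int n - int m = 0 then of_real (2 * pi) else 0))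
      = (\<Sum>n<N. \<Sum>m<N. if m = n then of_real (2 * pi) * (a n * cnj (a n)) else 0)"
    by (intro sum.cong) auto
  also have "\<dots> = (\<Sum>n<N. of_real (2 * pi) * (a n * cnj (a n)))"
    by (intro sum.cong) auto
  also have "\<dots> = of_real (2 * pi * (\<Sum>n<N. (cmod (a n))\<^sup>2))"
    unfolding of_real_mult[of "2 * pi"] of_real_sum complex_norm_square sum_distrib_left ..
  finally have "((\<lambda>y. of_real ((cmod (\<Sum>n<N. a n * cis (of_nat n * y)))\<^sup>2) :: complex) has_integral
      of_real (2 * pi * (\<Sum>n<N. (cmod (a n))\<^sup>2))) ?J"
    by (simp only: eq)
  from has_integral_linear[OF this bounded_linear_Re] show ?thesis
    by (simp only: o_def Re_complex_of_real)
qed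

text \<open>The missing endpoints are the point -1, where the coordinate \<open>tan (t / 2)\<close>
  becomes infinite and the boundary function of \<open>phi2\<close> is not continuous.\<close>

abbreviation arc_lebesgue :: "real measure" where
  "arc_lebesgue \<equiv> restrict_space lborel {-pi<..<pi}"

lemma emeasure_arc: "emeasure arc_lebesgue (space arc_lebesgue) = ennreal (2 * pi)"
  by (simp add: space_restrict_space emeasure_restrict_space)

lemma finite_measure_arc: "finite_measure arc_lebesgue"
  by (rule finite_measureI) (simp only: emeasure_arc, simp)

lemma arc_measurable:
  fixes f :: "real \<Rightarrow> 'b::topological_space"
  assumes "continuous_on {-pi<..<pi} f"
  shows "f \<in> borel_measurable arc_lebesgue"
proof -
  have "f \<in> borel_measurable (restrict_space borel {-pi<..<pi})"
    by (rule borel_measurable_continuous_on_restrict[OF assms])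
  moreover have "sets (restrict_space borel {-pi<..<pi}) = sets (arc_lebesgue :: real measure)"
    by (rule sets_restrict_space_cong) simp
  ultimately show ?thesis using measurable_cong_sets by blast
qed

lemma integrable_arc_bounded:
  fixes f :: "real \<Rightarrow> real"
  assumes "continuous_on {-pi<..<pi} f" "\<And>x. x \<in> {-pi<..<pi} \<Longrightarrow> \<bar>f x\<bar> \<le> B"
  shows "integrable arc_lebesgue f"
  by (rule finite_measure.integrable_const_bound[OF finite_measure_arc, of _ B])
     (use assms in \<open>auto intro!: AE_I2 arc_measurable simp: space_restrict_space\<close>)

lemma arc_integral_eq:
  fixes f :: "real \<Rightarrow> real"
  assumes "continuous_on {-pi..pi} f"
  shows "(\<integral>x. f x \<partial>arc_lebesgue) = integral {-pi..pi} f"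
proof -
  have *: "set_integrable lborel {-pi..pi} f"
    by (rule borel_integrable_atLeastAtMost'[OF assms])
  then have **: "set_integrable lborel {-pi<..<pi} f"
    by (rule set_integrable_subset) auto
  have "(\<integral>x. f x \<partial>arc_lebesgue) = (LINT x:{-pi<..<pi}|lborel. f x)"
    by (simp add: integral_restrict_space set_lebesgue_integral_def)
  also have "\<dots> = integral {-pi<..<pi} f"
    by (rule set_borel_integral_eq_integral(2)[OF **])
  also have "\<dots> = integral {-pi..pi} f"
    by (rule integral_open_interval_real[symmetric])
  finally show ?thesis .
qed

lemma integral_arc_const: "(\<integral>x. (c::real) \<partial>arc_lebesgue) = 2 * pi * c"
  unfolding lebesgue_integral_const measure_def emeasure_arc by simp

lemma cis_power_of_nat: "(of_real r * cis y) ^ n = of_real (r ^ n) * cis (of_nat n * y)"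
  by (simp add: power_mult_distrib Complex.DeMoivre)

text \<open>On a circle of radius below 1 the Taylor series is dominated by an absolutely convergent
  series, so Parseval for its partial sums passes to the limit.\<close>

lemma bessel_inner_circle:
  assumes g: "g holomorphic_on ball 0 1" and r: "0 \<le> r" "r < 1"
  shows "(\<Sum>k<K. (cmod (taylor_coeff g k))\<^sup>2 * r ^ (2 * k)) \<le> (1 / (2 * pi)) * (\<integral>x. (cmod (g (of_real r * cis x)))\<^sup>2 \<partial>arc_lebesgue)"
proof -
  let ?c = "taylor_coeff g"
  let ?S = "\<lambda>N x. \<Sum>k<N. ?c k * (of_real r * cis x) ^ k"
  have sums: "(\<lambda>k. ?c k * (of_real r * cis x) ^ k) sums g (of_real r * cis x)" for x
    using r by (intro holomorphic_sums_taylor_coeff g) (simp add: norm_mult)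
  have abs: "summable (\<lambda>k. cmod (?c k) * r ^ k)"
  proof -
    have "summable (\<lambda>k. ?c k * of_real ((1 + r) / 2) ^ k)"
      using holomorphic_sums_taylor_coeff[OF g, of "of_real ((1 + r) / 2)"] r
      by (simp only: sums_iff norm_of_real) simp
    then have "summable (\<lambda>k. cmod (?c k * of_real r ^ k))"
      by (rule powser_insidea) (use r in \<open>simp only: norm_of_real, simp\<close>)
    then show ?thesis using r by (simp add: norm_mult norm_power)
  qed
  define B where "B = (\<Sum>k. cmod (?c k) * r ^ k)"
  have SB: "cmod (?S N x) \<le> B" for N x
  proof -
    have "cmod (?S N x) \<le> (\<Sum>k<N. cmod (?c k) * r ^ k)"
      using r by (intro order_trans[OF norm_sum] sum_mono) (simp add: norm_mult norm_power)
    also have "\<dots> \<le> B"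
      unfolding B_def using r by (intro sum_le_suminf abs) auto
    finally show ?thesis .
  qed
  have B0: "0 \<le> B" using order_trans[OF norm_ge_zero SB] .
  have int: "(\<integral>x. (cmod (?S N x))\<^sup>2 \<partial>arc_lebesgue) = 2 * pi * (\<Sum>k<N. (cmod (?c k))\<^sup>2 * r ^ (2 * k))" for N
  proof -
    have "(\<integral>x. (cmod (?S N x))\<^sup>2 \<partial>arc_lebesgue) = integral {-pi..pi} (\<lambda>x. (cmod (?S N x))\<^sup>2)"
      by (rule arc_integral_eq) (intro continuous_intros)
    also have "\<dots> = 2 * pi * (\<Sum>k<N. (cmod (?c k * of_real (r ^ k)))\<^sup>2)"
      using parseval_trig_poly[of "\<lambda>k. ?c k * of_real (r ^ k)" N "-pi"]
      by (intro integral_unique) (simp add: cis_power_of_nat mult.assoc del: of_real_power)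
    also have "\<dots> = 2 * pi * (\<Sum>k<N. (cmod (?c k))\<^sup>2 * r ^ (2 * k))"
      using r by (simp add: norm_mult power_mult_distrib norm_power power_mult[symmetric] mult.commute)
    finally show ?thesis .
  qed
  have "(\<lambda>N. \<integral>x. (cmod (?S N x))\<^sup>2 \<partial>arc_lebesgue) \<longlonglongrightarrow> (\<integral>x. (cmod (g (of_real r * cis x)))\<^sup>2 \<partial>arc_lebesgue)"
  proof (rule integral_dominated_convergence)
    show "integrable arc_lebesgue (\<lambda>x. B\<^sup>2)"
      by (rule integrable_arc_bounded) auto
    show "AE x in arc_lebesgue. (\<lambda>N. (cmod (?S N x))\<^sup>2) \<longlonglongrightarrow> (cmod (g (of_real r * cis x)))\<^sup>2"
      using sums unfolding sums_def by (intro AE_I2 tendsto_intros)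
    show "AE x in arc_lebesgue. norm ((cmod (?S N x))\<^sup>2) \<le> B\<^sup>2" for N
      using SB B0 by (intro AE_I2) (simp add: power_mono)
    show "(\<lambda>x. (cmod (g (of_real r * cis x)))\<^sup>2) \<in> borel_measurable arc_lebesgue"
      using r by (intro arc_measurable continuous_intros continuous_on_compose2[OF holomorphic_on_imp_continuous_on[OF g]])
        (auto simp: norm_mult)
    show "(\<lambda>x. (cmod (?S N x))\<^sup>2) \<in> borel_measurable arc_lebesgue" for N
      by (intro arc_measurable continuous_intros)
  qed
  then have "2 * pi * (\<Sum>k<K. (cmod (?c k))\<^sup>2 * r ^ (2 * k)) \<le> (\<integral>x. (cmod (g (of_real r * cis x)))\<^sup>2 \<partial>arc_lebesgue)"
  proof (rule LIMSEQ_le_const)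
    have "2 * pi * (\<Sum>k<K. (cmod (?c k))\<^sup>2 * r ^ (2 * k)) \<le> (\<integral>x. (cmod (?S N x))\<^sup>2 \<partial>arc_lebesgue)" if "N \<ge> K" for N
      unfolding int using that r by (intro mult_left_mono sum_mono2) auto
    then show "\<exists>N. \<forall>n\<ge>N. 2 * pi * (\<Sum>k<K. (cmod (?c k))\<^sup>2 * r ^ (2 * k)) \<le> (\<integral>x. (cmod (?S n x))\<^sup>2 \<partial>arc_lebesgue)" by blast
  qed
  then show ?thesis by (simp add: field_simps)
qed

text \<open>Fatou's theorem is bypassed: the radial limits on the open arc are supplied as
  \<open>h\<close>, and boundedness of \<open>g\<close> lets the radius tend to 1 by dominated
  convergence.\<close>

lemma bessel_circle:
  assumes g: "g holomorphic_on ball 0 1" and B: "\<And>z. cmod z < 1 \<Longrightarrow> cmod (g z) \<le> B"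
    and h: "continuous_on {-pi<..<pi} h"
    and lim: "\<And>x. x \<in> {-pi<..<pi} \<Longrightarrow> ((\<lambda>r. g (of_real r * cis x)) \<longlongrightarrow> h x) (at_left 1)"
  shows "(\<Sum>k<K. (cmod (taylor_coeff g k))\<^sup>2) \<le> (1 / (2 * pi)) * (\<integral>x. (cmod (h x))\<^sup>2 \<partial>arc_lebesgue)"
proof (rule LIMSEQ_le)
  define r where "r n = 1 - 1 / real (Suc n)" for n
  have r: "0 \<le> r n" "r n < 1" for n by (auto simp: r_def field_simps)
  have "r \<longlonglongrightarrow> 1 - 0" unfolding r_def by (intro tendsto_intros LIMSEQ_Suc[OF lim_1_over_n])
  then have r1: "r \<longlonglongrightarrow> 1" by simp
  then have rl: "filterlim r (at_left 1) sequentially"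
    unfolding filterlim_at using r less_imp_neq[OF r(2)] by (auto intro!: always_eventually)
  have "(\<lambda>n. \<Sum>k<K. (cmod (taylor_coeff g k))\<^sup>2 * r n ^ (2 * k)) \<longlonglongrightarrow> (\<Sum>k<K. (cmod (taylor_coeff g k))\<^sup>2 * 1 ^ (2 * k))"
    by (intro tendsto_intros r1)
  then show "(\<lambda>n. \<Sum>k<K. (cmod (taylor_coeff g k))\<^sup>2 * r n ^ (2 * k)) \<longlonglongrightarrow> (\<Sum>k<K. (cmod (taylor_coeff g k))\<^sup>2)"
    by simp
  have "(\<lambda>n. \<integral>x. (cmod (g (of_real (r n) * cis x)))\<^sup>2 \<partial>arc_lebesgue) \<longlonglongrightarrow> (\<integral>x. (cmod (h x))\<^sup>2 \<partial>arc_lebesgue)"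
  proof (rule integral_dominated_convergence)
    show "integrable arc_lebesgue (\<lambda>x. B\<^sup>2)"
      by (rule integrable_arc_bounded) auto
    show "AE x in arc_lebesgue. (\<lambda>n. (cmod (g (of_real (r n) * cis x)))\<^sup>2) \<longlonglongrightarrow> (cmod (h x))\<^sup>2"
      by (intro AE_I2 tendsto_intros filterlim_compose[OF lim rl]) (simp add: space_restrict_space)
    show "AE x in arc_lebesgue. norm ((cmod (g (of_real (r n) * cis x)))\<^sup>2) \<le> B\<^sup>2" for n
      using r by (intro AE_I2) (auto intro!: power_mono B simp: norm_mult)
    show "(\<lambda>x. (cmod (g (of_real (r n) * cis x)))\<^sup>2) \<in> borel_measurable arc_lebesgue" for n
      using r by (intro arc_measurable continuous_intros continuous_on_compose2[OF holomorphic_on_imp_continuous_on[OF g]])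
        (auto simp: norm_mult)
    show "(\<lambda>x. (cmod (h x))\<^sup>2) \<in> borel_measurable arc_lebesgue"
      by (intro arc_measurable continuous_intros h)
  qed
  then show "(\<lambda>n. (1 / (2 * pi)) * (\<integral>x. (cmod (g (of_real (r n) * cis x)))\<^sup>2 \<partial>arc_lebesgue)) \<longlonglongrightarrow> (1 / (2 * pi)) * (\<integral>x. (cmod (h x))\<^sup>2 \<partial>arc_lebesgue)"
    by (intro tendsto_intros)
  show "\<exists>N. \<forall>n\<ge>N. (\<Sum>k<K. (cmod (taylor_coeff g k))\<^sup>2 * r n ^ (2 * k)) \<le> (1 / (2 * pi)) * (\<integral>x. (cmod (g (of_real (r n) * cis x)))\<^sup>2 \<partial>arc_lebesgue)"
    using bessel_inner_circle[OF g r] by blast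
qed

section \<open>Non-compactness from a finite angular derivative\<close>

lemma bounded_holomorphic_summable:
  assumes g: "g holomorphic_on ball 0 1" and B: "\<And>z. cmod z < 1 \<Longrightarrow> cmod (g z) \<le> B"
  shows "summable (\<lambda>k. (cmod (taylor_coeff g k))\<^sup>2)"
proof (rule norm_le_if_partial_sums(1))
  fix K
  define r where "r n = 1 - 1 / real (Suc n)" for n
  have r: "0 \<le> r n" "r n < 1" for n by (auto simp: r_def field_simps)
  have "r \<longlonglongrightarrow> 1 - 0" unfolding r_def by (intro tendsto_intros LIMSEQ_Suc[OF lim_1_over_n])
  then have "(\<lambda>n. \<Sum>k<K. (cmod (taylor_coeff g k))\<^sup>2 * r n ^ (2 * k)) \<longlonglongrightarrow> (\<Sum>k<K. (cmod (taylor_coeff g k))\<^sup>2 * 1 ^ (2 * k))"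
    by (intro tendsto_intros) simp
  moreover have "(\<Sum>k<K. (cmod (taylor_coeff g k))\<^sup>2 * r n ^ (2 * k)) \<le> B\<^sup>2" for n
  proof -
    have "(\<integral>x. (cmod (g (of_real (r n) * cis x)))\<^sup>2 \<partial>arc_lebesgue) \<le> (\<integral>x. B\<^sup>2 \<partial>arc_lebesgue)"
    proof (rule integral_mono)
      have c: "continuous_on {-pi<..<pi} (\<lambda>x. (cmod (g (of_real (r n) * cis x)))\<^sup>2)"
        using r by (intro continuous_intros continuous_on_compose2[OF holomorphic_on_imp_continuous_on[OF g]])
          (auto simp: norm_mult)
      show le: "(cmod (g (of_real (r n) * cis x)))\<^sup>2 \<le> B\<^sup>2" for x
        using r by (auto intro!: power_mono B simp: norm_mult)
      show "integrable arc_lebesgue (\<lambda>x. (cmod (g (of_real (r n) * cis x)))\<^sup>2)"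
        using le by (intro integrable_arc_bounded[OF c]) simp
    qed (rule integrable_arc_bounded, auto)
    then have "(1 / (2 * pi)) * (\<integral>x. (cmod (g (of_real (r n) * cis x)))\<^sup>2 \<partial>arc_lebesgue) \<le> B\<^sup>2"
      unfolding integral_arc_const by (simp add: field_simps)
    with bessel_inner_circle[OF g r, of n K] show ?thesis by simp
  qed
  ultimately show "(\<Sum>k<K. (cmod (taylor_coeff g k))\<^sup>2) \<le> B\<^sup>2"
    by (intro LIMSEQ_le_const2) auto
qed

text \<open>The assumption \<open>ang\<close> says that the radial value at -1 is 1, with finite
  angular derivative. The \<open>f n\<close> are normalised kernels at points \<open>r n\<close>
  tending to 1. They tend to zero pointwise, so any limit of their images is 0; but evaluating the
  images at \<open>- r n\<close> shows that their norms stay at least 1 / B.\<close>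

lemma not_compact_if_angular_derivative:
  assumes holo: "\<phi> holomorphic_on ball 0 1" and self_map: "\<phi> ` ball 0 1 \<subseteq> ball 0 1"
    and ang: "\<And>\<rho>. 0 < \<rho> \<Longrightarrow> \<rho> < 1 \<Longrightarrow> cmod (1 - of_real \<rho> * \<phi> (of_real (- \<rho>))) \<le> B * (1 - \<rho>)"
  shows "\<not> compact_operator (composition_operator \<phi>)"
proof
  assume "compact_operator (composition_operator \<phi>)"
  then have cpt: "seq_compact (closure (composition_operator \<phi> ` cball 0 1))"
    unfolding compact_operator_def compact_eq_seq_compact_metric .
  \<comment> \<open>\<open>n + 2\<close> keeps \<open>r n\<close> positive already for
    \<open>n = 0\<close>, as \<open>ang\<close> requires.\<close>
  define r where "r n = 1 - 1 / real (n + 2)" for n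
  have r: "0 < r n" "r n < 1" for n by (auto simp: r_def field_simps)
  have r2: "(r n)\<^sup>2 < 1" for n using r[of n] by (simp add: abs_square_less_1)
  have "r \<longlonglongrightarrow> 1 - 0" unfolding r_def
    using LIMSEQ_ignore_initial_segment[OF lim_1_over_n[where 'a=real], of 2] by (intro tendsto_intros) simp
  then have r1: "r \<longlonglongrightarrow> 1" by simp
  define f where "f n = hardy2_of (\<lambda>k. of_real (sqrt (1 - (r n)\<^sup>2)) * of_real (r n) ^ k)" for n
  have s: "(\<lambda>k. (cmod (of_real (sqrt (1 - (r n)\<^sup>2)) * of_real (r n) ^ k))\<^sup>2) sums 1" for n
  proof -
    have "(\<lambda>k. (1 - (r n)\<^sup>2) * ((r n)\<^sup>2) ^ k) sums ((1 - (r n)\<^sup>2) * (1 / (1 - (r n)\<^sup>2)))"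
      using r2[of n] by (intro sums_mult geometric_sums) simp
    then show ?thesis
      using r2[of n] r[of n]
      by (simp add: norm_mult norm_power power_mult_distrib abs_of_pos less_imp_le power_mult[symmetric] mult.commute[of _ 2])
  qed
  have cf: "hcoeff (f n) k = of_real (sqrt (1 - (r n)\<^sup>2)) * of_real (r n) ^ k" for n k
    unfolding f_def using s[of n] by (intro hcoeff_hardy2_of) (simp add: sums_iff)
  have nf: "norm (f n) = 1" for n
  proof -
    have "(norm (f n))\<^sup>2 = 1" unfolding norm_hardy2_sq cf using s[of n] by (simp add: sums_iff)
    then show ?thesis by (metis norm_ge_zero power2_eq_imp_eq one_power2 zero_le_one)
  qed
  have ev: "hardy2_fun (f n) w = of_real (sqrt (1 - (r n)\<^sup>2)) / (1 - of_real (r n) * w)" if w: "cmod w < 1" for n w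
  proof -
    have "cmod (of_real (r n) * w) < 1"
      using r[of n] w mult_strict_mono'[of "r n" 1 "cmod w" 1] by (simp add: norm_mult)
    then have "(\<lambda>k. of_real (sqrt (1 - (r n)\<^sup>2)) * (of_real (r n) * w) ^ k) sums
        (of_real (sqrt (1 - (r n)\<^sup>2)) * (1 / (1 - of_real (r n) * w)))"
      by (intro sums_mult geometric_sums)
    moreover have "(\<lambda>k. of_real (sqrt (1 - (r n)\<^sup>2)) * (of_real (r n) * w) ^ k) sums hardy2_fun (f n) w"
      using hardy2_sums[OF w, of "f n"] by (simp add: cf power_mult_distrib mult.assoc)
    ultimately show ?thesis using sums_unique2 by fastforce
  qed
  have phi_disc: "cmod (\<phi> z) < 1" if "cmod z < 1" for z
    using self_map that by (auto simp: image_subset_iff)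
  have den: "1 - t \<le> cmod (1 - of_real (r n) * w)" if "cmod w \<le> t" for n w t
  proof -
    have "r n * cmod w \<le> 1 * t" using r[of n] that by (intro mult_mono) auto
    then have "1 - t \<le> cmod 1 - cmod (of_real (r n) * w)" using r[of n] by (simp add: norm_mult)
    also have "\<dots> \<le> cmod (1 - of_real (r n) * w)" by (rule norm_triangle_ineq2)
    finally show ?thesis .
  qed
  \<comment> \<open>The pole \<open>1 / r n\<close> of \<open>f n\<close> lies outside the closed
    disc, so its composite is bounded and hence in the Hardy space. This takes the place of the
    subordination principle on the vectors that matter.\<close>
  have "summable (\<lambda>k. (cmod (taylor_coeff (\<lambda>z. hardy2_fun (f n) (\<phi> z)) k))\<^sup>2)" for n
  proof (rule bounded_holomorphic_summable)
    fix z :: complex assume z: "cmod z < 1"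
    have "1 - r n \<le> cmod (1 - of_real (r n) * \<phi> z)"
    proof -
      have "cmod (of_real (r n) * \<phi> z) \<le> r n"
        using r[of n] phi_disc[OF z] by (simp add: norm_mult)
      moreover have "cmod 1 - cmod (of_real (r n) * \<phi> z) \<le> cmod (1 - of_real (r n) * \<phi> z)"
        by (rule norm_triangle_ineq2)
      ultimately show ?thesis by simp
    qed
    then show "cmod (hardy2_fun (f n) (\<phi> z)) \<le> sqrt (1 - (r n)\<^sup>2) / (1 - r n)"
      unfolding ev[OF phi_disc[OF z]] norm_divide using r[of n] r2[of n]
      by (intro frac_le) auto
  qed (rule hardy2_compose_holomorphic[OF holo self_map])
  note rep = hardy2_fun_Abs[OF hardy2_compose_holomorphic[OF holo self_map] this,
    folded composition_operator_def]
  have "composition_operator \<phi> (f n) \<in> closure (composition_operator \<phi> ` cball 0 1)" for n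
    by (intro subsetD[OF closure_subset] imageI) (simp add: nf)
  with cpt obtain l k where k: "strict_mono (k :: nat \<Rightarrow> nat)"
    and l: "((\<lambda>n. composition_operator \<phi> (f n)) \<circ> k) \<longlonglongrightarrow> l"
    unfolding seq_compact_def by metis
  then have l: "(\<lambda>n. composition_operator \<phi> (f (k n))) \<longlonglongrightarrow> l" by (simp add: o_def)
  have "hardy2_fun l z = 0" for z
  proof (cases "cmod z < 1")
    case z: True
    have "(\<lambda>n. sqrt (1 - (r n)\<^sup>2) / (1 - cmod (\<phi> z))) \<longlonglongrightarrow> sqrt (1 - 1\<^sup>2) / (1 - cmod (\<phi> z))"
      using phi_disc[OF z] by (intro tendsto_intros r1) auto
    then have t: "(\<lambda>n. sqrt (1 - (r n)\<^sup>2) / (1 - cmod (\<phi> z))) \<longlonglongrightarrow> 0" by simp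
    have "(\<lambda>n. hardy2_fun (f n) (\<phi> z)) \<longlonglongrightarrow> 0"
    proof (rule Lim_null_comparison[OF always_eventually t], rule allI)
      fix n
      show "cmod (hardy2_fun (f n) (\<phi> z)) \<le> sqrt (1 - (r n)\<^sup>2) / (1 - cmod (\<phi> z))"
        unfolding ev[OF phi_disc[OF z]] norm_divide using r2[of n] phi_disc[OF z] den[OF order_refl, of "\<phi> z" n]
        by (intro frac_le) simp_all
    qed
    then have "(\<lambda>n. hardy2_fun (f (k n)) (\<phi> z)) \<longlonglongrightarrow> 0"
      using LIMSEQ_subseq_LIMSEQ[OF _ k] by (fastforce simp: o_def)
    moreover have "(\<lambda>n. hardy2_fun (f (k n)) (\<phi> z)) \<longlonglongrightarrow> hardy2_fun l z"
      using hardy2_eval_tendsto[OF l z] z by (simp add: rep)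
    ultimately show ?thesis using LIMSEQ_unique by blast
  qed (simp add: hardy2_outside)
  then have "l = 0" by (simp add: hardy2_fun_inject[symmetric] zero_hardy2.rep_eq fun_eq_iff)
  then have lim0: "(\<lambda>n. B * norm (composition_operator \<phi> (f (k n)))) \<longlonglongrightarrow> 0"
    using l by (intro tendsto_mult_right_zero tendsto_norm_zero) simp
  \<comment> \<open>At \<open>z = - r n\<close> the composite has modulus
    \<open>sqrt (1 - (r n)\<^sup>2) / X\<close> with \<open>X\<close> of order
    \<open>1 - r n\<close>. Up to the factor \<open>B\<close> this is the largest growth that
    \<open>hardy2_eval_bound\<close> allows to a function of norm 1.\<close>
  have lower: "1 \<le> B * norm (composition_operator \<phi> (f n))" for n
  proof -
    define z where "z = complex_of_real (- r n)"
    have z: "cmod z < 1" "cmod z = r n" using r[of n] by (auto simp: z_def)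
    define X where "X = cmod (1 - of_real (r n) * \<phi> z)"
    have X: "X > 0" using den[OF order_refl, of "\<phi> z" n] phi_disc[OF z(1)] unfolding X_def by linarith
    have XB: "X \<le> B * (1 - r n)" unfolding X_def z_def using r[of n] by (intro ang)
    have "(cmod (hardy2_fun (composition_operator \<phi> (f n)) z))\<^sup>2
        \<le> (norm (composition_operator \<phi> (f n)))\<^sup>2 / (1 - (cmod z)\<^sup>2)"
      by (rule hardy2_eval_bound[OF z(1)])
    also have "hardy2_fun (composition_operator \<phi> (f n)) z = hardy2_fun (f n) (\<phi> z)"
      using z by (simp add: rep)
    finally have "(1 - (r n)\<^sup>2) / X\<^sup>2 \<le> (norm (composition_operator \<phi> (f n)))\<^sup>2 / (1 - (r n)\<^sup>2)"
      unfolding ev[OF phi_disc[OF z(1)]] norm_divide X_def[symmetric] z(2)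
      using r2[of n] by (simp add: power_divide)
    then have "(1 - (r n)\<^sup>2)\<^sup>2 \<le> (X * norm (composition_operator \<phi> (f n)))\<^sup>2"
      using X r2[of n] by (simp add: field_simps power2_eq_square)
    then have "1 - (r n)\<^sup>2 \<le> X * norm (composition_operator \<phi> (f n))"
      by (rule power2_le_imp_le) (use X in simp)
    also have "\<dots> \<le> B * (1 - r n) * norm (composition_operator \<phi> (f n))"
      by (intro mult_right_mono XB) simp
    finally have "(1 + r n) * (1 - r n) \<le> (B * norm (composition_operator \<phi> (f n))) * (1 - r n)"
      by (simp add: power2_eq_square algebra_simps)
    then have "1 + r n \<le> B * norm (composition_operator \<phi> (f n))"
      using r[of n] by simp
    then show ?thesis using r[of n] by linarith
  qed
  from LIMSEQ_le_const[OF lim0] lower show False by fastforce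
qed

section \<open>The image curve\<close>

text \<open>The substitution \<open>y = \<Theta> t\<close> costs the factor 1 / m, and by
  \<open>turn\<close> the image lies in one period, over which Parseval is exact.\<close>

lemma parseval_along_phase:
  fixes b :: "nat \<Rightarrow> complex" and \<Theta> \<Theta>' :: "real \<Rightarrow> real"
  assumes t: "t1 \<le> t2" and d: "\<And>t. t \<in> {t1..t2} \<Longrightarrow> (\<Theta> has_real_derivative \<Theta>' t) (at t)"
    and m: "m > 0" "\<And>t. t \<in> {t1..t2} \<Longrightarrow> m \<le> \<Theta>' t" and turn: "\<Theta> t2 \<le> \<Theta> t1 + 2 * pi"
  shows "integral {t1..t2} (\<lambda>t. (cmod (\<Sum>n<N. b n * cis (real n * \<Theta> t)))\<^sup>2)
    \<le> 2 * pi / m * (\<Sum>n<N. (cmod (b n))\<^sup>2)"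
proof -
  define R where "R y = (cmod (\<Sum>n<N. b n * cis (real n * y)))\<^sup>2" for y
  have cR: "continuous_on S R" for S unfolding R_def by (intro continuous_intros)
  have c\<Theta>: "continuous_on {t1..t2} \<Theta>"
    by (rule continuous_at_imp_continuous_on) (blast intro: d DERIV_isCont)
  have "compact (\<Theta> ` {t1..t2})" by (intro compact_continuous_image c\<Theta>) auto
  then obtain c where c: "\<Theta> ` {t1..t2} \<subseteq> {-c..c}"
    using compact_imp_bounded[THEN bounded_subset_ballD, of "\<Theta> ` {t1..t2}" 0]
    by (auto simp: subset_iff dist_norm abs_less_iff) (metis abs_le_iff less_imp_le minus_le_iff)
  have mono: "\<Theta> t1 \<le> \<Theta> t2"
    using t d m by (intro DERIV_nonneg_imp_nondecreasing[of t1 t2 \<Theta>]) (fastforce intro: less_imp_le order_trans)+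
  have "((\<lambda>t. \<Theta>' t *\<^sub>R R (\<Theta> t)) has_integral integral {\<Theta> t1..\<Theta> t2} R) {t1..t2}"
    by (rule has_integral_substitution[OF t mono c cR]) (use d in \<open>auto intro: has_field_derivative_at_within\<close>)
  moreover have "((\<lambda>t. m * R (\<Theta> t)) has_integral (m * integral {t1..t2} (\<lambda>t. R (\<Theta> t)))) {t1..t2}"
    by (intro has_integral_mult_right integrable_integral integrable_continuous_real
        continuous_on_compose2[OF cR c\<Theta>]) auto
  moreover have "m * R (\<Theta> t) \<le> \<Theta>' t *\<^sub>R R (\<Theta> t)" if "t \<in> {t1..t2}" for t
    using m(2)[OF that] by (simp add: R_def mult_right_mono)
  ultimately have "m * integral {t1..t2} (\<lambda>t. R (\<Theta> t)) \<le> integral {\<Theta> t1..\<Theta> t2} R"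
    by (meson has_integral_le)
  also have "\<dots> \<le> integral {\<Theta> t1..\<Theta> t1 + 2 * pi} R"
    using turn by (intro integral_subset_le integrable_continuous_real cR) (auto simp: R_def)
  also have "\<dots> = 2 * pi * (\<Sum>n<N. (cmod (b n))\<^sup>2)"
    unfolding R_def by (rule integral_unique[OF parseval_trig_poly])
  finally show ?thesis using m(1) by (simp add: R_def field_simps)
qed

text \<open>On each vertical line the phase can be substituted and Parseval applies; the passage from the line
  \<open>v = A\<close> to the curve costs the integral of the derivative in \<open>v\<close>, which is controlled by
  \<open>n exp (- n v) \<le> 1 / A\<close> and is harmless as long as \<open>B - A\<close> is comparable to \<open>A\<close>.\<close>

lemma curve_estimate:
  fixes a :: "nat \<Rightarrow> complex" and \<sigma> \<Theta> \<Theta>' :: "real \<Rightarrow> real"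
  assumes t: "t1 \<le> t2" and d: "\<And>t. t \<in> {t1..t2} \<Longrightarrow> (\<Theta> has_real_derivative \<Theta>' t) (at t)"
    and m: "m > 0" "\<And>t. t \<in> {t1..t2} \<Longrightarrow> m \<le> \<Theta>' t" and turn: "\<Theta> t2 \<le> \<Theta> t1 + 2 * pi"
    and \<sigma>: "continuous_on {t1..t2} \<sigma>" "\<And>t. t \<in> {t1..t2} \<Longrightarrow> A \<le> \<sigma> t \<and> \<sigma> t \<le> B" and A: "A > 0"
  shows "integral {t1..t2} (\<lambda>t. (cmod (\<Sum>n<N. a n * (of_real (exp (- \<sigma> t)) * cis (\<Theta> t)) ^ n))\<^sup>2)
    \<le> 2 * pi / m * (\<Sum>n<N. (cmod (a n))\<^sup>2) * (1 + 2 * (B - A) / A)"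
proof -
  define F where "F v y = (\<Sum>n<N. a n * of_real (exp (- (real n * v))) * cis (real n * y))" for v y
  define G where "G v y = (\<Sum>n<N. - (of_nat n * a n * of_real (exp (- (real n * v)))) * cis (real n * y))" for v y
  \<comment> \<open>\<open>G\<close> is the derivative of \<open>F\<close> in \<open>v\<close>, and
    \<open>Q\<close> dominates the derivative of \<open>|F|\<^sup>2\<close> by the inequality of
    arithmetic and geometric means. The weights 1 / A and A are balanced: along each line both terms
    integrate to at most D / A.\<close>
  define Q where "Q v y = (cmod (F v y))\<^sup>2 / A + A * (cmod (G v y))\<^sup>2" for v y
  define S where "S = (\<Sum>n<N. (cmod (a n))\<^sup>2)"
  define D where "D = 2 * pi / m * S"
  have S0: "0 \<le> S" by (simp add: S_def sum_nonneg)
  have AB: "A \<le> B" using \<sigma>(2)[of t1] t by auto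
  have c\<Theta>: "continuous_on {t1..t2} \<Theta>"
    by (rule continuous_at_imp_continuous_on) (blast intro: d DERIV_isCont)
  have Q0: "0 \<le> Q v y" for v y using A by (simp add: Q_def)
  have contF: "continuous_on X (\<lambda>v. F v y)" "continuous_on X (\<lambda>v. G v y)"
    "continuous_on X (\<lambda>y. F v y)" "continuous_on X (\<lambda>y. G v y)" for X v y
    unfolding F_def G_def by (intro continuous_intros)+
  have deriv: "((\<lambda>v. (cmod (F v y))\<^sup>2) has_vector_derivative (2 * inner (F v y) (G v y))) (at v within X)" for v y X
  proof -
    have "((\<lambda>v. F v y) has_vector_derivative G v y) (at v within X)"
      unfolding F_def G_def
      by (auto intro!: derivative_eq_intros has_vector_derivative_sum
          has_vector_derivative_mult_left has_vector_derivative_mult_right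
          simp: has_real_derivative_iff_has_vector_derivative[symmetric] scaleR_conv_of_real mult_ac)
    then have "((\<lambda>v. inner (F v y) (F v y)) has_vector_derivative (inner (F v y) (G v y) + inner (G v y) (F v y))) (at v within X)"
      by (intro bounded_bilinear.has_vector_derivative[OF bounded_bilinear_inner])
    then show ?thesis by (simp only: power2_norm_eq_inner inner_commute[of "G v y" "F v y"] mult_2)
  qed
  have pt: "(cmod (F (\<sigma> t) (\<Theta> t)))\<^sup>2 \<le> (cmod (F A (\<Theta> t)))\<^sup>2 + integral {A..B} (\<lambda>v. Q v (\<Theta> t))"
    if tt: "t \<in> {t1..t2}" for t
  proof -
    let ?y = "\<Theta> t"
    have s: "A \<le> \<sigma> t" "\<sigma> t \<le> B" using \<sigma>(2)[OF tt] by auto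
    have iQ: "(\<lambda>v. Q v ?y) integrable_on X" if "X = {c..d}" for X c d
      unfolding that Q_def by (intro integrable_continuous_real continuous_intros contF) (use A in auto)
    have "((\<lambda>v. 2 * inner (F v ?y) (G v ?y)) has_integral ((cmod (F (\<sigma> t) ?y))\<^sup>2 - (cmod (F A ?y))\<^sup>2)) {A..\<sigma> t}"
      by (rule fundamental_theorem_of_calculus[OF s(1) deriv])
    moreover have "2 * inner (F v ?y) (G v ?y) \<le> Q v ?y" for v
    proof -
      have "2 * inner (F v ?y) (G v ?y) \<le> 2 * (norm (F v ?y) * norm (G v ?y))"
        using norm_cauchy_schwarz[of "F v ?y" "G v ?y"] by simp
      also have "\<dots> = 2 * (norm (F v ?y) / sqrt A) * (sqrt A * norm (G v ?y))"
        using A by simp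
      also have "\<dots> \<le> (norm (F v ?y) / sqrt A)\<^sup>2 + (sqrt A * norm (G v ?y))\<^sup>2"
        by (rule sum_squares_bound)
      also have "\<dots> = Q v ?y" using A by (simp add: Q_def power_divide power_mult_distrib)
      finally show ?thesis .
    qed
    ultimately have "(cmod (F (\<sigma> t) ?y))\<^sup>2 - (cmod (F A ?y))\<^sup>2 \<le> integral {A..\<sigma> t} (\<lambda>v. Q v ?y)"
      using integrable_integral[OF iQ[OF refl]] by (meson has_integral_le)
    also have "\<dots> \<le> integral {A..B} (\<lambda>v. Q v ?y)"
      using s by (intro integral_subset_le iQ[OF refl]) (auto simp: Q0)
    finally show ?thesis by simp
  qed
  have e: "exp (- (real n * v)) \<le> 1" if "v \<ge> A" for n v
    using that A by simp
  have ne: "real n * exp (- (real n * v)) \<le> 1 / A" if "v \<ge> A" for n v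
  proof -
    have "real n * A \<le> real n * v" using that by (intro mult_left_mono) auto
    also have "\<dots> \<le> exp (real n * v)" using exp_ge_add_one_self[of "real n * v"] by linarith
    finally have "real n * A * exp (- (real n * v)) \<le> exp (real n * v) * exp (- (real n * v))"
      by (intro mult_right_mono) auto
    also have "\<dots> = 1" by (simp flip: exp_add)
    finally show ?thesis using A by (simp add: field_simps)
  qed
  have lineF: "integral {t1..t2} (\<lambda>t. (cmod (F v (\<Theta> t)))\<^sup>2) \<le> D" if v: "v \<ge> A" for v
  proof -
    have "integral {t1..t2} (\<lambda>t. (cmod (F v (\<Theta> t)))\<^sup>2)
        \<le> 2 * pi / m * (\<Sum>n<N. (cmod (a n * of_real (exp (- (real n * v)))))\<^sup>2)"
      unfolding F_def by (rule parseval_along_phase[OF t d m turn])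
    also have "\<dots> \<le> D"
      unfolding D_def S_def using m e[OF v]
      by (intro mult_left_mono sum_mono power_mono) (auto simp: norm_mult intro!: mult_left_le)
    finally show ?thesis .
  qed
  have lineG: "integral {t1..t2} (\<lambda>t. (cmod (G v (\<Theta> t)))\<^sup>2) \<le> D / A\<^sup>2" if v: "v \<ge> A" for v
  proof -
    have "integral {t1..t2} (\<lambda>t. (cmod (G v (\<Theta> t)))\<^sup>2)
        \<le> 2 * pi / m * (\<Sum>n<N. (cmod (- (of_nat n * a n * of_real (exp (- (real n * v))))))\<^sup>2)"
      unfolding G_def by (rule parseval_along_phase[OF t d m turn])
    also have "\<dots> \<le> 2 * pi / m * (\<Sum>n<N. (cmod (a n) * (1 / A))\<^sup>2)"
    proof (intro mult_left_mono sum_mono power_mono)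
      fix n
      have "cmod (a n) * (real n * exp (- (real n * v))) \<le> cmod (a n) * (1 / A)"
        using ne[OF v] by (intro mult_left_mono) auto
      then show "cmod (- (of_nat n * a n * of_real (exp (- (real n * v))))) \<le> cmod (a n) * (1 / A)"
        by (simp add: norm_mult mult_ac)
    qed (use m in auto)
    also have "\<dots> = D / A\<^sup>2"
      by (simp add: D_def S_def power_divide sum_divide_distrib[symmetric])
    finally show ?thesis .
  qed
  have lineQ: "integral {t1..t2} (\<lambda>t. Q v (\<Theta> t)) \<le> 2 * D / A" if v: "v \<ge> A" for v
  proof -
    have "integral {t1..t2} (\<lambda>t. Q v (\<Theta> t)) =
        integral {t1..t2} (\<lambda>t. (cmod (F v (\<Theta> t)))\<^sup>2) / A + A * integral {t1..t2} (\<lambda>t. (cmod (G v (\<Theta> t)))\<^sup>2)"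
      unfolding Q_def
      by (subst integral_add)
         (auto intro!: integrable_continuous_real continuous_intros c\<Theta>
            continuous_on_compose2[OF contF(3) c\<Theta>] continuous_on_compose2[OF contF(4) c\<Theta>] simp: A less_imp_neq[symmetric])
    also have "\<dots> \<le> D / A + A * (D / A\<^sup>2)"
      using A by (intro add_mono divide_right_mono mult_left_mono lineF lineG v) auto
    also have "\<dots> = 2 * D / A" using A by (simp add: power2_eq_square)
    finally show ?thesis .
  qed
  have contQ2: "continuous_on (cbox (t1, A) (t2, B)) (\<lambda>(t, v). Q v (\<Theta> t))"
  proof -
    have "continuous_on (cbox (t1, A) (t2, B)) (\<lambda>x. \<Theta> (fst x))"
      by (intro continuous_on_compose2[OF c\<Theta>] continuous_intros) auto
    then show ?thesis
      unfolding Q_def F_def G_def case_prod_beta using A by (intro continuous_intros) auto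
  qed
  have swap: "integral {t1..t2} (\<lambda>t. integral {A..B} (\<lambda>v. Q v (\<Theta> t)))
      = integral {A..B} (\<lambda>v. integral {t1..t2} (\<lambda>t. Q v (\<Theta> t)))"
    using integral_swap_continuous[OF contQ2] by simp
  have i1: "(\<lambda>t. integral {A..B} (\<lambda>v. Q v (\<Theta> t))) integrable_on {t1..t2}"
  proof -
    have "continuous_on (cbox t1 t2) (\<lambda>t. integral (cbox A B) (\<lambda>v. Q v (\<Theta> t)))"
      using contQ2 by (intro integral_continuous_on_param) (simp add: cbox_Pair_eq)
    then show ?thesis by (simp add: integrable_continuous_real)
  qed
  have i2: "(\<lambda>v. integral {t1..t2} (\<lambda>t. Q v (\<Theta> t))) integrable_on {A..B}"
  proof -
    have "continuous_on (cbox (A, t1) (B, t2)) (\<lambda>(v, t). Q v (\<Theta> t))"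
    proof -
      have "continuous_on (cbox (A, t1) (B, t2)) (\<lambda>x. \<Theta> (snd x))"
        by (intro continuous_on_compose2[OF c\<Theta>] continuous_intros) auto
      then show ?thesis
        unfolding Q_def F_def G_def case_prod_beta using A by (intro continuous_intros) auto
    qed
    then have "continuous_on (cbox A B) (\<lambda>v. integral (cbox t1 t2) (\<lambda>t. Q v (\<Theta> t)))"
      by (intro integral_continuous_on_param) (simp add: cbox_Pair_eq)
    then show ?thesis by (simp add: integrable_continuous_real)
  qed
  have i3: "(\<lambda>t. (cmod (F A (\<Theta> t)))\<^sup>2) integrable_on {t1..t2}"
    by (intro integrable_continuous_real continuous_intros continuous_on_compose2[OF contF(3) c\<Theta>]) auto
  have i4: "(\<lambda>t. (cmod (F (\<sigma> t) (\<Theta> t)))\<^sup>2) integrable_on {t1..t2}"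
    unfolding F_def by (intro integrable_continuous_real continuous_intros \<sigma>(1) c\<Theta>)
  have "integral {t1..t2} (\<lambda>t. (cmod (F (\<sigma> t) (\<Theta> t)))\<^sup>2)
      \<le> integral {t1..t2} (\<lambda>t. (cmod (F A (\<Theta> t)))\<^sup>2 + integral {A..B} (\<lambda>v. Q v (\<Theta> t)))"
    by (intro integral_le i4 integrable_add i3 i1 pt)
  also have "\<dots> = integral {t1..t2} (\<lambda>t. (cmod (F A (\<Theta> t)))\<^sup>2) + integral {A..B} (\<lambda>v. integral {t1..t2} (\<lambda>t. Q v (\<Theta> t)))"
    by (simp add: integral_add[OF i3 i1] swap)
  also have "\<dots> \<le> D + integral {A..B} (\<lambda>v. 2 * D / A)"
    by (intro add_mono lineF integral_le i2 lineQ) auto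
  also have "\<dots> = D * (1 + 2 * (B - A) / A)" using AB A by (simp add: field_simps)
  finally have "integral {t1..t2} (\<lambda>t. (cmod (F (\<sigma> t) (\<Theta> t)))\<^sup>2) \<le> D * (1 + 2 * (B - A) / A)" .
  moreover have "F (\<sigma> t) (\<Theta> t) = (\<Sum>n<N. a n * (of_real (exp (- \<sigma> t)) * cis (\<Theta> t)) ^ n)" for t
    unfolding F_def by (intro sum.cong) (simp_all add: cis_power_of_nat exp_of_nat_mult[symmetric] del: of_real_power)
  ultimately show ?thesis by (simp add: D_def S_def)
qed

section \<open>Two trigonometric inequalities\<close>

lemma sin_ge_third:
  assumes "0 \<le> x" "x \<le> pi / 2"
  shows "x / 3 \<le> sin x"
proof -
  have "\<bar>sin x - x\<bar> \<le> x ^ 3 / 6"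
    using Maclaurin_sin_bound[of x 3] assms by (simp add: sin_coeff_def eval_nat_numeral)
  moreover have "x ^ 3 / 6 \<le> 2 * x / 3"
  proof -
    have "x \<le> 2" using assms pi_less_4 by simp
    then have "x * x \<le> 2 * 2" using assms by (intro mult_mono) auto
    then have "x * x * x \<le> 4 * x" using assms by (intro mult_right_mono) auto
    then show ?thesis by (simp add: eval_nat_numeral)
  qed
  ultimately show ?thesis by linarith
qed

lemma cos_diff_le: "cos x - cos y \<le> \<bar>x - y\<bar>" for x y :: real
proof -
  have "\<bar>cos x - cos y\<bar> = 2 * \<bar>sin ((x + y) / 2)\<bar> * \<bar>sin ((y - x) / 2)\<bar>"
    by (simp add: cos_diff_cos abs_mult)
  also have "\<dots> \<le> 2 * 1 * \<bar>(y - x) / 2\<bar>"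
    by (intro mult_mono abs_sin_x_le_abs_x) (auto simp: abs_sin_le_one)
  also have "2 * 1 * \<bar>(y - x) / 2\<bar> = \<bar>x - y\<bar>" by (simp add: abs_minus_commute)
  finally show ?thesis by simp
qed

section \<open>The symbols\<close>

lemma one_plus_ne0:
  fixes z :: complex
  assumes "Re z > -1"
  shows "1 + z \<noteq> 0"
proof
  assume "1 + z = 0"
  then have "Re (1 + z) = 0" by (simp only: zero_complex.simps)
  then show False using assms by simp
qed

lemma disc_subset: "ball 0 1 \<subseteq> {z. Re z > -1}"
proof
  fix z :: complex assume "z \<in> ball 0 1"
  then show "z \<in> {z. Re z > -1}" using abs_Re_le_cmod[of z] by auto
qed

lemma disc_half:
  assumes "z \<in> ball 0 1"
  shows "Re ((1 + z) / 2) > 0" "cmod ((1 + z) / 2) \<le> 1"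
proof -
  show "Re ((1 + z) / 2) > 0" using assms disc_subset by auto
  show "cmod ((1 + z) / 2) \<le> 1" using assms norm_triangle_ineq[of 1 z] by (simp add: norm_divide)
qed

lemma cayley_pos:
  assumes "z \<in> ball 0 1"
  shows "Re ((1 - z) / (1 + z)) > 0"
proof -
  have z0: "1 + z \<noteq> 0" using assms disc_subset by (intro one_plus_ne0) auto
  have "(1 - z) / (1 + z) = (1 - z) * cnj (1 + z) / of_real ((cmod (1 + z))\<^sup>2)"
    unfolding complex_norm_square
    by (rule nonzero_mult_divide_mult_cancel_right[symmetric]) (use z0 in \<open>simp only: complex_cnj_zero_iff, simp\<close>)
  then have "Re ((1 - z) / (1 + z)) = Re ((1 - z) * cnj (1 + z)) / (cmod (1 + z))\<^sup>2"
    by (simp only: Re_divide_of_real)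
  also have "Re ((1 - z) * cnj (1 + z)) = 1 - (cmod z)\<^sup>2"
    unfolding cmod_power2 by (simp add: algebra_simps power2_eq_square)
  finally show ?thesis using assms z0 by (simp add: abs_square_less_1)
qed

lemma Re_cis_gt:
  assumes "t \<in> {-pi<..<pi}"
  shows "Re (cis t) > -1"
proof -
  have "cos (t / 2) > 0" using assms by (intro cos_gt_zero_pi) auto
  then show ?thesis using cos_double_cos[of "t / 2"] by simp
qed

text \<open>Both symbols are holomorphic on this half-plane, which contains the closed disc except
  for -1. Their radial limits are therefore ordinary values.\<close>

lemma radial_tendsto:
  assumes "\<phi> holomorphic_on {z. Re z > -1}" "Re \<zeta> > -1"
  shows "((\<lambda>r. \<phi> (of_real r * \<zeta>)) \<longlongrightarrow> \<phi> \<zeta>) (at_left 1)"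
proof -
  have "open {z::complex. Re z > -1}" by (simp add: open_halfspace_Re_gt)
  then have "isCont \<phi> \<zeta>"
    using holomorphic_on_imp_continuous_on[OF assms(1)] assms(2) continuous_on_eq_continuous_at by blast
  moreover have "((\<lambda>r. of_real r * \<zeta>) \<longlongrightarrow> of_real 1 * \<zeta>) (at_left 1)"
    by (intro tendsto_intros)
  ultimately show ?thesis by (auto intro: isCont_tendsto_compose)
qed

lemma radial_limit_eq:
  assumes "\<phi> holomorphic_on {z. Re z > -1}" "Re \<zeta> > -1"
  shows "radial_limit \<phi> \<zeta> = \<phi> \<zeta>"
  unfolding radial_limit_def by (rule tendsto_Lim[OF _ radial_tendsto[OF assms]]) simp

section \<open>The circle in the coordinate x = tan (t / 2)\<close>

lemma one_plus_cis:
  assumes "t \<in> {-pi<..<pi}"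
  shows "1 + cis t = 2 / (1 - \<i> * of_real (tan (t / 2)))"
proof -
  have c: "cos (t / 2) > 0" using assms by (intro cos_gt_zero_pi) auto
  have "1 - \<i> * of_real (tan (t / 2)) = cis (- (t / 2)) / of_real (cos (t / 2))"
    using c by (simp add: complex_eq_iff tan_def Re_divide_of_real Im_divide_of_real)
  then have "2 / (1 - \<i> * of_real (tan (t / 2))) = 2 * of_real (cos (t / 2)) / cis (- (t / 2))"
    by simp
  also have "\<dots> = of_real (2 * cos (t / 2)) * cis (t / 2)"
    by (simp add: divide_inverse[of _ "cis _"])
  also have "\<dots> = 1 + cis t"
    using cos_double_cos[of "t / 2"] sin_double[of "t / 2"]
    by (simp add: complex_eq_iff power2_eq_square)
  finally show ?thesis ..
qed

text \<open>The boundary values of \<open>u = (1 + z) / 2\<close> in the coordinate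
  \<open>x = tan (t / 2)\<close>. They lie on the circle with diameter from 0 to 1, which is why
  \<open>Re_W\<close> and \<open>norm_W_sq\<close> have the same right side.\<close>

definition W :: "real \<Rightarrow> complex" where "W x = 1 / (1 - \<i> * of_real x)"

lemma W_den: "1 - \<i> * of_real x \<noteq> 0"
  by (simp add: complex_eq_iff)

lemma Re_W: "Re (W x) = 1 / (1 + x\<^sup>2)"
  by (simp add: W_def Re_divide)

lemma norm_W_sq: "(cmod (W x))\<^sup>2 = 1 / (1 + x\<^sup>2)"
  by (simp add: W_def norm_divide power_divide cmod_power2)

lemma W_le: "cmod (W x) \<le> 1"
proof (rule power2_le_imp_le)
  show "(cmod (W x))\<^sup>2 \<le> 1\<^sup>2" by (simp add: norm_W_sq add_pos_nonneg)
qed simp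

lemma Re_W_pos: "Re (W x) > 0"
  by (simp add: Re_W add_pos_nonneg)

lemma W_ne0: "W x \<noteq> 0" using Re_W_pos[of x] by auto

lemma inverse_powr: "1 / (1 + x\<^sup>2) = (1 + x\<^sup>2) powr (- 1)" for x :: real
  by (simp add: powr_minus divide_inverse add_nonneg_nonneg)

lemma norm_W_powr: "cmod (W x) powr a = (1 + x\<^sup>2) powr (- a / 2)"
proof -
  have "cmod (W x) powr a = ((cmod (W x))\<^sup>2) powr (a / 2)"
    using W_ne0[of x] by (simp add: powr_powr flip: powr_numeral)
  also have "\<dots> = (1 + x\<^sup>2) powr (- a / 2)"
    unfolding norm_W_sq inverse_powr powr_powr by simp
  finally show ?thesis .
qed

text \<open>The factor 3 is independent of \<open>k\<close>, so that all segments of the curve share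
  their constants.\<close>

lemma comparable:
  fixes k x :: real
  assumes "k \<le> x" "x \<le> k + 1"
  shows "1 + x\<^sup>2 \<le> 3 * (1 + k\<^sup>2)" "1 + k\<^sup>2 \<le> 3 * (1 + x\<^sup>2)"
proof -
  have "(x - k)\<^sup>2 \<le> 1" using assms by (simp add: abs_square_le_1)
  moreover have "x\<^sup>2 \<le> 2 * (x - k)\<^sup>2 + 2 * k\<^sup>2"
    using zero_le_power2[of "x - 2 * k"] by (simp add: power2_eq_square algebra_simps)
  moreover have "k\<^sup>2 \<le> 2 * (x - k)\<^sup>2 + 2 * x\<^sup>2"
    using zero_le_power2[of "2 * x - k"] by (simp add: power2_eq_square algebra_simps)
  moreover have "1 + X \<le> 3 * (1 + Y)" if "d \<le> 1" "X \<le> 2 * d + 2 * Y" "0 \<le> Y" for X Y d :: real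
    using that by simp
  ultimately have "1 + x\<^sup>2 \<le> 3 * (1 + k\<^sup>2) \<and> 1 + k\<^sup>2 \<le> 3 * (1 + x\<^sup>2)"
    by (meson zero_le_power2)
  then show "1 + x\<^sup>2 \<le> 3 * (1 + k\<^sup>2)" "1 + k\<^sup>2 \<le> 3 * (1 + x\<^sup>2)" by auto
qed

lemma tan_half_range:
  assumes "t \<in> {2 * arctan k..2 * arctan l}"
  shows "k \<le> tan (t / 2)" "tan (t / 2) \<le> l" "t \<in> {-pi<..<pi}"
proof -
  have "- (pi / 2) < arctan k" "arctan l < pi / 2" by (rule arctan_lbound arctan_ubound)+
  then show "t \<in> {-pi<..<pi}" using assms by auto
  then have "arctan (tan (t / 2)) = t / 2" by (intro arctan_tan) auto
  then have "arctan k \<le> arctan (tan (t / 2))" "arctan (tan (t / 2)) \<le> arctan l" using assms by auto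
  then show "k \<le> tan (t / 2)" "tan (t / 2) \<le> l" by (simp_all add: arctan_le_iff)
qed

section \<open>The function \<open>U\<close> and the two symbols\<close>

locale exponent =
  fixes \<alpha> :: real
  assumes alpha: "1 < \<alpha>" "\<alpha> < 2"
begin

definition U :: "complex \<Rightarrow> complex" where
  "U u = u / 4 - u powr of_real \<alpha> / 32"

text \<open>The value of \<open>- cos (\<alpha> * \<omega>)\<close> in the vertical directions,
  positive because \<open>\<alpha> * pi / 2\<close> lies between pi / 2 and pi.\<close>

definition \<delta> :: real where "\<delta> = - cos (\<alpha> * pi / 2)"

lemma delta_pos: "\<delta> > 0"
proof -
  have "cos (\<alpha> * pi / 2) < 0"
    using alpha by (intro cos_lt_zero_pi) auto
  then show ?thesis by (simp add: \<delta>_def)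
qed

lemma Re_powr:
  assumes "u \<noteq> 0"
  shows "Re (u powr of_real \<alpha>) = cmod u powr \<alpha> * cos (\<alpha> * Im (Ln u))"
  using assms by (simp add: powr_def Re_exp)

lemma Re_eq_cos:
  assumes "u \<noteq> 0"
  shows "Re u = cmod u * cos (Im (Ln u))"
  using Re_exp[of "Ln u"] assms by simp

lemma norm_powr_alpha: "cmod (u powr of_real \<alpha>) = cmod u powr \<alpha>"
  by (simp add: norm_powr_real_powr')

text \<open>In the direction \<omega> the angle to the vertical is at most
  \<open>3 * cos \<omega>\<close>, so \<open>cos (\<alpha> * \<omega>)\<close> exceeds its value
  \<open>- \<delta>\<close> at the vertical by at most \<open>6 * cos \<omega>\<close>. Since
  \<open>cmod u \<le> 1\<close>, this error costs at most \<open>6 * Re u / 32\<close> and is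
  absorbed by \<open>u / 4\<close>, which is \<open>8 * u / 32\<close>. This fixes the ratio of the
  two coefficients.\<close>

lemma Re_U_ge:
  assumes u: "Re u > 0" "cmod u \<le> 1"
  shows "\<delta> / 32 * cmod u powr \<alpha> \<le> Re (U u)"
proof -
  have u0: "u \<noteq> 0" using u by auto
  define \<omega> where "\<omega> = Im (Ln u)"
  have \<omega>: "\<bar>\<omega>\<bar> < pi / 2" unfolding \<omega>_def using u by (rule_tac Re_Ln_pos_lt_imp)
  have co: "(pi / 2 - \<bar>\<omega>\<bar>) / 3 \<le> cos \<omega>"
    using sin_ge_third[of "pi / 2 - \<bar>\<omega>\<bar>"] \<omega> by (simp add: sin_diff)
  have "cos (\<alpha> * \<omega>) = cos (\<alpha> * \<bar>\<omega>\<bar>)" by (cases "\<omega> \<ge> 0") auto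
  also have "\<dots> \<le> cos (\<alpha> * pi / 2) + \<bar>\<alpha> * \<bar>\<omega>\<bar> - \<alpha> * pi / 2\<bar>"
    using cos_diff_le[of "\<alpha> * \<bar>\<omega>\<bar>" "\<alpha> * pi / 2"] by linarith
  also have "\<bar>\<alpha> * \<bar>\<omega>\<bar> - \<alpha> * pi / 2\<bar> = \<alpha> * (pi / 2 - \<bar>\<omega>\<bar>)"
  proof -
    have "\<alpha> * \<bar>\<omega>\<bar> - \<alpha> * pi / 2 = - (\<alpha> * (pi / 2 - \<bar>\<omega>\<bar>))" by (simp add: algebra_simps)
    moreover have "0 \<le> \<alpha> * (pi / 2 - \<bar>\<omega>\<bar>)" using \<omega> alpha by simp
    ultimately show ?thesis by linarith
  qed
  also have "\<alpha> * (pi / 2 - \<bar>\<omega>\<bar>) \<le> 2 * (3 * cos \<omega>)"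
    using alpha co \<omega> by (intro mult_mono) auto
  finally have le: "cos (\<alpha> * \<omega>) \<le> - \<delta> + 6 * cos \<omega>" by (simp add: \<delta>_def)
  have "0 \<le> (pi / 2 - \<bar>\<omega>\<bar>) / 3" using \<omega> by simp
  then have cos0: "cos \<omega> \<ge> 0" using co by (rule order_trans)
  have "cmod u powr \<alpha> \<le> cmod u powr 1" using u u0 alpha by (intro powr_mono') auto
  then have p: "cmod u powr \<alpha> \<le> cmod u" using u0 by simp
  have "cmod u powr \<alpha> * cos (\<alpha> * \<omega>) \<le> cmod u powr \<alpha> * (- \<delta> + 6 * cos \<omega>)"
    by (intro mult_left_mono le) simp
  also have "\<dots> \<le> - (\<delta> * cmod u powr \<alpha>) + 8 * (cmod u * cos \<omega>)"
  proof -
    have "cmod u powr \<alpha> * cos \<omega> \<le> cmod u * cos \<omega>" by (intro mult_right_mono p cos0)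
    moreover have "0 \<le> cmod u * cos \<omega>" using cos0 by simp
    moreover have "cmod u powr \<alpha> * (- \<delta> + 6 * cos \<omega>) = - (\<delta> * cmod u powr \<alpha>) + 6 * (cmod u powr \<alpha> * cos \<omega>)"
      by (simp add: algebra_simps)
    ultimately show ?thesis by linarith
  qed
  finally show ?thesis
    using Re_powr[OF u0] Re_eq_cos[OF u0] by (simp add: U_def \<omega>_def)
qed

lemma Re_U_pos:
  assumes "Re u > 0" "cmod u \<le> 1"
  shows "Re (U u) > 0"
proof -
  have "u \<noteq> 0" using assms by auto
  then have "0 < \<delta> / 32 * cmod u powr \<alpha>" using delta_pos by simp
  then show ?thesis using Re_U_ge[OF assms] by linarith
qed

lemma Re_U_le: "Re (U u) \<le> Re u / 4 + cmod u powr \<alpha> / 32"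
  using abs_Re_le_cmod[of "u powr of_real \<alpha>"] by (simp add: U_def norm_powr_alpha)

lemma norm_U_le:
  assumes "cmod u \<le> 1"
  shows "cmod (U u) \<le> 9 / 32"
proof -
  have "cmod (U u) \<le> cmod u / 4 + cmod u powr \<alpha> / 32"
    unfolding U_def by (rule order_trans[OF norm_triangle_ineq4]) (simp add: norm_divide norm_powr_alpha)
  also have "\<dots> \<le> 1 / 4 + 1 powr \<alpha> / 32"
    using assms alpha by (intro add_mono divide_right_mono powr_mono2) auto
  finally show ?thesis by simp
qed

text \<open>At a boundary point \<open>z = cis t\<close> other than \<open>-1\<close> the denominator below is nonzero, so the same
  formulas also give the boundary values.\<close>

definition phi1 :: "complex \<Rightarrow> complex" where
  "phi1 z = exp (- U ((1 + z) / 2))"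

definition phi2 :: "complex \<Rightarrow> complex" where
  "phi2 z = exp (- U ((1 + z) / 2) - (1 - z) / (1 + z))"

lemma phi_holomorphic: "phi1 holomorphic_on {z. Re z > -1}" "phi2 holomorphic_on {z. Re z > -1}"
proof -
  have 1: "(1 + z) / 2 \<notin> \<real>\<^sub>\<le>\<^sub>0" if "Re z > -1" for z
    using that by (auto simp: complex_nonpos_Reals_iff)
  note 2 = one_plus_ne0
  show "phi1 holomorphic_on {z. Re z > -1}" "phi2 holomorphic_on {z. Re z > -1}"
    unfolding phi1_def phi2_def U_def using 1 2
    by (auto intro!: holomorphic_intros)
qed

lemma phi_disc: "phi1 ` ball 0 1 \<subseteq> ball 0 1" "phi2 ` ball 0 1 \<subseteq> ball 0 1"
proof -
  have *: "cmod (exp (- w)) < 1" if "Re w > 0" for w using that by simp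
  have "phi1 z \<in> ball 0 1" "phi2 z \<in> ball 0 1" if z: "z \<in> ball 0 1" for z
    unfolding phi1_def phi2_def
    using *[OF Re_U_pos[OF disc_half[OF z]]]
      *[of "U ((1 + z) / 2) + (1 - z) / (1 + z)"] Re_U_pos[OF disc_half[OF z]] cayley_pos[OF z]
    by simp_all
  then show "phi1 ` ball 0 1 \<subseteq> ball 0 1" "phi2 ` ball 0 1 \<subseteq> ball 0 1" by auto
qed

text \<open>Polar data of the boundary curve of \<open>phi2\<close>: \<open>\<sigma>\<close> is
  minus the logarithm of the modulus and \<open>\<Theta>\<close> a continuous argument, not reduced
  modulo 2 pi. The summand \<open>x\<close> comes from the inner factor, which is
  \<open>cis x\<close> on the circle.\<close>

definition \<sigma> :: "real \<Rightarrow> real" where "\<sigma> x = Re (U (W x))"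
definition \<Theta> :: "real \<Rightarrow> real" where "\<Theta> x = x - Im (U (W x))"
definition \<Theta>' :: "real \<Rightarrow> real" where
  "\<Theta>' x = 1 - Im ((1 / 4 - of_real \<alpha> * W x powr (of_real \<alpha> - 1) / 32) * (\<i> * (W x)\<^sup>2))"

lemma phi_cis:
  assumes "t \<in> {-pi<..<pi}"
  shows "phi1 (cis t) = exp (- U (W (tan (t / 2))))"
    "phi2 (cis t) = of_real (exp (- \<sigma> (tan (t / 2)))) * cis (\<Theta> (tan (t / 2)))"
proof -
  let ?x = "tan (t / 2)"
  have "2 / d / 2 = 1 / d" for d :: complex by simp
  then have 1: "(1 + cis t) / 2 = W ?x" unfolding one_plus_cis[OF assms] W_def .
  show "phi1 (cis t) = exp (- U (W ?x))" by (simp add: phi1_def 1)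
  have "1 - cis t = 2 - (1 + cis t)" by simp
  also have "\<dots> = 2 - 2 / (1 - \<i> * of_real ?x)" by (simp only: one_plus_cis[OF assms])
  also have "\<dots> = - 2 * \<i> * of_real ?x / (1 - \<i> * of_real ?x)"
    using W_den[of ?x] by (simp add: field_simps)
  finally have "(1 - cis t) / (1 + cis t) = - \<i> * of_real ?x"
    using W_den[of ?x] by (simp add: one_plus_cis[OF assms])
  then have "phi2 (cis t) = exp (- U (W ?x) + \<i> * of_real ?x)"
    by (simp add: phi2_def 1)
  also have "\<dots> = of_real (exp (- \<sigma> ?x)) * cis (\<Theta> ?x)"
    by (simp add: exp_eq_polar \<sigma>_def \<Theta>_def)
  finally show "phi2 (cis t) = of_real (exp (- \<sigma> ?x)) * cis (\<Theta> ?x)" .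
qed

lemma norm_phi_cis:
  assumes "t \<in> {-pi<..<pi}"
  shows "cmod (phi1 (cis t)) = exp (- \<sigma> (tan (t / 2)))" "cmod (phi2 (cis t)) = exp (- \<sigma> (tan (t / 2)))"
  by (simp_all add: phi_cis[OF assms] norm_mult \<sigma>_def)

lemma sigma_ge: "\<delta> / 32 * (1 + x\<^sup>2) powr (- \<alpha> / 2) \<le> \<sigma> x"
  using Re_U_ge[OF Re_W_pos W_le, of x] by (simp add: \<sigma>_def norm_W_powr)

text \<open>On the circle \<open>Re u = |u|\<^sup>2\<close>, which is at most
  \<open>|u| powr \<alpha>\<close> because \<alpha> < 2; the linear term of \<open>U\<close> thus
  respects the order found in \<open>sigma_ge\<close>.\<close>

lemma sigma_le: "\<sigma> x \<le> 9 / 32 * (1 + x\<^sup>2) powr (- \<alpha> / 2)"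
proof -
  have "1 / (1 + x\<^sup>2) = (1 + x\<^sup>2) powr (-1)" by (rule inverse_powr)
  also have "\<dots> \<le> (1 + x\<^sup>2) powr (- \<alpha> / 2)" using alpha by (intro powr_mono) auto
  finally have *: "1 / (1 + x\<^sup>2) \<le> (1 + x\<^sup>2) powr (- \<alpha> / 2)" .
  have "a / 4 + p / 32 \<le> 9 / 32 * p" if "a \<le> p" for a p :: real using that by simp
  note this[OF *]
  from order_trans[OF Re_U_le[of "W x", unfolded norm_W_powr Re_W] this] show ?thesis
    unfolding \<sigma>_def .
qed

lemma sigma_pos: "\<sigma> x > 0"
  unfolding \<sigma>_def by (rule Re_U_pos[OF Re_W_pos W_le])

lemma sigma_le_half: "\<sigma> x \<le> 1 / 2"
  using norm_U_le[OF W_le, of x] abs_Re_le_cmod[of "U (W x)"] by (simp add: \<sigma>_def)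

lemma UW_deriv:
  "((\<lambda>x. U (W x)) has_vector_derivative ((1 / 4 - of_real \<alpha> * W x powr (of_real \<alpha> - 1) / 32) * (\<i> * (W x)\<^sup>2))) (at x)"
proof -
  have "(W has_vector_derivative \<i> * (W x)\<^sup>2) (at x)"
  proof -
    have "((\<lambda>z. 1 / (1 - \<i> * z)) has_field_derivative (\<i> * (W x)\<^sup>2)) (at (of_real x))"
      using W_den[of x] by (auto intro!: derivative_eq_intros simp: W_def power2_eq_square divide_simps)
    from has_vector_derivative_real_field[OF this] show ?thesis
      by (simp add: W_def[abs_def])
  qed
  moreover have "(U has_field_derivative (1 / 4 - of_real \<alpha> * W x powr (of_real \<alpha> - 1) / 32)) (at (W x))"
  proof -
    have nonpos: "W x \<notin> \<real>\<^sub>\<le>\<^sub>0" using Re_W_pos[of x] by (auto simp: complex_nonpos_Reals_iff)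
    from DERIV_diff[OF DERIV_cdivide[OF DERIV_ident] DERIV_cdivide[OF has_field_derivative_powr[OF nonpos]], of 4 "of_real \<alpha>" 32]
    show ?thesis unfolding U_def[abs_def] .
  qed
  ultimately have "((U \<circ> W) has_vector_derivative (\<i> * (W x)\<^sup>2 * (1 / 4 - of_real \<alpha> * W x powr (of_real \<alpha> - 1) / 32))) (at x)"
    by (rule field_vector_diff_chain_at)
  then show ?thesis by (simp add: o_def mult.commute)
qed

lemma Theta_deriv: "(\<Theta> has_real_derivative \<Theta>' x) (at x)"
proof -
  have "((\<lambda>x. Im (U (W x))) has_vector_derivative Im ((1 / 4 - of_real \<alpha> * W x powr (of_real \<alpha> - 1) / 32) * (\<i> * (W x)\<^sup>2))) (at x)"
    by (rule bounded_linear.has_vector_derivative[OF bounded_linear_Im UW_deriv])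
  then show ?thesis
    unfolding \<Theta>_def[abs_def] \<Theta>'_def has_real_derivative_iff_has_vector_derivative[symmetric]
    by (rule DERIV_diff[OF DERIV_ident])
qed

lemma sigma_cont: "continuous_on S \<sigma>"
proof -
  have "isCont (\<lambda>x. U (W x)) x" for x
    using UW_deriv by (rule has_vector_derivative_continuous)
  then show ?thesis unfolding \<sigma>_def[abs_def]
    by (intro continuous_at_imp_continuous_on ballI) (auto intro!: continuous_intros)
qed

text \<open>The inner factor contributes 1. The derivative of \<open>U\<close> along the curve is at
  most 1 / 4 + 2 / 32 in modulus, since \<open>W\<close> and its derivative are bounded by
  1.\<close>

lemma Theta'_ge: "\<Theta>' x \<ge> 1 / 2"
proof -
  have "cmod (of_real \<alpha> * W x powr (of_real \<alpha> - 1) / 32) \<le> 2 * 1 / 32"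
  proof -
    have "cmod (W x powr (of_real \<alpha> - 1)) = cmod (W x) powr (\<alpha> - 1)"
      using norm_powr_real_powr'[of "of_real (\<alpha> - 1)" "W x"] by simp
    also have "\<dots> \<le> 1 powr (\<alpha> - 1)" using alpha W_le by (intro powr_mono2) auto
    finally have "cmod (W x powr (of_real \<alpha> - 1)) \<le> 1" by simp
    then have "cmod (of_real \<alpha>) * cmod (W x powr (of_real \<alpha> - 1)) \<le> 2 * 1"
      using alpha by (intro mult_mono) auto
    then show ?thesis by (simp add: norm_divide norm_mult)
  qed
  then have "cmod (1 / 4 - of_real \<alpha> * W x powr (of_real \<alpha> - 1) / 32) \<le> 1 / 2"
    using norm_triangle_ineq4[of "1 / 4" "of_real \<alpha> * W x powr (of_real \<alpha> - 1) / 32"] by simp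
  moreover have "cmod (\<i> * (W x)\<^sup>2) \<le> 1" using W_le[of x] by (simp add: norm_mult norm_power power_le_one)
  ultimately have "cmod ((1 / 4 - of_real \<alpha> * W x powr (of_real \<alpha> - 1) / 32) * (\<i> * (W x)\<^sup>2)) \<le> 1 / 2 * 1"
    unfolding norm_mult by (intro mult_mono) auto
  then show ?thesis
    using abs_Im_le_cmod[of "(1 / 4 - of_real \<alpha> * W x powr (of_real \<alpha> - 1) / 32) * (\<i> * (W x)\<^sup>2)"]
    unfolding \<Theta>'_def by linarith
qed

text \<open>The inner factor turns by 1 and \<open>U\<close> changes the argument by at most 9 / 16,
  so a unit step in \<open>x\<close> stays within one full turn.\<close>

lemma Theta_diff: "\<Theta> (k + 1) \<le> \<Theta> k + 2 * pi"
proof -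
  have *: "\<bar>Im (U (W x))\<bar> \<le> 9 / 32" for x
    using norm_U_le[OF W_le, of x] abs_Im_le_cmod[of "U (W x)"] by linarith
  show ?thesis using *[of k] *[of "k + 1"] pi_gt3 unfolding \<Theta>_def by linarith
qed

lemma segment_estimate:
  fixes k :: real and a :: "nat \<Rightarrow> complex"
  shows "integral {2 * arctan k..2 * arctan (k + 1)} (\<lambda>t. (cmod (\<Sum>n<N. a n * phi2 (cis t) ^ n))\<^sup>2)
    \<le> 3888 * pi / \<delta> / (1 + k\<^sup>2) * (\<Sum>n<N. (cmod (a n))\<^sup>2)"
proof -
  let ?t1 = "2 * arctan k" and ?t2 = "2 * arctan (k + 1)"
  \<comment> \<open>Bounds for \<open>\<sigma>\<close> on the segment, from \<open>sigma_ge\<close>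
    and \<open>sigma_le\<close> with the factor 3 of \<open>comparable\<close>. Their ratio is at
    most 81 / \<delta> for every \<open>k\<close>, which is the comparability that
    \<open>curve_estimate\<close> calls for.\<close>
  define A where "A = \<delta> / 32 * (3 * (1 + k\<^sup>2)) powr (- \<alpha> / 2)"
  define B where "B = 9 / 32 * ((1 + k\<^sup>2) / 3) powr (- \<alpha> / 2)"
  have k0: "1 + k\<^sup>2 > 0" by (simp add: add_pos_nonneg)
  have A: "A > 0" using delta_pos k0 by (simp add: A_def)
  have "(1 + k\<^sup>2) / 3 = (3 * (1 + k\<^sup>2)) / 9" by simp
  then have "B = 9 / 32 * ((3 * (1 + k\<^sup>2)) / 9) powr (- \<alpha> / 2)" unfolding B_def by (rule arg_cong)
  also have "\<dots> = 9 / 32 * ((3 * (1 + k\<^sup>2)) powr (- \<alpha> / 2) / 9 powr (- \<alpha> / 2))"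
    using k0 by (subst powr_divide) auto
  also have "\<dots> = 9 / \<delta> * 9 powr (\<alpha> / 2) * A"
    using delta_pos by (simp add: A_def powr_minus field_simps)
  also have "\<dots> \<le> 9 / \<delta> * 9 * A"
  proof -
    have "9 powr (\<alpha> / 2) \<le> 9 powr (1 :: real)" using alpha by (intro powr_mono) auto
    then show ?thesis using delta_pos A by (intro mult_left_mono mult_right_mono) auto
  qed
  finally have BA: "B / A \<le> 81 / \<delta>" using A by (simp add: field_simps)
  \<comment> \<open>The speed of the phase in \<open>t\<close>: at least 1 / 2 in \<open>x\<close>,
    times \<open>(1 + x\<^sup>2) / 2\<close> for the derivative of \<open>x\<close>, where
    \<open>1 + x\<^sup>2\<close> is at least a third of \<open>1 + k\<^sup>2\<close>. It produces
    the decay in \<open>k\<close>; the constant 3888 is the product of 2, 12, 2 and 81.\<close>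
  define m where "m = (1 + k\<^sup>2) / 12"
  have m: "m > 0" using k0 by (simp add: m_def)
  have "integral {?t1..?t2} (\<lambda>t. (cmod (\<Sum>n<N. a n * (of_real (exp (- \<sigma> (tan (t / 2)))) * cis (\<Theta> (tan (t / 2)))) ^ n))\<^sup>2)
      \<le> 2 * pi / m * (\<Sum>n<N. (cmod (a n))\<^sup>2) * (1 + 2 * (B - A) / A)"
  proof (rule curve_estimate)
    show "?t1 \<le> ?t2" by (simp add: arctan_le_iff)
    show "\<Theta> (tan (?t2 / 2)) \<le> \<Theta> (tan (?t1 / 2)) + 2 * pi"
      using Theta_diff[of k] by (simp add: tan_arctan)
    fix t assume t: "t \<in> {?t1..?t2}"
    note r = tan_half_range[OF t]
    have c: "cos (t / 2) > 0" using r(3) by (intro cos_gt_zero_pi) auto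
    then have "((\<lambda>t. tan (t / 2)) has_real_derivative (1 + (tan (t / 2))\<^sup>2) / 2) (at t)"
      by (auto intro!: derivative_eq_intros simp: tan_sec field_simps)
    from DERIV_chain2[OF Theta_deriv this]
    show "((\<lambda>t. \<Theta> (tan (t / 2))) has_real_derivative \<Theta>' (tan (t / 2)) * ((1 + (tan (t / 2))\<^sup>2) / 2)) (at t)" .
    have "m \<le> 1 / 2 * ((1 + (tan (t / 2))\<^sup>2) / 2)"
      using comparable(2)[OF r(1,2)] by (simp add: m_def)
    also have "\<dots> \<le> \<Theta>' (tan (t / 2)) * ((1 + (tan (t / 2))\<^sup>2) / 2)"
      by (intro mult_right_mono Theta'_ge) (simp add: add_nonneg_nonneg)
    finally show "m \<le> \<Theta>' (tan (t / 2)) * ((1 + (tan (t / 2))\<^sup>2) / 2)" .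
    show "A \<le> \<sigma> (tan (t / 2)) \<and> \<sigma> (tan (t / 2)) \<le> B"
    proof
      have "(3 * (1 + k\<^sup>2)) powr (- \<alpha> / 2) \<le> (1 + (tan (t / 2))\<^sup>2) powr (- \<alpha> / 2)"
        using comparable(1)[OF r(1,2)] alpha by (intro powr_mono2') (auto simp: add_pos_nonneg)
      then have "A \<le> \<delta> / 32 * (1 + (tan (t / 2))\<^sup>2) powr (- \<alpha> / 2)"
        unfolding A_def using delta_pos by (intro mult_left_mono) auto
      then show "A \<le> \<sigma> (tan (t / 2))" using sigma_ge by (rule order_trans)
      have "(1 + (tan (t / 2))\<^sup>2) powr (- \<alpha> / 2) \<le> ((1 + k\<^sup>2) / 3) powr (- \<alpha> / 2)"
        using comparable(2)[OF r(1,2)] alpha k0 by (intro powr_mono2') auto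
      then have "9 / 32 * (1 + (tan (t / 2))\<^sup>2) powr (- \<alpha> / 2) \<le> B"
        unfolding B_def by (intro mult_left_mono) auto
      then show "\<sigma> (tan (t / 2)) \<le> B" by (rule order_trans[OF sigma_le])
    qed
  next
    have "continuous_on {?t1..?t2} (\<lambda>t. tan (t / 2))"
    proof (intro continuous_at_imp_continuous_on ballI)
      fix t assume "t \<in> {?t1..?t2}"
      then have "cos (t / 2) > 0" using tan_half_range(3)[of t] by (intro cos_gt_zero_pi) auto
      then show "isCont (\<lambda>t. tan (t / 2)) t" by (intro continuous_intros) auto
    qed
    then show "continuous_on {?t1..?t2} (\<lambda>t. \<sigma> (tan (t / 2)))"
      by (rule continuous_on_compose2[OF sigma_cont]) auto
  qed (use m A in auto)
  also have "integral {?t1..?t2} (\<lambda>t. (cmod (\<Sum>n<N. a n * (of_real (exp (- \<sigma> (tan (t / 2)))) * cis (\<Theta> (tan (t / 2)))) ^ n))\<^sup>2)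
      = integral {?t1..?t2} (\<lambda>t. (cmod (\<Sum>n<N. a n * phi2 (cis t) ^ n))\<^sup>2)"
    using tan_half_range(3) by (intro integral_cong) (simp add: phi_cis)
  also have "2 * pi / m * (\<Sum>n<N. (cmod (a n))\<^sup>2) * (1 + 2 * (B - A) / A)
      \<le> 2 * pi / m * (\<Sum>n<N. (cmod (a n))\<^sup>2) * (2 * (81 / \<delta>))"
  proof (intro mult_left_mono)
    have "1 + 2 * (B - A) / A = 2 * (B / A) - 1" using A by (simp add: field_simps)
    then show "1 + 2 * (B - A) / A \<le> 2 * (81 / \<delta>)" using BA by linarith
  qed (use m in \<open>auto intro!: mult_nonneg_nonneg divide_nonneg_pos sum_nonneg\<close>)
  also have "\<dots> = 3888 * pi / \<delta> / (1 + k\<^sup>2) * (\<Sum>n<N. (cmod (a n))\<^sup>2)"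
    using k0 delta_pos by (simp add: m_def field_simps)
  finally show ?thesis .
qed

end

section \<open>Integrals and weights on the arc\<close>

lemma arc_integral_segment:
  fixes f :: "real \<Rightarrow> real"
  assumes "continuous_on {a..b} f" "{a..b} \<subseteq> {-pi<..<pi}"
  shows "(\<integral>x. indicator {a..b} x * f x \<partial>arc_lebesgue) = integral {a..b} f"
    "integrable arc_lebesgue (\<lambda>x. indicator {a..b} x * f x)"
proof -
  have *: "set_integrable lborel {a..b} f"
    by (rule borel_integrable_atLeastAtMost'[OF assms(1)])
  have eq: "indicator {-pi<..<pi} x *\<^sub>R (indicator {a..b} x * f x) = indicator {a..b} x *\<^sub>R f x" for x
    using assms(2) by (auto simp: indicator_def)
  have "(\<integral>x. indicator {a..b} x * f x \<partial>arc_lebesgue) = (LINT x:{a..b}|lborel. f x)"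
    unfolding set_lebesgue_integral_def by (subst integral_restrict_space) (simp_all only: eq, simp)
  also have "\<dots> = integral {a..b} f"
    by (rule set_borel_integral_eq_integral(2)[OF *])
  finally show "(\<integral>x. indicator {a..b} x * f x \<partial>arc_lebesgue) = integral {a..b} f" .
  show "integrable arc_lebesgue (\<lambda>x. indicator {a..b} x * f x)"
    using * unfolding set_integrable_def by (subst integrable_restrict_space) (simp_all only: eq, simp)
qed

text \<open>The antiderivative is continuous up to the endpoints although the integrand is unbounded
  there, so the fundamental theorem applies with interior derivatives; nonnegativity makes the
  integrability absolute.\<close>

lemma integrable_arc_powr:
  fixes \<gamma> :: real
  assumes \<gamma>: "0 < \<gamma>" "\<gamma> < 1"
  shows "integrable arc_lebesgue (\<lambda>x. (pi - x) powr (- \<gamma>) + (pi + x) powr (- \<gamma>))"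
proof -
  let ?f = "\<lambda>x. (pi - x) powr (- \<gamma>) + (pi + x) powr (- \<gamma>)"
  let ?F = "\<lambda>x. (pi + x) powr (1 - \<gamma>) / (1 - \<gamma>) - (pi - x) powr (1 - \<gamma>) / (1 - \<gamma>)"
  have "(?f has_integral (?F pi - ?F (-pi))) {-pi..pi}"
  proof (rule fundamental_theorem_of_calculus_interior)
    show "continuous_on {-pi..pi} ?F"
      using \<gamma> by (intro continuous_intros continuous_on_powr') auto
    fix x assume x: "x \<in> {-pi<..<pi}"
    show "(?F has_vector_derivative ?f x) (at x)"
      unfolding has_real_derivative_iff_has_vector_derivative[symmetric] using x \<gamma>
      by (auto intro!: derivative_eq_intros)
  qed simp
  then have "?f absolutely_integrable_on {-pi..pi}"
    by (intro nonnegative_absolutely_integrable_1) auto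
  then have "set_integrable lebesgue {-pi<..<pi} ?f"
    by (rule set_integrable_subset) auto
  then have "integrable (completion lborel) (\<lambda>x. indicator {-pi<..<pi} x *\<^sub>R ?f x)"
    by (simp add: set_integrable_def)
  then have "integrable lborel (\<lambda>x. indicator {-pi<..<pi} x *\<^sub>R ?f x)"
    by (subst (asm) integrable_completion) measurable
  then show ?thesis by (subst integrable_restrict_space) auto
qed

lemma one_le_weight:
  fixes c h q :: real
  assumes "c > 0" "h > 0" "q > 1"
  shows "1 \<le> c / h + c powr (1 - q) * h powr (q - 1)"
proof (cases "h \<le> c")
  case True
  then have "1 \<le> c / h" using assms by simp
  then show ?thesis using mult_nonneg_nonneg[OF powr_ge_zero powr_ge_zero, of c "1 - q" h "q - 1"] by linarith
next
  case False
  then have "1 \<le> (h / c) powr (q - 1)" using assms by (intro ge_one_powr_ge_zero) auto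
  also have "\<dots> = c powr (1 - q) * h powr (q - 1)"
    using assms powr_minus[of c "q - 1"] by (simp add: powr_divide field_simps)
  finally show ?thesis using divide_pos_pos[OF assms(1,2)] by linarith
qed

lemma summable_weights: "summable (\<lambda>k. (1 + (real k)\<^sup>2) powr (- 3 / 4))"
proof (rule summable_comparison_test')
  show "summable (\<lambda>k. real k powr (- 3 / 2))" by (simp add: summable_real_powr_iff)
  show "norm ((1 + (real k)\<^sup>2) powr (- 3 / 4)) \<le> real k powr (- 3 / 2)" if "k \<ge> 1" for k
  proof -
    have "(1 + (real k)\<^sup>2) powr (- 3 / 4) \<le> ((real k)\<^sup>2) powr (- 3 / 4)"
      using that by (intro powr_mono2') auto
    also have "\<dots> = real k powr (- 3 / 2)"
      using that by (simp add: powr_powr flip: powr_numeral)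
    finally show ?thesis by simp
  qed
qed

text \<open>Since \<open>cos (t / 2)\<close> is the modulus of \<open>(1 + cis t) / 2\<close>, this
  is the function \<open>h\<close> of the overview. On the k-th segment \<open>1 / h\<close> grows
  like the square root of \<open>k\<close>; against the mass \<open>1 / k\<^sup>2\<close> this
  leaves the convergent series of \<open>summable_weights\<close>.\<close>

definition weight :: "real \<Rightarrow> real" where "weight t = sqrt (cos (t / 2))"

lemma cos_half_pos: "t \<in> {-pi<..<pi} \<Longrightarrow> 0 < cos (t / 2)"
  by (intro cos_gt_zero_pi) auto

lemma weight_pos: "t \<in> {-pi<..<pi} \<Longrightarrow> 0 < weight t"
  using cos_half_pos by (simp add: weight_def)

lemma weight_le: "weight t \<le> 1"
  by (simp add: weight_def)

lemma weight_cont: "continuous_on S weight"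
  unfolding weight_def by (intro continuous_intros) auto

lemma weight_eq:
  assumes "t \<in> {-pi<..<pi}"
  shows "cos (t / 2) = (1 + (tan (t / 2))\<^sup>2) powr (- 1 / 2)" "1 / weight t = (1 + (tan (t / 2))\<^sup>2) powr (1 / 4)"
proof -
  let ?c = "cos (t / 2)" and ?y = "1 + (tan (t / 2))\<^sup>2"
  have c: "?c > 0" by (rule cos_half_pos[OF assms])
  have y: "?y = ?c powr (- 2)"
    using c tan_sec[of "t / 2"] by (simp add: powr_minus power_inverse)
  show 1: "?c = ?y powr (- 1 / 2)"
    unfolding y powr_powr using c by simp
  have "1 / weight t = (?c powr (1 / 2)) powr (- 1)"
    using c by (simp add: weight_def powr_half_sqrt powr_minus_divide)
  also have "\<dots> = ?y powr (1 / 4)"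
    unfolding y powr_powr by simp
  finally show "1 / weight t = ?y powr (1 / 4)" .
qed

lemma poly_le: "cmod z \<le> 1 \<Longrightarrow> cmod (\<Sum>n<N. a n * z ^ n) \<le> (\<Sum>n<N. cmod (a n))"
  by (rule order_trans[OF norm_sum])
     (auto simp: norm_mult norm_power intro!: sum_mono mult_left_le power_le_one)

lemma arctan_segment: "{2 * arctan k..2 * arctan l} \<subseteq> {-pi<..<pi}"
  using tan_half_range(3) by blast

text \<open>\<open>circle_measure\<close> is parametrised from 0 to 2 pi, the estimates from -pi to
  pi. Every point of the circle other than -1 is \<open>cis (Arg \<zeta>)\<close> with argument in
  the open arc, and -1 is a null set.\<close>

lemma AE_circle_cis:
  assumes "\<And>t. t \<in> {-pi<..<pi} \<Longrightarrow> P (cis t)"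
  shows "AE \<zeta> in circle_measure. P \<zeta>"
proof -
  have m: "cis \<in> uniform_measure lborel {0..2 * pi} \<rightarrow>\<^sub>M restrict_space borel (sphere 0 1)"
  proof -
    have "cis \<in> borel_measurable borel"
      by (intro borel_measurable_continuous_onI continuous_intros)
    then show ?thesis by (intro measurable_restrict_space2) auto
  qed
  have "AE t in uniform_measure lborel {0..2 * pi}. cis t \<noteq> -1"
  proof (rule AE_uniform_measureI)
    show "AE t in lborel. t \<in> {0..2 * pi} \<longrightarrow> cis t \<noteq> -1"
      using AE_lborel_singleton[of pi]
    proof eventually_elim
      case (elim t)
      show ?case
      proof
        assume t: "t \<in> {0..2 * pi}"
        show "cis t \<noteq> -1"
        proof
          assume "cis t = -1"
          then have "cos (t - pi) = 1" by (simp add: complex_eq_iff)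
          moreover have "cos (t - pi) \<noteq> 1"
          proof -
            have "cos \<bar>t - pi\<bar> < 1"
              using t elim cos_monotone_0_pi[of 0 "\<bar>t - pi\<bar>"] by auto
            then show ?thesis by (cases "t \<ge> pi") (auto simp: cos_diff)
          qed
          ultimately show False by simp
        qed
      qed
    qed
  qed simp
  then have "AE \<zeta> in circle_measure. \<zeta> \<noteq> -1"
    unfolding circle_measure_def by (subst AE_distr_iff[OF m]) (auto simp: sets_restrict_space_iff)
  moreover have "P \<zeta>" if "\<zeta> \<noteq> -1" "\<zeta> \<in> space circle_measure" for \<zeta>
  proof -
    have n: "cmod \<zeta> = 1" using that by (simp add: circle_measure_def space_restrict_space)
    then have "\<zeta> \<noteq> 0" by auto
    then have e: "\<zeta> = cis (Arg \<zeta>)" using cis_Arg[of \<zeta>] n by (simp add: sgn_div_norm)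
    moreover have "Arg \<zeta> \<noteq> pi" using e that(1) by auto
    ultimately show ?thesis using assms[of "Arg \<zeta>"] mpi_less_Arg[of \<zeta>] Arg_le_pi[of \<zeta>] by auto
  qed
  then have "AE \<zeta> in circle_measure. \<zeta> \<noteq> -1 \<longrightarrow> P \<zeta>" by (intro AE_I2) auto
  ultimately show ?thesis by (rule AE_mp)
qed

section \<open>From segments to the whole circle\<close>

context exponent
begin

definition Fsq :: "nat \<Rightarrow> (nat \<Rightarrow> complex) \<Rightarrow> real \<Rightarrow> real" where
  "Fsq N a t = (cmod (\<Sum>n<N. a n * phi2 (cis t) ^ n))\<^sup>2"

lemma phi2_cis_cont: "continuous_on {-pi<..<pi} (\<lambda>t. phi2 (cis t))"
  by (rule continuous_on_compose2[OF holomorphic_on_imp_continuous_on[OF phi_holomorphic(2)]])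
     (use Re_cis_gt in \<open>auto intro!: continuous_intros\<close>)

lemma Fsq_cont: "continuous_on {-pi<..<pi} (Fsq N a)"
  unfolding Fsq_def by (intro continuous_intros phi2_cis_cont)

lemma phi2_cis_lt: "t \<in> {-pi<..<pi} \<Longrightarrow> cmod (phi2 (cis t)) < 1"
  by (simp add: norm_phi_cis sigma_pos)

lemma Fsq_le: "t \<in> {-pi<..<pi} \<Longrightarrow> Fsq N a t \<le> (\<Sum>n<N. cmod (a n))\<^sup>2"
  unfolding Fsq_def using phi2_cis_lt[of t] by (intro power_mono poly_le) auto

lemma Fsq_nonneg: "0 \<le> Fsq N a t" by (simp add: Fsq_def)

lemma Fsq_weight_cont: "continuous_on {-pi<..<pi} (\<lambda>t. Fsq N a t / weight t)"
  using weight_pos by (intro continuous_intros Fsq_cont weight_cont) fastforce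

text \<open>Dividing by the weight costs at most \<open>(3 * (1 + k\<^sup>2)) powr (1 / 4)\<close>
  on the segment. The constant is 3 times 3888, with \<open>3 powr (1 / 4)\<close> estimated by
  3.\<close>

lemma weighted_segment_estimate:
  "integral {2 * arctan k..2 * arctan (k + 1)} (\<lambda>t. Fsq N a t / weight t)
    \<le> 11664 * pi / \<delta> * (\<Sum>n<N. (cmod (a n))\<^sup>2) * (1 + k\<^sup>2) powr (- 3 / 4)"
proof -
  let ?J = "{2 * arctan k..2 * arctan (k + 1)}"
  define S where "S = (\<Sum>n<N. (cmod (a n))\<^sup>2)"
  have S0: "0 \<le> S" by (simp add: S_def sum_nonneg)
  have k0: "1 + k\<^sup>2 > 0" by (simp add: add_pos_nonneg)
  have "integral ?J (\<lambda>t. Fsq N a t / weight t) \<le> integral ?J (\<lambda>t. (3 * (1 + k\<^sup>2)) powr (1 / 4) * Fsq N a t)"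
  proof (rule integral_le)
    show "(\<lambda>t. Fsq N a t / weight t) integrable_on ?J"
      by (intro integrable_continuous_real continuous_on_subset[OF Fsq_weight_cont] arctan_segment)
    show "(\<lambda>t. (3 * (1 + k\<^sup>2)) powr (1 / 4) * Fsq N a t) integrable_on ?J"
      by (intro integrable_continuous_real continuous_intros continuous_on_subset[OF Fsq_cont] arctan_segment)
    fix t assume t: "t \<in> ?J"
    note r = tan_half_range[OF t]
    have "1 / weight t \<le> (3 * (1 + k\<^sup>2)) powr (1 / 4)"
      unfolding weight_eq(2)[OF r(3)] using comparable(1)[OF r(1,2)]
      by (intro powr_mono2) (auto simp: add_nonneg_nonneg)
    then have "1 / weight t * Fsq N a t \<le> (3 * (1 + k\<^sup>2)) powr (1 / 4) * Fsq N a t"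
      by (intro mult_right_mono Fsq_nonneg)
    then show "Fsq N a t / weight t \<le> (3 * (1 + k\<^sup>2)) powr (1 / 4) * Fsq N a t" by simp
  qed
  also have "\<dots> = (3 * (1 + k\<^sup>2)) powr (1 / 4) * integral ?J (Fsq N a)"
    by simp
  also have "\<dots> \<le> (3 * (1 + k\<^sup>2)) powr (1 / 4) * (3888 * pi / \<delta> / (1 + k\<^sup>2) * S)"
    unfolding S_def Fsq_def by (intro mult_left_mono segment_estimate) simp
  also have "(3 * (1 + k\<^sup>2)) powr (1 / 4) = 3 powr (1 / 4) * (1 + k\<^sup>2) powr (1 / 4)"
    by (rule powr_mult)
  also have "3 powr (1 / 4) * (1 + k\<^sup>2) powr (1 / 4) * (3888 * pi / \<delta> / (1 + k\<^sup>2) * S)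
      \<le> 3 * (1 + k\<^sup>2) powr (1 / 4) * (3888 * pi / \<delta> / (1 + k\<^sup>2) * S)"
  proof (intro mult_right_mono)
    show "3 powr (1 / 4) \<le> (3 :: real)" using powr_mono[of "1 / 4" 1 "3 :: real"] by simp
  qed (use delta_pos k0 S0 in auto)
  also have "\<dots> = 11664 * pi / \<delta> * S * ((1 + k\<^sup>2) powr (1 / 4) * (1 + k\<^sup>2) powr (- 1))"
    by (simp add: inverse_powr[symmetric] field_simps)
  also have "(1 + k\<^sup>2) powr (1 / 4) * (1 + k\<^sup>2) powr (- 1) = (1 + k\<^sup>2) powr (- 3 / 4)"
    unfolding powr_add[symmetric] by simp
  finally show ?thesis by (simp add: S_def)
qed

text \<open>The factor 2 accounts for the segments on both sides of \<open>t = 0\<close>.\<close>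

definition C0 :: real where
  "C0 = 11664 * pi / \<delta> * (2 * (\<Sum>k. (1 + (real k)\<^sup>2) powr (- 3 / 4)))"

lemma C0_pos: "C0 > 0"
proof -
  have "(0::real) < (1 + (real 0)\<^sup>2) powr (- 3 / 4)" by simp
  also have "\<dots> \<le> (\<Sum>k. (1 + (real k)\<^sup>2) powr (- 3 / 4))"
    using sum_le_suminf[OF summable_weights, of "{0}"] by simp
  finally show ?thesis using delta_pos by (simp add: C0_def)
qed

lemma weighted_estimate:
  "integral {2 * arctan (- real m)..2 * arctan (real m)} (\<lambda>t. Fsq N a t / weight t)
    \<le> C0 * (\<Sum>n<N. (cmod (a n))\<^sup>2)"
proof -
  define S where "S = (\<Sum>n<N. (cmod (a n))\<^sup>2)"
  have S0: "0 \<le> S" by (simp add: S_def sum_nonneg)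
  define E where "E = 11664 * pi / \<delta> * S"
  have E0: "0 \<le> E" unfolding E_def using delta_pos S0 by simp
  let ?g = "\<lambda>t. Fsq N a t / weight t"
  let ?w = "\<lambda>k. (1 + (real k)\<^sup>2) powr (- 3 / 4)"
  have "integral {2 * arctan (- real m)..2 * arctan (real m)} ?g \<le> E * (\<Sum>k<m. 2 * ?w k)"
  proof (induction m)
    case 0
    then show ?case by simp
  next
    case (Suc m)
    let ?a = "2 * arctan (- real (Suc m))" and ?b = "2 * arctan (- real m)"
      and ?c = "2 * arctan (real m)" and ?d = "2 * arctan (real (Suc m))"
    have o: "?a \<le> ?b" "?b \<le> ?c" "?c \<le> ?d" by (simp_all add: arctan_le_iff del: arctan_minus)
    have i: "?g integrable_on {2 * arctan x..2 * arctan y}" for x y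
      by (intro integrable_continuous_real continuous_on_subset[OF Fsq_weight_cont] arctan_segment)
    have "integral {?a..?d} ?g = integral {?a..?b} ?g + integral {?b..?c} ?g + integral {?c..?d} ?g"
      using Henstock_Kurzweil_Integration.integral_combine[OF _ _ i, of "- real (Suc m)" ?c "real (Suc m)"]
        Henstock_Kurzweil_Integration.integral_combine[OF _ _ i, of "- real (Suc m)" ?b "real m"] o
      by linarith
    \<comment> \<open>The left segment starts at \<open>k = - Suc m\<close>. Replacing its bound by
      the larger one for \<open>m\<close> lets both sides share one series.\<close>
    also have "integral {?a..?b} ?g \<le> E * ?w m"
    proof -
      have "integral {?a..?b} ?g \<le> E * (1 + (- real (Suc m))\<^sup>2) powr (- 3 / 4)"
        using weighted_segment_estimate[of "- real (Suc m)" N a] by (simp add: E_def S_def)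
      also have "\<dots> \<le> E * ?w m"
        using E0 by (intro mult_left_mono powr_mono2') (auto intro!: power_mono simp: add_pos_nonneg simp del: of_nat_Suc)
      finally show ?thesis .
    qed
    also have "integral {?c..?d} ?g \<le> E * ?w m"
      using weighted_segment_estimate[of "real m" N a] by (simp add: E_def S_def add.commute)
    also note Suc.IH
    finally show ?case by (simp add: algebra_simps)
  qed
  also have "\<dots> \<le> E * (2 * (\<Sum>k. ?w k))"
    unfolding sum_distrib_left[symmetric]
    by (intro mult_left_mono sum_le_suminf summable_weights E0) auto
  also have "\<dots> = C0 * S" by (simp add: C0_def E_def)
  finally show ?thesis by (simp add: S_def)
qed

lemma integrable_Fsq: "integrable arc_lebesgue (Fsq N a)"
  by (rule integrable_arc_bounded[OF Fsq_cont]) (use Fsq_le Fsq_nonneg in auto)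

lemma Fsq_powr_cont: "continuous_on {-pi<..<pi} (\<lambda>t. Fsq N a t * weight t powr r)"
  using weight_pos by (intro continuous_intros Fsq_cont weight_cont) fastforce

lemma integrable_Fsq_powr:
  assumes "r > 0"
  shows "integrable arc_lebesgue (\<lambda>t. Fsq N a t * weight t powr r)"
proof (rule integrable_arc_bounded[OF Fsq_powr_cont])
  fix t assume t: "t \<in> {-pi<..<pi}"
  have "weight t powr r \<le> 1 powr r" using weight_le[of t] weight_pos[OF t] assms by (intro powr_mono2) auto
  then have "Fsq N a t * weight t powr r \<le> Fsq N a t * 1" by (intro mult_left_mono Fsq_nonneg) simp
  then show "\<bar>Fsq N a t * weight t powr r\<bar> \<le> (\<Sum>n<N. cmod (a n))\<^sup>2"
    using Fsq_le[OF t, of N a] Fsq_nonneg[of N a t] by (simp add: abs_mult)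
qed

text \<open>\<open>one_le_weight\<close> is integrated against \<open>Fsq\<close>. The estimate with
  \<open>1 / h\<close> is available on closed arcs away from -1, so the circle is exhausted by the
  arcs \<open>?J m\<close>, with bounds independent of \<open>m\<close>.\<close>

lemma arc_estimate:
  assumes c: "c > 0" and q: "q > 1"
  shows "(\<integral>t. Fsq N a t \<partial>arc_lebesgue) \<le> c * C0 * (\<Sum>n<N. (cmod (a n))\<^sup>2)
    + c powr (1 - q) * (\<integral>t. Fsq N a t * weight t powr (q - 1) \<partial>arc_lebesgue)"
proof -
  let ?J = "\<lambda>m. {2 * arctan (- real m)..2 * arctan (real m)}"
  let ?F = "Fsq N a" and ?G = "\<lambda>t. Fsq N a t * weight t powr (q - 1)" and ?H = "\<lambda>t. Fsq N a t / weight t"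
  have lim: "(\<lambda>m. \<integral>t. indicator (?J m) t * ?F t \<partial>arc_lebesgue) \<longlonglongrightarrow> (\<integral>t. ?F t \<partial>arc_lebesgue)"
  proof (rule integral_dominated_convergence)
    show "integrable arc_lebesgue ?F" by (rule integrable_Fsq)
    show "AE t in arc_lebesgue. (\<lambda>m. indicator (?J m) t * ?F t) \<longlonglongrightarrow> ?F t"
    proof (rule AE_I2)
      fix t assume "t \<in> space arc_lebesgue"
      then have t: "t \<in> {-pi<..<pi}" by (simp add: space_restrict_space)
      then have at: "arctan (tan (t / 2)) = t / 2" by (intro arctan_tan) auto
      obtain m where m: "\<bar>tan (t / 2)\<bar> \<le> real m" using real_arch_simple by blast
      have "t \<in> ?J n" if "n \<ge> m" for n
      proof -
        have "- real n \<le> tan (t / 2)" "tan (t / 2) \<le> real n" using m that by auto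
        then have "arctan (- real n) \<le> arctan (tan (t / 2))" "arctan (tan (t / 2)) \<le> arctan (real n)"
          unfolding arctan_le_iff .
        then have "arctan (- real n) \<le> t / 2" "t / 2 \<le> arctan (real n)"
          unfolding at .
        then show ?thesis by auto
      qed
      then have "\<forall>\<^sub>F n in sequentially. indicator (?J n) t * ?F t = ?F t"
        unfolding eventually_sequentially by (intro exI[of _ m]) (auto simp del: arctan_minus)
      then show "(\<lambda>n. indicator (?J n) t * ?F t) \<longlonglongrightarrow> ?F t" by (rule tendsto_eventually)
    qed
    show "AE t in arc_lebesgue. norm (indicator (?J m) t * ?F t) \<le> ?F t" for m
      using Fsq_nonneg by (intro AE_I2) (auto simp: indicator_def)
    show "?F \<in> borel_measurable arc_lebesgue" by (rule arc_measurable[OF Fsq_cont])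
    show "(\<lambda>t. indicator (?J m) t * ?F t) \<in> borel_measurable arc_lebesgue" for m
      by (intro borel_measurable_integrable arc_integral_segment continuous_on_subset[OF Fsq_cont] arctan_segment)
  qed
  have "(\<integral>t. indicator (?J m) t * ?F t \<partial>arc_lebesgue) \<le> c * C0 * (\<Sum>n<N. (cmod (a n))\<^sup>2)
    + c powr (1 - q) * (\<integral>t. ?G t \<partial>arc_lebesgue)" for m
  proof -
    note cont = continuous_on_subset[OF Fsq_cont arctan_segment]
      continuous_on_subset[OF Fsq_powr_cont arctan_segment] continuous_on_subset[OF Fsq_weight_cont arctan_segment]
    have "(\<integral>t. indicator (?J m) t * ?F t \<partial>arc_lebesgue) = integral (?J m) ?F"
      by (intro arc_integral_segment cont arctan_segment)
    also have "\<dots> \<le> integral (?J m) (\<lambda>t. c * ?H t + c powr (1 - q) * ?G t)"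
    proof (rule integral_le)
      fix t assume "t \<in> ?J m"
      then have "t \<in> {-pi<..<pi}" using arctan_segment by blast
      then have "?F t * 1 \<le> ?F t * (c / weight t + c powr (1 - q) * weight t powr (q - 1))"
        by (intro mult_left_mono one_le_weight c q weight_pos Fsq_nonneg)
      then show "?F t \<le> c * ?H t + c powr (1 - q) * ?G t" by (simp add: algebra_simps)
    qed (intro integrable_continuous_real continuous_intros cont)+
    also have "\<dots> = c * integral (?J m) ?H + c powr (1 - q) * integral (?J m) ?G"
    proof -
      have "integral (?J m) (\<lambda>t. c * ?H t + c powr (1 - q) * ?G t)
          = integral (?J m) (\<lambda>t. c * ?H t) + integral (?J m) (\<lambda>t. c powr (1 - q) * ?G t)"
        by (intro Henstock_Kurzweil_Integration.integral_add integrable_continuous_real continuous_on_mult_left cont)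
      then show ?thesis by (simp only: Henstock_Kurzweil_Integration.integral_mult_right)
    qed
    also have "\<dots> \<le> c * (C0 * (\<Sum>n<N. (cmod (a n))\<^sup>2)) + c powr (1 - q) * (\<integral>t. ?G t \<partial>arc_lebesgue)"
    proof (intro add_mono mult_left_mono weighted_estimate)
      have "integral (?J m) ?G = (\<integral>t. indicator (?J m) t * ?G t \<partial>arc_lebesgue)"
        by (intro arc_integral_segment(1)[symmetric] cont arctan_segment)
      also have "\<dots> \<le> (\<integral>t. ?G t \<partial>arc_lebesgue)"
        using q Fsq_nonneg
        by (intro integral_mono arc_integral_segment(2) cont arctan_segment integrable_Fsq_powr)
           (auto simp: indicator_def)
      finally show "integral (?J m) ?G \<le> (\<integral>t. ?G t \<partial>arc_lebesgue)" .
    qed (use c in auto)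
    finally show ?thesis by (simp add: mult.assoc)
  qed
  then show ?thesis by (intro LIMSEQ_le_const2[OF lim] exI[of _ 0] allI impI)
qed

lemma one_minus_norm_ge:
  assumes t: "t \<in> {-pi<..<pi}"
  shows "\<delta> / 32 * cos (t / 2) powr \<alpha> \<le> 1 - (cmod (phi2 (cis t)))\<^sup>2"
proof -
  define s where "s = \<sigma> (tan (t / 2))"
  have s: "0 < s" "s \<le> 1 / 2" using sigma_pos sigma_le_half by (auto simp: s_def)
  have "cos (t / 2) powr \<alpha> = (1 + (tan (t / 2))\<^sup>2) powr (- \<alpha> / 2)"
    by (subst weight_eq(1)[OF t]) (simp add: powr_powr)
  then have "\<delta> / 32 * cos (t / 2) powr \<alpha> \<le> s"
    using sigma_ge[of "tan (t / 2)"] by (simp add: s_def)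
  \<comment> \<open>Here \<open>s \<le> 1 / 2\<close> enters: for positive \<open>s\<close> the
    inequality \<open>1 / (1 + 2 * s) \<le> 1 - s\<close> holds exactly up to that value.\<close>
  also have "s \<le> 1 - exp (- (2 * s))"
  proof -
    have "exp (- (2 * s)) = 1 / exp (2 * s)" by (simp add: exp_minus divide_inverse)
    also have "\<dots> \<le> 1 / (1 + 2 * s)" using s by (intro divide_left_mono exp_ge_add_one_self) auto
    also have "\<dots> \<le> 1 - s"
    proof -
      have "s * (2 * s) \<le> s * 1" using s by (intro mult_left_mono) auto
      then show ?thesis using s by (simp add: divide_simps algebra_simps)
    qed
    finally show ?thesis by simp
  qed
  also have "exp (- (2 * s)) = (cmod (phi2 (cis t)))\<^sup>2"
    by (simp add: norm_phi_cis[OF t] s_def exp_of_nat_mult[of 2, simplified, symmetric] power2_eq_square exp_add[symmetric])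
  finally show ?thesis .
qed

text \<open>The integrand is at most a multiple of \<open>cos (t / 2)\<close> to the power (q - 1) /
  2 - \<alpha>, which the assumption places above -1; and \<open>cos (t / 2)\<close> is comparable
  to the distance from the nearer endpoint of the arc.\<close>

lemma kernel_integrable:
  assumes q: "q > 1" "(q - 1) / 2 - \<alpha> > -1"
  shows "integrable arc_lebesgue (\<lambda>t. weight t powr (q - 1) * (1 / (1 - (cmod (phi2 (cis t)))\<^sup>2)))"
proof -
  \<comment> \<open>The maximum with 1 / 2 keeps \<gamma> positive when the power is not singular at
    all; as \<open>r \<le> 1\<close>, enlarging \<gamma> only weakens the bound. The constant 192 is
    32 times 6, with \<open>6 powr \<gamma>\<close> estimated by 6.\<close>
  define \<gamma> where "\<gamma> = max (1 / 2) (\<alpha> - (q - 1) / 2)"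
  have \<gamma>: "0 < \<gamma>" "\<gamma> < 1" using q by (auto simp: \<gamma>_def)
  let ?g = "\<lambda>x. 192 / \<delta> * ((pi - x) powr (- \<gamma>) + (pi + x) powr (- \<gamma>))"
  have sq: "(cmod (phi2 (cis t)))\<^sup>2 < 1" if "t \<in> {-pi<..<pi}" for t
    using phi2_cis_lt[OF that] by (simp add: abs_square_less_1)
  show ?thesis
  proof (rule Bochner_Integration.integrable_bound)
    show "integrable arc_lebesgue ?g"
      by (intro integrable_mult_right integrable_arc_powr \<gamma>)
    have "continuous_on {-pi<..<pi} (\<lambda>t. weight t powr (q - 1) * (1 / (1 - (cmod (phi2 (cis t)))\<^sup>2)))"
      using weight_pos sq by (intro continuous_intros weight_cont phi2_cis_cont) fastforce+
    then show "(\<lambda>t. weight t powr (q - 1) * (1 / (1 - (cmod (phi2 (cis t)))\<^sup>2))) \<in> borel_measurable arc_lebesgue"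
      by (rule arc_measurable)
    show "AE t in arc_lebesgue. norm (weight t powr (q - 1) * (1 / (1 - (cmod (phi2 (cis t)))\<^sup>2))) \<le> norm (?g t)"
    proof (rule AE_I2)
      fix t assume "t \<in> space arc_lebesgue"
      then have t: "t \<in> {-pi<..<pi}" by (simp add: space_restrict_space)
      define r where "r = cos (t / 2)"
      have r: "0 < r" "r \<le> 1" using cos_half_pos[OF t] by (auto simp: r_def)
      have w: "weight t powr (q - 1) = r powr ((q - 1) / 2)"
        using r by (simp add: weight_def r_def[symmetric] powr_half_sqrt[symmetric] powr_powr)
      define d where "d = pi - \<bar>t\<bar>"
      have d: "0 < d" using t by (auto simp: d_def)
      have "d / 2 / 3 \<le> sin (d / 2)" using t by (intro sin_ge_third) (auto simp: d_def)
      also have "sin (d / 2) = r"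
        by (cases "t \<ge> 0") (auto simp: d_def r_def diff_divide_distrib add_divide_distrib sin_diff sin_add)
      finally have dr: "d / 6 \<le> r" by simp
      have "weight t powr (q - 1) * (1 / (1 - (cmod (phi2 (cis t)))\<^sup>2))
          \<le> r powr ((q - 1) / 2) * (1 / (\<delta> / 32 * r powr \<alpha>))"
        unfolding w using one_minus_norm_ge[OF t] delta_pos r
        by (intro mult_left_mono frac_le) (auto simp: r_def)
      also have "\<dots> = 32 / \<delta> * r powr ((q - 1) / 2 - \<alpha>)"
        using delta_pos r by (simp add: powr_diff)
      finally have le: "weight t powr (q - 1) * (1 / (1 - (cmod (phi2 (cis t)))\<^sup>2)) \<le> 32 / \<delta> * r powr ((q - 1) / 2 - \<alpha>)" .
      have "r powr ((q - 1) / 2 - \<alpha>) \<le> r powr (- \<gamma>)"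
        using r by (intro powr_mono') (auto simp: \<gamma>_def)
      also have "\<dots> \<le> (d / 6) powr (- \<gamma>)"
        using dr d \<gamma> by (intro powr_mono2') auto
      also have "\<dots> = 6 powr \<gamma> * d powr (- \<gamma>)"
        using d by (subst powr_divide) (auto simp: powr_minus divide_simps)
      also have "\<dots> \<le> 6 * ((pi - t) powr (- \<gamma>) + (pi + t) powr (- \<gamma>))"
      proof (intro mult_mono)
        show "6 powr \<gamma> \<le> (6::real)" using powr_mono[of \<gamma> 1 "6::real"] \<gamma> by simp
        show "d powr (- \<gamma>) \<le> (pi - t) powr (- \<gamma>) + (pi + t) powr (- \<gamma>)"
          by (cases "t \<ge> 0") (auto simp: d_def)
      qed auto
      finally have "32 / \<delta> * r powr ((q - 1) / 2 - \<alpha>) \<le> 32 / \<delta> * (6 * ((pi - t) powr (- \<gamma>) + (pi + t) powr (- \<gamma>)))"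
        using delta_pos by (intro mult_left_mono) auto
      with le have "weight t powr (q - 1) * (1 / (1 - (cmod (phi2 (cis t)))\<^sup>2)) \<le> ?g t"
        by simp
      moreover have "0 \<le> weight t powr (q - 1) * (1 / (1 - (cmod (phi2 (cis t)))\<^sup>2))"
        using sq[OF t] by simp
      ultimately show "norm (weight t powr (q - 1) * (1 / (1 - (cmod (phi2 (cis t)))\<^sup>2))) \<le> norm (?g t)"
        by (metis abs_ge_self abs_of_nonneg order_trans real_norm_def)
    qed
  qed
qed

section \<open>Conclusions for the two symbols\<close>

lemma phi2_schatten:
  assumes q: "q > 1" "(q - 1) / 2 - \<alpha> > -1"
  shows "composition_operator phi2 \<in> schatten_class (2 * q)"
proof -
  \<comment> \<open>The division by 2 pi matches the factor in \<open>bessel_circle\<close>, which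
    also turns \<open>C0\<close> into \<open>C0 / (2 * pi)\<close>.\<close>
  let ?w = "\<lambda>t. weight t powr (q - 1) / (2 * pi)"
  let ?M = "density arc_lebesgue ?w"
  let ?\<psi> = "\<lambda>t. phi2 (cis t)"
  have wm: "?w \<in> borel_measurable arc_lebesgue"
    using weight_pos by (intro arc_measurable continuous_intros weight_cont) fastforce+
  have w0: "AE t in arc_lebesgue. 0 \<le> ?w t" by (intro AE_I2) simp
  have pm: "?\<psi> \<in> borel_measurable arc_lebesgue" by (rule arc_measurable[OF phi2_cis_cont])
  interpret composition_trace_bound phi2 ?M ?\<psi> "C0 / (2 * pi)" q
  proof
    show "phi2 holomorphic_on ball 0 1" "phi2 ` ball 0 1 \<subseteq> ball 0 1"
      by (rule holomorphic_on_subset[OF phi_holomorphic(2) disc_subset] phi_disc)+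
    show "q > 1" "C0 / (2 * pi) > 0" using q C0_pos by auto
    show "?\<psi> \<in> borel_measurable ?M" using pm by simp
    show "cmod (?\<psi> t) < 1" if "t \<in> space ?M" for t
      using that by (intro phi2_cis_lt) (simp add: space_restrict_space)
    have km: "(\<lambda>t. 1 / (1 - (cmod (?\<psi> t))\<^sup>2)) \<in> borel_measurable arc_lebesgue"
      using pm by measurable
    show "integrable ?M (\<lambda>t. 1 / (1 - (cmod (?\<psi> t))\<^sup>2))"
      unfolding integrable_density[OF km wm w0]
      using integrable_mult_right[OF kernel_integrable[OF q], of "1 / (2 * pi)"] by simp
    fix c :: real and a :: "nat \<Rightarrow> complex" and N L :: nat
    assume c: "c > 0"
    let ?g = "\<lambda>z. \<Sum>n<N. a n * phi2 z ^ n"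
    let ?R = "c * C0 * (\<Sum>n<N. (cmod (a n))\<^sup>2)
        + c powr (1 - q) * (\<integral>t. Fsq N a t * weight t powr (q - 1) \<partial>arc_lebesgue)"
    have "(\<integral>t. (cmod (?g (cis t)))\<^sup>2 \<partial>arc_lebesgue) \<le> ?R"
      using arc_estimate[OF c q(1), of N a] by (simp add: Fsq_def)
    then have R: "(1 / (2 * pi)) * (\<integral>t. (cmod (?g (cis t)))\<^sup>2 \<partial>arc_lebesgue) \<le> (1 / (2 * pi)) * ?R"
      by (intro mult_left_mono) auto
    have "(\<Sum>k<L. (cmod (taylor_coeff ?g k))\<^sup>2) \<le> (1 / (2 * pi)) * (\<integral>t. (cmod (?g (cis t)))\<^sup>2 \<partial>arc_lebesgue)"
    proof (rule bessel_circle)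
      have h: "?g holomorphic_on {z. Re z > -1}" by (intro holomorphic_intros phi_holomorphic)
      show "?g holomorphic_on ball 0 1" by (rule holomorphic_on_subset[OF h disc_subset])
      show "cmod (?g z) \<le> (\<Sum>n<N. cmod (a n))" if "cmod z < 1" for z
        using that phi_disc(2) by (intro poly_le) (force simp: image_subset_iff)
      show "continuous_on {-pi<..<pi} (\<lambda>t. ?g (cis t))" by (intro continuous_intros phi2_cis_cont)
      show "((\<lambda>r. ?g (of_real r * cis t)) \<longlongrightarrow> ?g (cis t)) (at_left 1)" if "t \<in> {-pi<..<pi}" for t
        by (rule radial_tendsto[OF h Re_cis_gt[OF that]])
    qed
    also note R
    also have "(1 / (2 * pi)) * ?R
      = c * (C0 / (2 * pi)) * (\<Sum>n<N. (cmod (a n))\<^sup>2)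
        + c powr (1 - q) * ((1 / (2 * pi)) * (\<integral>t. Fsq N a t * weight t powr (q - 1) \<partial>arc_lebesgue))"
      by (simp add: field_simps)
    also have "(1 / (2 * pi)) * (\<integral>t. Fsq N a t * weight t powr (q - 1) \<partial>arc_lebesgue)
      = (\<integral>t. (cmod (\<Sum>n<N. a n * ?\<psi> t ^ n))\<^sup>2 \<partial>?M)"
      unfolding integral_density[OF arc_measurable[OF Fsq_cont[unfolded Fsq_def[abs_def]]] wm w0]
      by (subst integral_mult_right_zero[symmetric]) (simp add: Fsq_def mult_ac)
    finally show "(\<Sum>k<L. (cmod (taylor_coeff ?g k))\<^sup>2) \<le> c * (C0 / (2 * pi)) * (\<Sum>n<N. (cmod (a n))\<^sup>2)
        + c powr (1 - q) * (\<integral>t. (cmod (\<Sum>n<N. a n * ?\<psi> t ^ n))\<^sup>2 \<partial>?M)"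
      by simp
  qed
  interpret trace_bound "composition_operator phi2" ?M ?\<psi> "C0 / (2 * pi)" q
    by (rule trace_bound)
  show ?thesis by (rule schatten)
qed

text \<open>On the radius \<open>u = v\<close> is real, and subtracting the power only lowers the
  exponent: \<open>X\<close> is at most \<open>v / 4 = (1 - \<rho>) / 8\<close>. Hence
  \<open>1 - \<rho> * exp (- X)\<close>, which is at most \<open>1 - \<rho> + X\<close>, is of order
  \<open>1 - \<rho>\<close>.\<close>

lemma phi1_not_compact: "\<not> compact_operator (composition_operator phi1)"
proof (rule not_compact_if_angular_derivative)
  show "phi1 holomorphic_on ball 0 1" "phi1 ` ball 0 1 \<subseteq> ball 0 1"
    by (rule holomorphic_on_subset[OF phi_holomorphic(1) disc_subset] phi_disc)+
  fix \<rho> :: real assume \<rho>: "0 < \<rho>" "\<rho> < 1"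
  define v where "v = (1 - \<rho>) / 2"
  have v: "0 < v" "v \<le> 1" using \<rho> by (auto simp: v_def)
  define X where "X = v / 4 - v powr \<alpha> / 32"
  have "(1 + of_real (- \<rho>)) / 2 = complex_of_real v" by (simp add: v_def)
  then have ph: "phi1 (of_real (- \<rho>)) = of_real (exp (- X))"
    using v by (simp add: phi1_def U_def X_def powr_of_real exp_of_real[symmetric])
  have "Re (U (of_real v)) > 0" using v by (intro Re_U_pos) auto
  then have X: "X > 0" using v by (simp add: U_def X_def powr_of_real)
  have "X \<le> v / 4" by (simp add: X_def)
  moreover have "1 - X \<le> exp (- X)" using exp_ge_add_one_self[of "- X"] by simp
  moreover have "exp (- X) \<le> 1" using X by simp
  moreover have "\<rho> * (1 - X) \<le> \<rho> * exp (- X)" using \<rho> exp_ge_add_one_self[of "- X"] by (intro mult_left_mono) auto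
  moreover have "\<rho> * exp (- X) \<le> 1 * 1" using \<rho> X by (intro mult_mono) auto
  moreover have "\<rho> * X \<le> 1 * X" using \<rho> X by (intro mult_right_mono) auto
  ultimately have "0 \<le> 1 - \<rho> * exp (- X)" "1 - \<rho> * exp (- X) \<le> 2 * (1 - \<rho>)"
    using \<rho> by (auto simp: v_def algebra_simps)
  moreover have "1 - of_real \<rho> * phi1 (of_real (- \<rho>)) = of_real (1 - \<rho> * exp (- X))"
    unfolding ph by simp
  ultimately show "cmod (1 - of_real \<rho> * phi1 (of_real (- \<rho>))) \<le> 2 * (1 - \<rho>)"
    by (metis abs_of_nonneg norm_of_real)
qed

lemma symbols:
  "symbol phi1" "symbol phi2"
  "AE \<zeta> in circle_measure. cmod (radial_limit phi1 \<zeta>) = cmod (radial_limit phi2 \<zeta>)"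
proof -
  have r: "radial_limit phi1 (cis t) = phi1 (cis t)" "radial_limit phi2 (cis t) = phi2 (cis t)"
    if "t \<in> {-pi<..<pi}" for t
    using Re_cis_gt[OF that] by (auto intro: radial_limit_eq phi_holomorphic)
  have "AE \<zeta> in circle_measure. cmod (radial_limit phi1 \<zeta>) < 1"
    "AE \<zeta> in circle_measure. cmod (radial_limit phi2 \<zeta>) < 1"
    by (rule AE_circle_cis, simp add: r norm_phi_cis sigma_pos)+
  then show "symbol phi1" "symbol phi2"
    unfolding symbol_def
    using phi_disc holomorphic_on_subset[OF phi_holomorphic(1) disc_subset]
      holomorphic_on_subset[OF phi_holomorphic(2) disc_subset] by auto
  show "AE \<zeta> in circle_measure. cmod (radial_limit phi1 \<zeta>) = cmod (radial_limit phi2 \<zeta>)"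
    by (rule AE_circle_cis) (simp add: r norm_phi_cis)
qed

end

theorem theorem4p2:
  fixes p :: real
  assumes "p > 2"
  shows "\<exists>\<phi>\<^sub>1 \<phi>\<^sub>2. symbol \<phi>\<^sub>1 \<and> symbol \<phi>\<^sub>2 \<and>
    (AE \<zeta> in circle_measure. cmod (radial_limit \<phi>\<^sub>1 \<zeta>) = cmod (radial_limit \<phi>\<^sub>2 \<zeta>)) \<and>
    \<not> compact_operator (composition_operator \<phi>\<^sub>1) \<and>
    composition_operator \<phi>\<^sub>2 \<in> schatten_class p"
proof -
  define q where "q = p / 2"
  \<comment> \<open>The cap 1 / 2 keeps \<alpha> below 2, and \<open>(q - 1) / 4\<close> is half of
    the excess over 1 that \<open>kernel_integrable\<close> permits, so the inequality is strict for
    every q > 1.\<close>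
  define \<alpha> where "\<alpha> = 1 + min (1 / 2) ((q - 1) / 4)"
  have q: "q > 1" using assms by (simp add: q_def)
  interpret exponent \<alpha>
    by standard (use q in \<open>auto simp: \<alpha>_def\<close>)
  have "(q - 1) / 2 - \<alpha> > -1" using q by (auto simp: \<alpha>_def min_def)
  then have "composition_operator phi2 \<in> schatten_class (2 * q)" by (rule phi2_schatten[OF q])
  then show ?thesis using symbols phi1_not_compact by (auto simp: q_def)
qed

end
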